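(* Suppose Assumptions 1 and 2 (in the context) hold. Let $K\ge0$, $N\ge0$ be integers and run ARDCA with restart (context) from $u^{0,0}\in\mathbb{D}$. Put $\rho=\frac{1+(1-\theta_0)\kappa}{1+\frac{\kappa}{2}\left(\frac{K}{2\widehat n}+1\right)^2}$ and $T_{0,0}=(1-\theta_0)(D(u^{0,0})-D(u^* ))+\|u^{0,0}-u^{0,0,*}\|_L^2$ where $u^{0,0,*}=\mathrm{Proj}_{\mathbb{D}^*}(u^{0,0})$. Then $$(1-\theta_0)\left(\mathbb{E}_{\zeta_N}[D(u^{N,0})]-D(u^* )\right)+\mathbb{E}_{\zeta_N}[\|u^{N,0}-u^{N,0,*}\|_L^2]\le\rho^NT_{0,0},$$ where $u^{N,0,*}=\mathrm{Proj}_{\mathbb{D}^*}(u^{N,0})$. Suppose moreover that $\mathbb{D}^*$ is bounded with $\|u^*\|_L\le C_{\mathbb{D}^*}$ for all $u^*\in\mathbb{D}^*$, that $K\ge\widehat n$, and that $K_0$ is a nonnegative integer with $K_0\le\left\lfloor\frac{K}{\upsilon(1+1/\widehat n)}+1\right\rfloor$ for some $\upsilon>1$. Then $$\left|\mathbb{E}_{\zeta_N}[F(\hat x^{N,K})]-F(x^* )\right|\le C_1\rho^{N/2}+C_2\rho^N,\qquad \mathbb{E}_{\zeta_N}\left[\left\|\begin{bmatrix}B\hat x^{N,K}+b\\ \max\{0,g(\hat x^{N,K})\}\end{bmatrix}\right\|_L^*\right]\le C_3\rho^{N/2},$$ with $C_1=\frac{6C_{\mathbb{D}^*}\sqrt{T_{0,0}}+6M\sqrt{\sum_{i=1}^nL_i}\sqrt{T_{0,0}}}{1-1/\upsilon}+\frac{2\sqrt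 m\,C_{\mathbb{D}^*}\sqrt{T_{0,0}}}{\sqrt{1-1/\upsilon}}$, $C_2=\frac{2T_{0,0}}{1-1/\upsilon}$, $C_3=\frac{6\sqrt{T_{0,0}}}{1-1/\upsilon}$.
   Context: Data: integers $n,t\ge1$, $p,m\ge0$; $A\in\mathbb{R}^{t\times n}$ with columns $A_1,\dots,A_n$; $B\in\mathbb{R}^{p\times t}$ with rows $B_{j,:}$; $b\in\mathbb{R}^p$; $f:\mathbb{R}^t\to\mathbb{R}$, $\phi_i:\mathbb{R}\to\mathbb{R}$, $g_i:\mathbb{R}^t\to\mathbb{R}$, $g=(g_1,\dots,g_m)$. Primal problem: minimize $F(x)=f(x)+\frac1n\sum_{i=1}^n\phi_i(A_i^Tx)$ s.t. $Bx+b=0$, $g_i(x)\le0$; $x^*$ its optimal solution. Assumption 1: (1) $f$ $\mu$-strongly convex ($\mu>0$); (2) each $\phi_i$ convex and $M$-Lipschitz; (3) each $g_i$ convex with all subgradients of norm $\le L_{g_i}$; (4) some $\bar x$ has $g_i(\bar x)<0$ $\forall i$ and $B\bar x+b=0$; (5) finite optimal value. Dual: $\widehat n=n+p+m$, $\mathbb{D}=\{u\in\mathbb{R}^{\widehat n}:u_{n+p+1},\dots,u_{\widehat n}\ge0\}$, $L_f(x,u)=f(x)+\langle u_{1:n},A^Tx/n\rangle+\langle u_{n+1:n+p},Bx+b\rangle+\sum_iu_{n+p+i}g_i(x)$, $x^*(u)=\arg\min_xL_f(x,u)$, $d(u)=-L_f(x^*(u),u)$, $h_i=\frac1n\phi_i^*$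 ($i\le n$), $h_i\equiv0$ ($n<i\le n+p$), $h_i$ = indicator of $[0,\infty)$ ($i>n+p$), $D(u)=d(u)+\sum_ih_i(u_i)$; $\nabla d(u)=-[(A^Tx^*(u)/n)^T,(Bx^*(u)+b)^T,g(x^*(u))^T]^T$ on $\mathbb{D}$. $\mathbb{D}^*$ is the set of minimizers of $D$, $u^*\in\mathbb{D}^*$ arbitrary. $L_j=\|A_j\|^2/(n^2\mu)$ ($j\le n$), $\|B_{j-n,:}\|^2/\mu$ ($n<j\le n+p$), $L_{g_{j-n-p}}^2/\mu$ ($j>n+p$); $\|w\|_L=\sqrt{\sum L_iw_i^2}$, $\|w\|_L^*=\sqrt{\sum w_i^2/L_i}$ (for $[Bx+b;\max\{0,g(x)\}]$ use weights $L_{n+1},\dots,L_{\widehat n}$). $\mathrm{Proj}_{\mathbb{D}^*}(u)=\arg\min_{w\in\mathbb{D}^*}\|u-w\|_L$. Assumption 2: there is $\kappa>0$ with $\kappa\|u-\mathrm{Proj}_{\mathbb{D}^*}(u)\|_L^2\le D(u)-D(u^* )$ for all $u$. ARDCA$(u^0,K_0,K)$: $\theta_0=1/\widehat n$, $\theta_{k+1}=\frac{\sqrt{\theta_k^4+4\theta_k^2}-\theta_k^2}{2}$; $z^0=u^0$; for $k=0..K$: $v^k=\theta_kz^k+(1-\theta_k)u^k$; $i_k$ uniform on $\{1..\widehat n\}$ independent; $z^{k+1}_{i_k}=\arg\min_w\widehat n\theta_kL_{i_k}(w-z^k_{i_k})^2+\nabla_{i_k}d(v^k)(w-z^k_{i_k})+h_{i_k}(w)$,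 other coordinates unchanged; $u^{k+1}=v^k+\widehat n\theta_k(z^{k+1}-z^k)$; outputs $\hat x^K=\frac{\sum_{k=K_0}^Kx^*(v^k)/\theta_k}{\sum_{k=K_0}^K1/\theta_k}$ and $u^{K+1}$. ARDCA with restart: given $u^{0,0}\in\mathbb{D}$, for $t=0,1,\dots,N$ run ARDCA$(u^{t,0},K_0,K)$ (fresh randomness), obtaining $u^{t,K+1}$ and $\hat x^{t,K}$, and set $u^{t+1,0}=u^{t,K+1}$. $\xi_{t,K}$ is the random index sequence of the $t$-th run and $\zeta_t=\bigcup_{r\le t}\xi_{r,K}$. *)

theory Defs
  imports "HOL-Analysis.Analysis"
begin

text \<open>Problem data.  Dual coordinates are 0-based: indices i < n correspond to
  the columns A_i, indices n <= i < n+p to the rows of B (and b), indices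
  n+p <= i < n+p+m to the constraints g.  Primal space R^t is an arbitrary
  euclidean space 'a.\<close>

record 'a cprob =
  nn  :: nat
  pp  :: nat
  mm  :: nat
  AA  :: "nat \<Rightarrow> 'a"
  Bro :: "nat \<Rightarrow> 'a"
  bb  :: "nat \<Rightarrow> real"
  ff  :: "'a \<Rightarrow> real"
  phi :: "nat \<Rightarrow> real \<Rightarrow> real"
  gg  :: "nat \<Rightarrow> 'a \<Rightarrow> real"
  Lg  :: "nat \<Rightarrow> real"
  mu  :: real
  MM  :: real

definition strongly_convex :: "real \<Rightarrow> ('a::real_normed_vector \<Rightarrow> real) \<Rightarrow> bool" where
  "strongly_convex c f \<longleftrightarrow> (\<forall>x y t. 0 \<le> t \<and> t \<le> 1 \<longrightarrow>
      f (t *\<^sub>R x + (1 - t) *\<^sub>R y) \<le> t * f x + (1 - t) * f y - c / 2 * t * (1 - t) * (norm (x - y))\<^sup>2)"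

definition nhat :: "'a cprob \<Rightarrow> nat" where
  "nhat P = nn P + pp P + mm P"

definition Fobj :: "('a::real_inner) cprob \<Rightarrow> 'a \<Rightarrow> real" where
  "Fobj P x = ff P x + (1 / real (nn P)) * (\<Sum>i<nn P. phi P i (AA P i \<bullet> x))"

definition feasible :: "('a::real_inner) cprob \<Rightarrow> 'a \<Rightarrow> bool" where
  "feasible P x \<longleftrightarrow> (\<forall>j<pp P. Bro P j \<bullet> x + bb P j = 0) \<and> (\<forall>j<mm P. gg P j x \<le> 0)"

definition Lagr :: "('a::real_inner) cprob \<Rightarrow> 'a \<Rightarrow> (nat \<Rightarrow> real) \<Rightarrow> real" where
  "Lagr P x u = ff P x + (\<Sum>i<nn P. u i * ((AA P i \<bullet> x) / real (nn P)))
     + (\<Sum>j<pp P. u (nn P + j) * (Bro P j \<bullet> x + bb P j))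
     + (\<Sum>j<mm P. u (nn P + pp P + j) * gg P j x)"

definition xst :: "('a::real_inner) cprob \<Rightarrow> (nat \<Rightarrow> real) \<Rightarrow> 'a" where
  "xst P u = (SOME x. \<forall>y. Lagr P x u \<le> Lagr P y u)"

definition dval :: "('a::real_inner) cprob \<Rightarrow> (nat \<Rightarrow> real) \<Rightarrow> real" where
  "dval P u = - Lagr P (xst P u) u"

definition gradd :: "('a::real_inner) cprob \<Rightarrow> (nat \<Rightarrow> real) \<Rightarrow> nat \<Rightarrow> real" where
  "gradd P u i = (let x = xst P u in
     if i < nn P then - ((AA P i \<bullet> x) / real (nn P))
     else if i < nn P + pp P then - (Bro P (i - nn P) \<bullet> x + bb P (i - nn P))
     else - gg P (i - nn P - pp P) x)"

definition conjugate :: "(real \<Rightarrow> real) \<Rightarrow> real \<Rightarrow> ereal" where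
  "conjugate f y = (SUP x. ereal (y * x - f x))"

definition hfun :: "'a cprob \<Rightarrow> nat \<Rightarrow> real \<Rightarrow> ereal" where
  "hfun P i w = (if i < nn P then ereal (1 / real (nn P)) * conjugate (phi P i) w
     else if i < nn P + pp P then 0
     else if 0 \<le> w then 0 else \<infinity>)"

definition Dfun :: "('a::real_inner) cprob \<Rightarrow> (nat \<Rightarrow> real) \<Rightarrow> ereal" where
  "Dfun P u = ereal (dval P u) + (\<Sum>i<nhat P. hfun P i (u i))"

definition Dset :: "'a cprob \<Rightarrow> (nat \<Rightarrow> real) set" where
  "Dset P = {u. \<forall>i. nn P + pp P \<le> i \<and> i < nhat P \<longrightarrow> 0 \<le> u i}"

definition Lc :: "('a::real_normed_vector) cprob \<Rightarrow> nat \<Rightarrow> real" where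
  "Lc P i = (if i < nn P then (norm (AA P i))\<^sup>2 / ((real (nn P))\<^sup>2 * mu P)
     else if i < nn P + pp P then (norm (Bro P (i - nn P)))\<^sup>2 / mu P
     else (Lg P (i - nn P - pp P))\<^sup>2 / mu P)"

definition normL :: "('a::real_normed_vector) cprob \<Rightarrow> (nat \<Rightarrow> real) \<Rightarrow> real" where
  "normL P w = sqrt (\<Sum>i<nhat P. Lc P i * (w i)\<^sup>2)"

definition constr_dnorm :: "('a::real_inner) cprob \<Rightarrow> 'a \<Rightarrow> real" where
  "constr_dnorm P x = sqrt ((\<Sum>j<pp P. (Bro P j \<bullet> x + bb P j)\<^sup>2 / Lc P (nn P + j))
     + (\<Sum>j<mm P. (max 0 (gg P j x))\<^sup>2 / Lc P (nn P + pp P + j)))"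

definition Dstar :: "('a::real_inner) cprob \<Rightarrow> (nat \<Rightarrow> real) set" where
  "Dstar P = {w. \<forall>u. Dfun P w \<le> Dfun P u}"

definition ProjD :: "('a::real_inner) cprob \<Rightarrow> (nat \<Rightarrow> real) \<Rightarrow> (nat \<Rightarrow> real)" where
  "ProjD P u = (SOME w. w \<in> Dstar P \<and> (\<forall>w'\<in>Dstar P. normL P (u - w) \<le> normL P (u - w')))"

fun theta :: "'a cprob \<Rightarrow> nat \<Rightarrow> real" where
  "theta P 0 = 1 / real (nhat P)"
| "theta P (Suc k) = (sqrt ((theta P k)^4 + 4 * (theta P k)\<^sup>2) - (theta P k)\<^sup>2) / 2"

definition coord_min :: "('a::real_inner) cprob \<Rightarrow> real \<Rightarrow> (nat \<Rightarrow> real) \<Rightarrow> (nat \<Rightarrow> real) \<Rightarrow> nat \<Rightarrow> real" where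
  "coord_min P th z v i = (SOME w. \<forall>w'.
      ereal (real (nhat P) * th * Lc P i * (w - z i)\<^sup>2 + gradd P v i * (w - z i)) + hfun P i w
   \<le> ereal (real (nhat P) * th * Lc P i * (w' - z i)\<^sup>2 + gradd P v i * (w' - z i)) + hfun P i w')"

fun ardca_state :: "('a::real_inner) cprob \<Rightarrow> (nat \<Rightarrow> real) \<Rightarrow> (nat \<Rightarrow> nat) \<Rightarrow> nat
    \<Rightarrow> (nat \<Rightarrow> real) \<times> (nat \<Rightarrow> real)" where
  "ardca_state P u0 s 0 = (u0, u0)"
| "ardca_state P u0 s (Suc k) =
     (let zu = ardca_state P u0 s k; z = fst zu; u = snd zu; th = theta P k;
          v = (\<lambda>j. th * z j + (1 - th) * u j);
          i = s k;
          z' = z(i := coord_min P th z v i)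
      in (z', (\<lambda>j. v j + real (nhat P) * th * (z' j - z j))))"

definition ardca_v :: "('a::real_inner) cprob \<Rightarrow> (nat \<Rightarrow> real) \<Rightarrow> (nat \<Rightarrow> nat) \<Rightarrow> nat \<Rightarrow> (nat \<Rightarrow> real)" where
  "ardca_v P u0 s k = (\<lambda>j. theta P k * fst (ardca_state P u0 s k) j
                          + (1 - theta P k) * snd (ardca_state P u0 s k) j)"

definition ardca_u :: "('a::real_inner) cprob \<Rightarrow> (nat \<Rightarrow> real) \<Rightarrow> (nat \<Rightarrow> nat) \<Rightarrow> nat \<Rightarrow> (nat \<Rightarrow> real)" where
  "ardca_u P u0 s k = snd (ardca_state P u0 s k)"

definition ardca_xhat :: "('a::real_inner) cprob \<Rightarrow> (nat \<Rightarrow> real) \<Rightarrow> (nat \<Rightarrow> nat) \<Rightarrow> nat \<Rightarrow> nat \<Rightarrow> 'a" where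
  "ardca_xhat P u0 s K0 K =
     inverse (\<Sum>k=K0..K. 1 / theta P k) *\<^sub>R (\<Sum>k=K0..K. (1 / theta P k) *\<^sub>R xst P (ardca_v P u0 s k))"

fun restart_u :: "('a::real_inner) cprob \<Rightarrow> (nat \<Rightarrow> real) \<Rightarrow> nat \<Rightarrow> (nat \<Rightarrow> nat \<Rightarrow> nat) \<Rightarrow> nat \<Rightarrow> (nat \<Rightarrow> real)" where
  "restart_u P u00 K s 0 = u00"
| "restart_u P u00 K s (Suc t) = ardca_u P (restart_u P u00 K s t) (s t) (Suc K)"

definition restart_xhat :: "('a::real_inner) cprob \<Rightarrow> (nat \<Rightarrow> real) \<Rightarrow> nat \<Rightarrow> nat \<Rightarrow> (nat \<Rightarrow> nat \<Rightarrow> nat) \<Rightarrow> nat \<Rightarrow> 'a" where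
  "restart_xhat P u00 K0 K s t = ardca_xhat P (restart_u P u00 K s t) (s t) K0 K"

text \<open>All realisations of zeta_N: index i_k of run t (t <= N, k <= K) in {0..<nh};
  unused entries fixed to 0.  Uniform independent indices = uniform over this finite set.\<close>
definition index_seqs :: "nat \<Rightarrow> nat \<Rightarrow> nat \<Rightarrow> (nat \<Rightarrow> nat \<Rightarrow> nat) set" where
  "index_seqs nh N K = {s. \<forall>t k. (t \<le> N \<and> k \<le> K \<longrightarrow> s t k < nh) \<and> (\<not> (t \<le> N \<and> k \<le> K) \<longrightarrow> s t k = 0)}"

definition expect :: "nat \<Rightarrow> nat \<Rightarrow> nat \<Rightarrow> ((nat \<Rightarrow> nat \<Rightarrow> nat) \<Rightarrow> real) \<Rightarrow> real" where
  "expect nh N K X = (\<Sum>s\<in>index_seqs nh N K. X s) / real (card (index_seqs nh N K))"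

definition expectE :: "nat \<Rightarrow> nat \<Rightarrow> nat \<Rightarrow> ((nat \<Rightarrow> nat \<Rightarrow> nat) \<Rightarrow> ereal) \<Rightarrow> ereal" where
  "expectE nh N K X = (\<Sum>s\<in>index_seqs nh N K. X s) / ereal (real (card (index_seqs nh N K)))"

end

theory Submission
  imports Defs
begin

text \<open>Each step decreases, in conditional expectation, the sum of the weighted dual gap
  (with \<open>run_H\<close>, a convex majorant of the regularizer) and the squared distance of \<open>z\<close> to any
  dual solution, with half of the squared step length to spare.  For the restart, the distance of
  the last \<open>u\<close> to the dual solutions is also needed: since \<open>u\<close> is an average of the \<open>z\<close>-iterates,
  its distance is below the initial potential by a multiple \<open>\<ge> max 1 (Xw / 2)\<close> of the final
  dual gap, and quadratic growth turns this into the factor \<open>\<rho>\<close>.  For the primal bounds, the optimality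
  condition of the prox step expresses the averaged constraint residual by the displacement of \<open>z\<close>
  plus a martingale, whose variance is paid for by the spare step lengths.\<close>

subsection \<open>Convex functions\<close>

text \<open>The spare half of the squared step comes from the quadratic in \<open>coord_min\<close>:
  its weight \<open>nhat P * th * Lc P i\<close> has no factor 1/2, twice what coordinate smoothness
  consumes. The new \<open>u\<close> contains the old \<open>z\<close> with the negative coefficient
  \<open>theta P k * (1 - nhat P)\<close>, so the regularizer at \<open>u\<close> cannot be bounded
  term by term in one step. \<open>run_H\<close> carries the same signed combination of values,
  whose conditional expectation is exact; convexity is used on an unrolled form where
  \<open>theta_ratio\<close> makes all weights nonnegative. Dual values are extended reals. With a
  finite initial potential, the start point can leave \<open>indom\<close> only if
  \<open>nhat P = 1\<close>: then \<open>theta P 0 = 1\<close>, the initial gap has weight 0, and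
  the first step replaces the only coordinate. The 1/2 before \<open>kappa\<close> in
  \<open>rho\<close> is the loss in the weight bound \<open>Xw / 2 \<le> S\<close>. The 6 in the
  primal constants rounds up \<open>4 / 5 * 2 * (2 + sqrt 2)\<close>: the distance of
  \<open>z\<close> at both ends of the averaging window, the martingale, and the lower bound
  \<open>5 / 4 * (1 - 1 / ups)\<close> for the normalised total weight.\<close>

lemma convex_on_subgradient_exists:
  fixes g :: "'a::euclidean_space \<Rightarrow> real"
  assumes cvx: "convex_on UNIV g"
  obtains s where "\<And>y. g x + s \<bullet> (y - x) \<le> g y"
proof -
  \<comment> \<open>Separating the graph point from the strict epigraph gives a supporting
    hyperplane whose slope is minus \<open>fst a / snd a\<close>; strictness makes the two sets
    disjoint.\<close>
  let ?S = "{(x, g x)}" and ?T = "{yr. g (fst yr) < snd yr}"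
  have T: "convex ?T"
  proof (rule convexI, simp, goal_cases)
    case (1 a b u v)
    have "g (u *\<^sub>R fst a + v *\<^sub>R fst b) \<le> u * g (fst a) + v * g (fst b)"
      using cvx 1 unfolding convex_on_def by auto
    moreover have "u * g (fst a) + v * g (fst b) < u * snd a + v * snd b"
    proof (cases "u = 0")
      case False
      then have "u * g (fst a) < u * snd a" using 1 by simp
      moreover have "v * g (fst b) \<le> v * snd b" using 1 by (intro mult_left_mono) auto
      ultimately show ?thesis by linarith
    qed (use 1 in auto)
    ultimately show ?case by simp
  qed
  have ne: "?T \<noteq> {}"
    by (auto intro!: exI[of _ x] exI[of _ "g x + 1"])
  have disj: "?S \<inter> ?T = {}" by auto
  obtain a b where ab: "a \<noteq> 0" "\<forall>w\<in>?S. a \<bullet> w \<le> b" "\<forall>w\<in>?T. b \<le> a \<bullet> w"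
    using separating_hyperplane_sets[OF convex_singleton T _ ne disj] by auto
  have key: "fst a \<bullet> x + snd a * g x \<le> fst a \<bullet> y + snd a * r" if "g y < r" for y r
    using ab(2) ab(3)[rule_format, of "(y, r)"] that by (auto simp: inner_prod_def)
  have "0 \<le> snd a" using key[of x "g x + 1"] by (simp add: algebra_simps)
  \<comment> \<open>A vertical hyperplane is impossible because \<open>g\<close> is finite
    everywhere: testing it at \<open>x - fst a\<close> would force \<open>fst a = 0\<close>
    too.\<close>
  moreover have "snd a \<noteq> 0"
  proof
    assume 0: "snd a = 0"
    have "fst a \<bullet> x \<le> fst a \<bullet> (x - fst a)"
      using key[of "x - fst a" "g (x - fst a) + 1"] 0 by simp
    then have "fst a \<bullet> fst a \<le> 0" by (simp add: inner_diff_right)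
    then have "fst a = 0" by (metis inner_eq_zero_iff inner_ge_zero order_antisym)
    with 0 ab(1) show False by (simp add: prod_eq_iff)
  qed
  ultimately have pos: "0 < snd a" by simp
  have "g x + (- (1 / snd a) *\<^sub>R fst a) \<bullet> (y - x) \<le> g y" for y
  proof (rule field_le_epsilon)
    fix e :: real assume "0 < e"
    then have "fst a \<bullet> x + snd a * g x \<le> fst a \<bullet> y + snd a * (g y + e)" by (intro key) simp
    then have "(fst a \<bullet> x) / snd a + g x \<le> (fst a \<bullet> y) / snd a + (g y + e)"
      using pos divide_right_mono[of "fst a \<bullet> x + snd a * g x" _ "snd a"] by (fastforce simp: add_divide_distrib)
    then show "g x + (- (1 / snd a) *\<^sub>R fst a) \<bullet> (y - x) \<le> g y + e"
      by (simp add: inner_diff_right right_diff_distrib)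
  qed
  then show thesis by (rule that)
qed

text \<open>A subgradient at the point with the larger value bounds the difference; Cauchy-Schwarz
  turns its norm bound into a Lipschitz constant.\<close>

lemma subgradient_bound_imp_lipschitz:
  fixes g :: "'a::euclidean_space \<Rightarrow> real"
  assumes cvx: "convex_on UNIV g"
    and bnd: "\<And>x s. (\<forall>y. g y \<ge> g x + s \<bullet> (y - x)) \<Longrightarrow> norm s \<le> l"
  shows "\<bar>g x - g y\<bar> \<le> l * norm (x - y)"
proof -
  have *: "g x - g y \<le> l * norm (x - y)" for x y
  proof -
    obtain s where s: "\<And>y. g x + s \<bullet> (y - x) \<le> g y"
      using convex_on_subgradient_exists[OF cvx] by blast
    have "g x - g y \<le> s \<bullet> (x - y)" using s[of y] by (simp add: inner_diff_right)
    also have "\<dots> \<le> norm s * norm (x - y)" by (rule norm_cauchy_schwarz)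
    also have "\<dots> \<le> l * norm (x - y)" using bnd s by (intro mult_right_mono) auto
    finally show ?thesis .
  qed
  show ?thesis using *[of x y] *[of y x] by (simp add: norm_minus_commute)
qed

lemma strongly_convex_imp_convex_on:
  assumes "strongly_convex c f" "0 \<le> c"
  shows "convex_on UNIV f"
proof (rule convex_onI)
  fix t x y assume t: "0 < t" "t < (1::real)"
  have "f ((1 - t) *\<^sub>R x + t *\<^sub>R y) \<le> (1 - t) * f x + t * f y - c / 2 * (1 - t) * t * (norm (x - y))\<^sup>2"
    using assms(1)[unfolded strongly_convex_def, rule_format, of "1 - t" x y] t by simp
  moreover have "0 \<le> c / 2 * (1 - t) * t * (norm (x - y))\<^sup>2" using t assms(2) by simp
  ultimately show "f ((1 - t) *\<^sub>R x + t *\<^sub>R y) \<le> (1 - t) * f x + t * f y" by linarith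
qed simp

lemma strongly_convex_add:
  assumes "strongly_convex c f" "convex_on UNIV g"
  shows "strongly_convex c (\<lambda>x. f x + g x)"
  unfolding strongly_convex_def
proof (intro allI impI)
  fix x y and t :: real assume t: "0 \<le> t \<and> t \<le> 1"
  have "f (t *\<^sub>R x + (1 - t) *\<^sub>R y) \<le> t * f x + (1 - t) * f y - c / 2 * t * (1 - t) * (norm (x - y))\<^sup>2"
    using assms(1) t by (simp add: strongly_convex_def)
  moreover have "g (t *\<^sub>R x + (1 - t) *\<^sub>R y) \<le> t * g x + (1 - t) * g y"
    using assms(2) t unfolding convex_on_def by simp
  ultimately show "f (t *\<^sub>R x + (1 - t) *\<^sub>R y) + g (t *\<^sub>R x + (1 - t) *\<^sub>R y)
    \<le> t * (f x + g x) + (1 - t) * (f y + g y) - c / 2 * t * (1 - t) * (norm (x - y))\<^sup>2"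
    by (simp add: algebra_simps)
qed

text \<open>Compactness bounds \<open>G\<close> from below on the unit ball. Along a ray from the
  origin the quadratic term then lifts \<open>G\<close> above \<open>G 0\<close> outside an explicit
  radius \<open>R\<close>, so a minimizer over that ball is global.\<close>

lemma strongly_convex_attains_min:
  fixes G :: "'a::euclidean_space \<Rightarrow> real"
  assumes sc: "strongly_convex c G" and c: "0 < c"
  obtains x where "\<And>y. G x \<le> G y"
proof -
  have cont: "continuous_on UNIV G"
    using strongly_convex_imp_convex_on[OF sc] c by (intro convex_on_continuous) auto
  have "\<exists>w\<in>cball 0 r. \<forall>y\<in>cball 0 r. G w \<le> G y" if "0 \<le> r" for r
    using that by (intro continuous_attains_inf continuous_on_subset[OF cont]) auto
  note inf = this
  obtain w where w: "\<And>y. y \<in> cball 0 1 \<Longrightarrow> G w \<le> G y" using inf[of 1] by force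
  define R where "R = 1 + 2 * (G 0 - G w) / c"
  have R1: "1 \<le> R" using w[of 0] c by (simp add: R_def)
  obtain x where x: "x \<in> cball 0 R" "\<And>y. y \<in> cball 0 R \<Longrightarrow> G x \<le> G y"
    using inf[of R] R1 by force
  have "G x \<le> G y" for y
  proof (cases "norm y \<le> R")
    case False
    define r where "r = norm y"
    have r: "r > R" using False by (simp add: r_def)
    then have r1: "r > 1" using R1 by simp
    have "G w \<le> G ((1 / r) *\<^sub>R y)" using r1 by (intro w) (simp add: r_def)
    also have "\<dots> \<le> (1/r) * G y + (1 - 1/r) * G 0 - c / 2 * (1/r) * (1 - 1/r) * r\<^sup>2"
      using sc[unfolded strongly_convex_def, rule_format, of "1/r" y 0] r1
      by (simp add: r_def divide_le_eq_1)
    finally have "r * G w \<le> r * ((1/r) * G y + (1 - 1/r) * G 0 - c / 2 * (1/r) * (1 - 1/r) * r\<^sup>2)"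
      using r1 by (intro mult_left_mono) auto
    also have "\<dots> = G y + (r - 1) * G 0 - c / 2 * (r - 1) * r"
      using r1 by (simp add: field_simps power2_eq_square)
    finally have 1: "r * (G w - G 0 + c / 2 * (r - 1)) \<le> G y - G 0" by (simp add: algebra_simps)
    have "2 * (G 0 - G w) / c < r - 1" using r by (simp add: R_def)
    then have "2 * (G 0 - G w) < (r - 1) * c" using c by (simp add: field_simps)
    then have "0 \<le> r * (G w - G 0 + c / 2 * (r - 1))" using r1
      by (intro mult_nonneg_nonneg) (auto simp: field_simps)
    with 1 have "G 0 \<le> G y" by simp
    moreover have "G x \<le> G 0" using R1 by (intro x) simp
    ultimately show ?thesis by simp
  qed (use x in simp)
  then show thesis by (rule that)
qed

text \<open>The limit t to 0, by which comparisons along a segment become first-order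
  conditions.\<close>

lemma linear_quadratic_nonneg_imp:
  fixes a b :: real
  assumes "\<And>t. 0 < t \<Longrightarrow> t < 1 \<Longrightarrow> 0 \<le> a + b * t"
  shows "0 \<le> a"
proof (rule tendsto_lowerbound[where F = "at_right 0" and f = "\<lambda>t. a + b * t"])
  show "((\<lambda>t. a + b * t) \<longlongrightarrow> a) (at_right 0)"
    by (rule tendsto_eq_intros refl)+ simp
  show "\<forall>\<^sub>F t in at_right 0. 0 \<le> a + b * t"
    using eventually_at_right_less eventually_at_right_real[of 0 1] 
    by (auto elim!: eventually_mono intro: assms)
qed simp

text \<open>Comparing the minimizer with \<open>t *\<^sub>R y + (1 - t) *\<^sub>R x\<close> and
  dividing by \<open>t\<close> leaves a defect linear in \<open>t\<close>, which disappears in the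
  limit.\<close>

lemma strongly_convex_min_growth:
  assumes sc: "strongly_convex c G" and min: "\<And>y. G x \<le> G y"
  shows "G x + c / 2 * (norm (y - x))\<^sup>2 \<le> G y"
proof -
  let ?a = "G y - G x - c / 2 * (norm (y - x))\<^sup>2"
  have "0 \<le> ?a + (c / 2 * (norm (y - x))\<^sup>2) * t" if t: "0 < t" "t < 1" for t
  proof -
    have "G x \<le> t * G y + (1 - t) * G x - c / 2 * t * (1 - t) * (norm (y - x))\<^sup>2"
      using sc[unfolded strongly_convex_def, rule_format, of t y x] min[of "t *\<^sub>R y + (1 - t) *\<^sub>R x"] t
      by auto
    then have "0 \<le> t * (?a + (c / 2 * (norm (y - x))\<^sup>2) * t)" by (simp add: field_simps)
    then show ?thesis using t by (simp add: zero_le_mult_iff)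
  qed
  from linear_quadratic_nonneg_imp[OF this] show ?thesis by simp
qed

text \<open>The supremum of a nonempty affine family excludes the value minus infinity, splits upper
  bounds into real affine inequalities, and is the shape in which a conjugate is given
  anyway.\<close>

definition proper_closed_convex :: "(real \<Rightarrow> ereal) \<Rightarrow> bool" where
  "proper_closed_convex h \<longleftrightarrow> (\<exists>A. A \<noteq> {} \<and> h = (\<lambda>w. SUP ab\<in>A. ereal (fst ab * w + snd ab)))
     \<and> (\<exists>w. h w < \<infinity>)"

context
  fixes h :: "real \<Rightarrow> ereal"
  assumes h: "proper_closed_convex h"
begin

lemma pcc_finite: "h w \<noteq> - \<infinity>" "h w < \<infinity> \<Longrightarrow> h w = ereal (real_of_ereal (h w))"
proof -
  obtain A where A: "A \<noteq> {}" "h = (\<lambda>w. SUP ab\<in>A. ereal (fst ab * w + snd ab))"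
    using h unfolding proper_closed_convex_def by blast
  then obtain ab where "ab \<in> A" by blast
  then have "ereal (fst ab * w + snd ab) \<le> h w" using A(2) by (auto intro: SUP_upper)
  then show "h w \<noteq> - \<infinity>" by auto
  then show "h w < \<infinity> \<Longrightarrow> h w = ereal (real_of_ereal (h w))" by (cases "h w") auto
qed

lemma pcc_le_iff:
  obtains A where "A \<noteq> {}" "\<And>w c. h w \<le> ereal c \<longleftrightarrow> (\<forall>ab\<in>A. fst ab * w + snd ab \<le> c)"
proof -
  obtain A where A: "A \<noteq> {}" "h = (\<lambda>w. SUP ab\<in>A. ereal (fst ab * w + snd ab))"
    using h unfolding proper_closed_convex_def by blast
  show thesis by (rule that[OF A(1)]) (simp add: A(2) SUP_le_iff)
qed

lemma pcc_convex:
  assumes "h x < \<infinity>" "h y < \<infinity>" "0 \<le> a" "0 \<le> b" "a + b = 1"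
  shows "h (a * x + b * y) < \<infinity>"
    "real_of_ereal (h (a * x + b * y)) \<le> a * real_of_ereal (h x) + b * real_of_ereal (h y)"
proof -
  obtain A where A: "A \<noteq> {}" "\<And>w c. h w \<le> ereal c \<longleftrightarrow> (\<forall>ab\<in>A. fst ab * w + snd ab \<le> c)"
    using pcc_le_iff by blast
  let ?r = "\<lambda>w. real_of_ereal (h w)"
  have r: "fst p * w + snd p \<le> ?r w" if "h w < \<infinity>" "p \<in> A" for p w
    using A(2)[of w "?r w"] pcc_finite(2)[OF that(1)] that(2) by auto
  have "fst p * (a * x + b * y) + snd p \<le> a * ?r x + b * ?r y" if "p \<in> A" for p
  proof -
    have "fst p * (a * x + b * y) + snd p = a * (fst p * x + snd p) + b * (fst p * y + snd p)"
      using arg_cong[OF assms(5), of "\<lambda>t. t * snd p"] by (simp add: algebra_simps)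
    also have "\<dots> \<le> a * ?r x + b * ?r y"
      using assms r that by (intro add_mono mult_left_mono) auto
    finally show ?thesis .
  qed
  then have le: "h (a * x + b * y) \<le> ereal (a * ?r x + b * ?r y)" using A(2) by blast
  then show 1: "h (a * x + b * y) < \<infinity>" by (cases "h (a * x + b * y)") auto
  show "?r (a * x + b * y) \<le> a * ?r x + b * ?r y"
    using le pcc_finite(2)[OF 1] by (metis ereal_less_eq(3))
qed

text \<open>The objective is extended-valued and need not be continuous, so the minimum is sought
  over a compact piece \<open>E\<close> of its epigraph, on which the height \<open>snd\<close> is
  continuous.\<close>

lemma pcc_prox_exists:
  fixes q b z :: real
  assumes q: "0 < q"
  obtains w where "\<And>w'. ereal (q * (w - z)\<^sup>2 + b * (w - z)) + h w
                        \<le> ereal (q * (w' - z)\<^sup>2 + b * (w' - z)) + h w'"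
proof -
  obtain A where A: "A \<noteq> {}" "\<And>w c. h w \<le> ereal c \<longleftrightarrow> (\<forall>ab\<in>A. fst ab * w + snd ab \<le> c)"
    using pcc_le_iff by blast
  define g where "g w = q * (w - z)\<^sup>2 + b * (w - z)" for w
  have le: "ereal (g w) + h w \<le> ereal c \<longleftrightarrow> (\<forall>ab\<in>A. g w + fst ab * w + snd ab \<le> c)" for w c
  proof -
    have "ereal (g w) + h w \<le> ereal c \<longleftrightarrow> h w \<le> ereal (c - g w)"
      by (cases "h w") auto
    also have "\<dots> \<longleftrightarrow> (\<forall>ab\<in>A. g w + fst ab * w + snd ab \<le> c)"
      unfolding A(2) by (auto simp: algebra_simps)
    finally show ?thesis .
  qed
  obtain w0 where w0: "h w0 < \<infinity>" using h unfolding proper_closed_convex_def by blast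
  define c0 where "c0 = g w0 + real_of_ereal (h w0)"
  have c0: "ereal (g w0) + h w0 \<le> ereal c0"
    using pcc_finite(2)[OF w0] unfolding c0_def by (metis order_refl plus_ereal.simps(1))
  obtain p where p: "p \<in> A" using A(1) by blast
  define bet gam where "bet = b + fst p - 2 * q * z" and "gam = q * z\<^sup>2 - b * z + snd p"
  have gp: "g w + fst p * w + snd p = q * w\<^sup>2 + bet * w + gam" for w
    unfolding g_def bet_def gam_def by (simp add: power2_eq_square algebra_simps)
  \<comment> \<open>Completing the square against half of the quadratic: a single affine minorant
    \<open>p\<close> of \<open>h\<close> already makes the objective coercive.\<close>
  have lower: "(q / 2) * w\<^sup>2 - bet\<^sup>2 / (2 * q) + gam \<le> g w + fst p * w + snd p" for w
  proof -
    have "0 \<le> (q * w + bet)\<^sup>2 / (2 * q)" using q by simp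
    also have "\<dots> = q / 2 * w\<^sup>2 + bet * w + bet\<^sup>2 / (2 * q)"
      using q by (simp add: power2_eq_square field_simps)
    finally show ?thesis unfolding gp by simp
  qed
  define lo where "lo = gam - bet\<^sup>2 / (2 * q)"
  define R where "R = 1 + 2 * (c0 - lo) / q"
  define E where "E = {wc :: real \<times> real. (\<forall>ab\<in>A. g (fst wc) + fst ab * fst wc + snd ab \<le> snd wc) \<and> snd wc \<le> c0}"
  have E: "(w, c) \<in> E \<longleftrightarrow> ereal (g w) + h w \<le> ereal c \<and> c \<le> c0" for w c
    by (simp add: E_def le)
  have clE: "closed E"
    unfolding E_def g_def Ball_def
    by (intro closed_Collect_conj closed_Collect_all closed_Collect_imp open_Collect_const closed_Collect_le continuous_intros)
  have sub: "E \<subseteq> {-R..R} \<times> {lo..c0}"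
  proof (clarify, unfold E, elim conjE)
    fix w c assume "ereal (g w) + h w \<le> ereal c" and c: "c \<le> c0"
    then have "g w + fst p * w + snd p \<le> c" unfolding le using p by blast
    with lower[of w] have 1: "q / 2 * w\<^sup>2 + lo \<le> c" unfolding lo_def by simp
    moreover have q2: "0 \<le> q / 2 * w\<^sup>2" using q by simp
    ultimately have "lo \<le> c" by simp
    have "q / 2 * w\<^sup>2 \<le> c0 - lo" using 1 c by simp
    then have w2: "w\<^sup>2 \<le> 2 * (c0 - lo) / q" using q by (simp add: field_simps)
    \<comment> \<open>Keeps square roots out of the radius \<open>R\<close>.\<close>
    have "\<bar>w\<bar> \<le> 1 + w\<^sup>2"
    proof -
      have "0 \<le> (\<bar>w\<bar> - 1)\<^sup>2" by simp
      then show ?thesis unfolding power2_diff by (simp add: power2_abs)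
    qed
    with w2 have "\<bar>w\<bar> \<le> R" unfolding R_def by simp
    with \<open>lo \<le> c\<close> c show "w \<in> {-R..R} \<and> c \<in> {lo..c0}" by auto
  qed
  have "compact ({-R..R} \<times> {lo..c0})" by (intro compact_Times compact_Icc)
  then have "compact E"
    using clE sub by (metis compact_Int_closed inf.absorb2)
  moreover have "(w0, c0) \<in> E" using c0 unfolding E by simp
  ultimately obtain wc where wc: "wc \<in> E" "\<And>v. v \<in> E \<Longrightarrow> snd wc \<le> snd v"
    using continuous_attains_inf[of E snd] by (force intro!: continuous_on_snd continuous_on_id)
  have "ereal (g (fst wc)) + h (fst wc) \<le> ereal (g w') + h w'" for w'
  proof -
    have 1: "ereal (g (fst wc)) + h (fst wc) \<le> ereal (snd wc)" "snd wc \<le> c0"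
      using wc(1) E[of "fst wc" "snd wc"] by auto
    show ?thesis
    proof (cases "h w' < \<infinity>")
      case True
      define c where "c = g w' + real_of_ereal (h w')"
      have c: "ereal (g w') + h w' = ereal c"
        using pcc_finite(2)[OF True] unfolding c_def by (metis plus_ereal.simps(1))
      show ?thesis
      proof (cases "c \<le> c0")
        case True
        then have "(w', c) \<in> E" using c unfolding E by simp
        from wc(2)[OF this] 1 show ?thesis unfolding c by (simp add: order_trans)
      next
        case False
        have "ereal (g (fst wc)) + h (fst wc) \<le> ereal c0" using 1 by (simp add: order_trans)
        also have "\<dots> \<le> ereal c" using False by simp
        finally show ?thesis unfolding c .
      qed
    qed (cases "h w'", auto)
  qed
  then show thesis using that unfolding g_def by blast
qed

text \<open>Moving from \<open>w\<close> towards \<open>v\<close> by a fraction \<open>t\<close>,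
  convexity bounds the change of \<open>h\<close> linearly in \<open>t\<close>, while the quadratic
  leaves only a remainder of order \<open>t\<close> squared. The slope is minus the derivative of
  the smooth part at \<open>w\<close>.\<close>

lemma pcc_prox_subgradient:
  fixes q b z w :: real
  assumes min: "\<And>w'. ereal (q * (w - z)\<^sup>2 + b * (w - z)) + h w
                        \<le> ereal (q * (w' - z)\<^sup>2 + b * (w' - z)) + h w'"
  shows "h w < \<infinity>"
    and "h v < \<infinity> \<Longrightarrow> real_of_ereal (h w) + (- b - 2 * q * (w - z)) * (v - w) \<le> real_of_ereal (h v)"
proof -
  obtain w0 where w0: "h w0 < \<infinity>" using h unfolding proper_closed_convex_def by blast
  then have "ereal (q * (w - z)\<^sup>2 + b * (w - z)) + h w < \<infinity>"
    using min[of w0] by (cases "h w0") auto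
  then show w: "h w < \<infinity>" by (cases "h w") auto
  assume v: "h v < \<infinity>"
  let ?r = "\<lambda>w. real_of_ereal (h w)"
  have min': "q * (w - z)\<^sup>2 + b * (w - z) + ?r w \<le> q * (w' - z)\<^sup>2 + b * (w' - z) + ?r w'"
    if "h w' < \<infinity>" for w'
    using min[of w'] pcc_finite(2)[OF w] pcc_finite(2)[OF that]
    by (metis ereal_less_eq(3) plus_ereal.simps(1))
  have "0 \<le> (?r v - ?r w + (b + 2 * q * (w - z)) * (v - w)) + (q * (v - w)\<^sup>2) * t"
    if t: "0 < t" "t < 1" for t
  proof -
    have c: "h ((1 - t) * w + t * v) < \<infinity>" "?r ((1 - t) * w + t * v) \<le> (1 - t) * ?r w + t * ?r v"
      using pcc_convex[OF w v] t by auto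
    have "q * (w - z)\<^sup>2 + b * (w - z) + ?r w
       \<le> q * ((1 - t) * w + t * v - z)\<^sup>2 + b * ((1 - t) * w + t * v - z) + ((1 - t) * ?r w + t * ?r v)"
      using min'[OF c(1)] c(2) by linarith
    also have "(1 - t) * w + t * v - z = (w - z) + t * (v - w)" by (simp add: algebra_simps)
    finally have "0 \<le> t * ((?r v - ?r w + (b + 2 * q * (w - z)) * (v - w)) + (q * (v - w)\<^sup>2) * t)"
      by (simp add: power2_eq_square algebra_simps)
    then show ?thesis using t by (simp add: zero_le_mult_iff)
  qed
  from linear_quadratic_nonneg_imp[OF this]
  show "?r w + (- b - 2 * q * (w - z)) * (v - w) \<le> ?r v" by (simp add: algebra_simps)
qed

end

subsection \<open>The step sizes\<close>

text \<open>\<open>Xw P k\<close> is \<open>1 / (nhat\<^sup>2 \<theta>\<^bsub>k-1\<^esub>\<^sup>2)\<close>, with the convention \<open>1 / \<theta>\<^bsub>-1\<^esub>\<^sup>2 = (1 - \<theta>\<^sub>0) / \<theta>\<^sub>0\<^sup>2\<close>.\<close>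

fun Xw :: "'a cprob \<Rightarrow> nat \<Rightarrow> real" where
  "Xw P 0 = 1 - theta P 0"
| "Xw P (Suc k) = 1 / ((real (nhat P))\<^sup>2 * (theta P k)\<^sup>2)"

declare theta.simps(2) [simp del]

context
  fixes P :: "'a cprob"
  assumes n1: "1 \<le> nhat P"
begin

text \<open>The update of \<open>theta\<close> is the positive root of a quadratic equation; in
  reciprocals it becomes a recursion that increases by at least 1/2 per step.\<close>

lemma theta_root:
  fixes t :: real
  assumes "0 < t"
  defines "s \<equiv> (sqrt (t^4 + 4 * t\<^sup>2) - t\<^sup>2) / 2"
  shows "s\<^sup>2 = (1 - s) * t\<^sup>2" and "0 < s"
    and "1 / s = 1 / 2 + sqrt (1 / 4 + 1 / t\<^sup>2)"
proof -
  have sq: "(sqrt (t^4 + 4 * t\<^sup>2))\<^sup>2 = t^4 + 4 * t\<^sup>2" by simp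
  show 1: "s\<^sup>2 = (1 - s) * t\<^sup>2"
    using sq unfolding s_def by (simp add: field_simps power2_eq_square power4_eq_xxxx)
  have "sqrt ((t\<^sup>2)\<^sup>2) < sqrt (t^4 + 4 * t\<^sup>2)"
    using assms by (intro real_sqrt_less_mono) (simp flip: power_mult)
  then show s: "0 < s" unfolding s_def by (simp only: real_sqrt_abs) simp
  define r where "r = sqrt (1 / 4 + 1 / t\<^sup>2)"
  have "(1 / s - 1 / 2)\<^sup>2 = 1 / 4 + 1 / t\<^sup>2"
    using 1 s assms(1) by (simp add: field_simps power2_eq_square)
  moreover have "s < 1"
  proof (rule ccontr)
    assume "\<not> s < 1"
    then have "(1 - s) * t\<^sup>2 \<le> 0" by (intro mult_nonpos_nonneg) auto
    moreover have "0 < s\<^sup>2" using s by simp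
    ultimately show False using 1 by simp
  qed
  then have "0 \<le> 1 / s - 1 / 2" using s by (simp add: field_simps)
  ultimately have "1 / s - 1 / 2 = r" unfolding r_def by (metis real_sqrt_unique)
  then show "1 / s = 1 / 2 + sqrt (1 / 4 + 1 / t\<^sup>2)" unfolding r_def by simp
qed

lemma theta_pos: "0 < theta P k"
proof (induction k)
  case (Suc k) then show ?case using theta_root(2)[of "theta P k"] by (simp add: theta.simps(2))
qed (use n1 in simp)

lemma theta_Suc: "(theta P (Suc k))\<^sup>2 = (1 - theta P (Suc k)) * (theta P k)\<^sup>2"
  using theta_root(1)[OF theta_pos[of k]] by (simp add: theta.simps(2))

lemma inverse_theta_Suc: "1 / theta P (Suc k) = 1 / 2 + sqrt (1 / 4 + (1 / theta P k)\<^sup>2)"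
  using theta_root(3)[OF theta_pos[of k]] by (simp add: power_one_over theta.simps(2))

lemma inverse_theta_ge: "real (nhat P) + real k / 2 \<le> 1 / theta P k"
proof (induction k)
  case (Suc k)
  have "1 / theta P k = sqrt ((1 / theta P k)\<^sup>2)" using theta_pos[of k] by (simp add: real_sqrt_abs)
  also have "\<dots> \<le> sqrt (1 / 4 + (1 / theta P k)\<^sup>2)" by (intro real_sqrt_le_mono) simp
  finally show ?case using Suc unfolding inverse_theta_Suc by (simp add: add_divide_distrib)
qed simp

text \<open>The square root exceeds \<open>a\<close> by at most \<open>1 / (2 * a)\<close>, hence by
  at most \<open>1 / (2 * nhat P)\<close>. This excess is the origin of the factor
  \<open>1 + 1 / nhat P\<close> in the admissible range of \<open>K0\<close>.\<close>

lemma inverse_theta_le: "1 / theta P k \<le> real (nhat P) + real k / 2 * (1 + 1 / real (nhat P))"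
proof (induction k)
  case (Suc k)
  define a where "a = 1 / theta P k"
  have a: "real (nhat P) \<le> a" using inverse_theta_ge[of k] unfolding a_def by simp
  have a0: "0 < a" using a n1 by simp
  have "sqrt (1 / 4 + a\<^sup>2) \<le> sqrt ((a + 1 / (2 * a))\<^sup>2)"
    using a0 by (intro real_sqrt_le_mono) (simp add: power2_sum)
  also have "\<dots> = a + 1 / (2 * a)" using a0 by simp
  also have "\<dots> \<le> a + 1 / (2 * real (nhat P))" using a n1 a0 by (simp add: frac_le)
  finally have "1 / theta P (Suc k) \<le> 1 / 2 + a + 1 / (2 * real (nhat P))"
    unfolding inverse_theta_Suc a_def by simp
  also have "a \<le> real (nhat P) + real k / 2 * (1 + 1 / real (nhat P))" using Suc unfolding a_def .
  finally show ?case by (simp add: add_divide_distrib distrib_right distrib_left)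
qed simp

lemma theta_decreasing: "theta P (Suc k) < theta P k"
proof -
  have "1 / theta P k = sqrt ((1 / theta P k)\<^sup>2)" using theta_pos[of k] by (simp add: real_sqrt_abs)
  also have "\<dots> \<le> sqrt (1 / 4 + (1 / theta P k)\<^sup>2)" by (intro real_sqrt_le_mono) simp
  finally have "1 / theta P k < 1 / theta P (Suc k)" unfolding inverse_theta_Suc by simp
  then show ?thesis using theta_pos[of k] theta_pos[of "Suc k"] by (simp add: field_simps)
qed

lemma n_theta_le_1: "real (nhat P) * theta P k \<le> 1"
proof -
  have "real (nhat P) \<le> 1 / theta P k" using inverse_theta_ge[of k] by simp
  then show ?thesis using theta_pos[of k] by (simp add: field_simps)
qed

lemma n_theta_less_1: "real (nhat P) * theta P (Suc k) < 1"
proof -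
  have "real (nhat P) < 1 / theta P (Suc k)"
    by (rule less_le_trans[OF _ inverse_theta_ge[of "Suc k"]]) simp
  then show ?thesis using theta_pos[of "Suc k"] by (simp add: field_simps)
qed

lemma theta_le_1: "theta P k \<le> 1"
proof -
  have "1 * theta P k \<le> real (nhat P) * theta P k"
    using n1 theta_pos[of k] by (intro mult_right_mono) auto
  then show ?thesis using n_theta_le_1[of k] by simp
qed

lemma theta_Suc_less_1: "theta P (Suc k) < 1"
  using theta_decreasing[of k] theta_le_1[of k] by simp

lemma Xw_Suc: "(real (nhat P))\<^sup>2 * (theta P k)\<^sup>2 * Xw P (Suc k) = 1"
  using theta_pos[of k] n1 by simp

text \<open>That the recursion holds from \<open>k = 0\<close> on is the reason for the convention
  chosen for \<open>Xw P 0\<close>.\<close>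

lemma Xw_step: "Xw P k = (1 - theta P k) * Xw P (Suc k)"
proof (cases k)
  case 0
  then show ?thesis using n1 by (simp add: power_one_over)
next
  case (Suc j)
  have "theta P j \<noteq> 0" "theta P (Suc j) \<noteq> 0" using theta_pos[of j] theta_pos[of "Suc j"] by auto
  then show ?thesis unfolding Suc Xw.simps theta_Suc
    using theta_Suc_less_1[of j] n1 by (simp del: theta.simps)
qed

text \<open>Turns the averaging weights \<open>1 / theta P k\<close> into increments of
  \<open>Xw\<close>, so that their sums telescope.\<close>

lemma Xw_diff: "Xw P (Suc k) - Xw P k = (1 / theta P k) / (real (nhat P))\<^sup>2"
  unfolding Xw_step[of k] using theta_pos[of k] n1
  by (simp add: field_simps power2_eq_square)

lemma Xw_nonneg: "0 \<le> Xw P k"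
  by (cases k) (use theta_le_1[of 0] in auto)

lemma Xw_ge: "(1 + real k / (2 * real (nhat P)))\<^sup>2 \<le> Xw P (Suc k)"
proof -
  have "1 + real k / (2 * real (nhat P)) \<le> (1 / theta P k) / real (nhat P)"
    using inverse_theta_ge[of k] n1 by (simp add: field_simps)
  then have "(1 + real k / (2 * real (nhat P)))\<^sup>2 \<le> ((1 / theta P k) / real (nhat P))\<^sup>2"
    by (intro power_mono) auto
  also have "\<dots> = Xw P (Suc k)" by (simp add: power_divide power_mult_distrib field_simps)
  finally show ?thesis .
qed

lemma Xw_Suc_ge_1: "1 \<le> Xw P (Suc k)"
proof -
  have "1\<^sup>2 \<le> (1 + real k / (2 * real (nhat P)))\<^sup>2" by (intro power_mono) auto
  then show ?thesis using Xw_ge[of k] by (metis order_trans power_one)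
qed

text \<open>With \<open>a = K / nhat P\<close> and \<open>r = 1 / ups\<close>, the two estimates of
  \<open>Xw\<close> leave a difference of squares equal to
  \<open>(1 - r) * (a + a^2 / 4 * (1 + r))\<close>; since \<open>a \<ge> 1\<close> the second factor
  is at least 5/4.\<close>

lemma Xw_diff_ge:
  assumes ups: "1 < ups" and K: "nhat P \<le> K"
    and K0: "int K0 \<le> \<lfloor>real K / (ups * (1 + 1 / real (nhat P))) + 1\<rfloor>"
  shows "K0 \<le> K" and "5 / 4 * (1 - 1 / ups) \<le> Xw P (Suc K) - Xw P K0"
proof -
  define n where "n = real (nhat P)"
  have n: "1 \<le> n" using n1 unfolding n_def by simp
  have Kn: "n \<le> real K" using K unfolding n_def by simp
  have up: "0 < ups * (1 + 1 / n)" using ups n by (intro mult_pos_pos) (auto intro: add_pos_nonneg)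
  have "real K0 \<le> real K / (ups * (1 + 1 / n)) + 1"
    using K0 unfolding n_def le_floor_iff by simp
  then have k1: "(real K0 - 1) \<le> real K / (ups * (1 + 1 / n))" by simp
  then have k2: "(real K0 - 1) * (1 + 1 / n) \<le> real K / ups"
    using up ups n by (simp add: field_simps)
  have "1 < ups * (1 + 1 / n)" using ups n by (intro less_1_mult') (auto simp: field_simps)
  then have "real K / (ups * (1 + 1 / n)) < real K" using Kn n by (simp add: divide_less_eq)
  with k1 have "real K0 < real K + 1" by simp
  then show "K0 \<le> K" by simp
  define a where "a = real K / n"
  have a: "1 \<le> a" using Kn n unfolding a_def by simp
  have i: "0 < 1 / ups" "1 / ups < 1" using ups by auto
  have *: "Xw P K0 \<le> (1 + a / (2 * ups))\<^sup>2"
  proof (cases K0)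
    case 0
    have "Xw P K0 \<le> 1" using theta_pos[of 0] unfolding 0 by simp
    also have "1 = (1::real)\<^sup>2" by simp
    also have "1\<^sup>2 \<le> (1 + a / (2 * ups))\<^sup>2" using a i by (intro power_mono) auto
    finally show ?thesis .
  next
    \<comment> \<open>\<open>Xw P K0\<close> is governed by \<open>theta\<close> at index
      \<open>K0 - 1\<close>, which is what the \<open>+ 1\<close> in the bound on \<open>K0\<close>
      allows for.\<close>
    case (Suc j)
    have "1 / theta P j \<le> n + real j / 2 * (1 + 1 / n)" using inverse_theta_le[of j] unfolding n_def .
    also have "\<dots> \<le> n + real K / (2 * ups)" using k2 unfolding Suc by simp
    finally have "(1 / theta P j) / n \<le> (n + real K / (2 * ups)) / n" using n by (intro divide_right_mono) auto
    also have "\<dots> = 1 + a / (2 * ups)" using n unfolding a_def by (simp add: field_simps)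
    finally have "((1 / theta P j) / n)\<^sup>2 \<le> (1 + a / (2 * ups))\<^sup>2"
      using theta_pos[of j] n by (intro power_mono) auto
    then show ?thesis unfolding Suc n_def by (simp add: power_divide field_simps)
  qed
  have "(1 + a / 2)\<^sup>2 \<le> Xw P (Suc K)" using Xw_ge[of K] unfolding a_def n_def by (simp add: mult.commute)
  with * have "(1 + a / 2)\<^sup>2 - (1 + a / 2 * (1 / ups))\<^sup>2 \<le> Xw P (Suc K) - Xw P K0" by simp
  moreover have "(1 + a / 2)\<^sup>2 - (1 + a / 2 * r)\<^sup>2 = (1 - r) * (a + a\<^sup>2 / 4 * (1 + r))" for r
    by (simp add: power2_eq_square field_simps)
  note this[of "1 / ups"]
  moreover have "(1 - 1 / ups) * (5 / 4) \<le> (1 - 1 / ups) * (a + a\<^sup>2 / 4 * (1 + 1 / ups))"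
  proof (rule mult_left_mono)
    have "1 * 1 \<le> a\<^sup>2 * (1 + 1 / ups)" using a i by (intro mult_mono) auto
    then show "5 / 4 \<le> a + a\<^sup>2 / 4 * (1 + 1 / ups)" using a by (simp add: field_simps)
  qed (use i in simp)
  ultimately show "5 / 4 * (1 - 1 / ups) \<le> Xw P (Suc K) - Xw P K0"
    by (metis (no_types) mult.commute order_trans)
qed

text \<open>The sign of the weight that the previous \<open>z\<close> keeps when \<open>u\<close> is
  unrolled over one more step. It holds because \<open>theta\<close> shrinks slowly: its reciprocal
  grows by at most 1 per step.\<close>

lemma theta_ratio: "(real (nhat P) - 1) * theta P (Suc k) \<le> (1 - theta P (Suc k)) * real (nhat P) * theta P k"
proof -
  define n t s where "n = real (nhat P)" and "t = theta P k" and "s = theta P (Suc k)"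
  have n: "1 \<le> n" using n1 unfolding n_def by simp
  have t: "0 < t" "n * t \<le> 1" using theta_pos[of k] n_theta_le_1[of k] unfolding t_def n_def by auto
  have s: "0 < s" using theta_pos[of "Suc k"] unfolding s_def .
  have "sqrt (1 / 4 + (1 / t)\<^sup>2) \<le> sqrt ((1 / t + 1 / 2)\<^sup>2)"
    using t by (intro real_sqrt_le_mono) (simp add: power2_sum power_one_over)
  also have "\<dots> = 1 / t + 1 / 2" using t by simp
  finally have "1 / s \<le> 1 / t + 1" using inverse_theta_Suc[of k] unfolding s_def t_def by simp
  then have "t \<le> s * (1 + t)" using s t by (simp add: field_simps)
  then have "(n - 1) * t \<le> (n - 1) * (s * (1 + t))" using n by (intro mult_left_mono) auto
  also have "(n - 1) * (s * (1 + t)) = s * (n - 1 + (n * t - t))" by (simp add: algebra_simps)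
  also have "\<dots> \<le> s * n" using s t by (intro mult_left_mono) auto
  finally have "((n - 1) * t) * s \<le> (s * n) * s" using s by (intro mult_right_mono) auto
  also have "\<dots> = n * s\<^sup>2" by (simp add: power2_eq_square)
  also have "s\<^sup>2 = (1 - s) * t\<^sup>2" using theta_Suc[of k] unfolding s_def t_def .
  finally have "((n - 1) * s) * t \<le> ((1 - s) * n * t) * t" by (simp add: power2_eq_square algebra_simps)
  then show ?thesis using t(1) unfolding n_def t_def s_def by (simp only: mult_le_cancel_right_pos)
qed

text \<open>The sequences stand for expectations along one run: \<open>y\<close> is the dual gap of the averaged bound,
  \<open>e\<close>, \<open>p\<close>, \<open>Q\<close> are the squared distances between \<open>z\<close>, \<open>u\<close> and the reference point, \<open>dl\<close> is the squared step
  and \<open>cr\<close> the correlation of the step with \<open>u - z\<close>.  The quantity \<open>y + c Q\<close> is nonincreasing, and the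
  variance terms in the identity for \<open>p\<close> compensate \<open>c Q\<close>.\<close>

lemma distance_gap_tradeoff:
  fixes e y Q p dl cr :: "nat \<Rightarrow> real"
  defines "n \<equiv> real (nhat P)"
  assumes lyap: "\<And>k. Xw P (Suc k) * y (Suc k) + e (Suc k) \<le> Xw P k * y k + e k"
    and init: "Xw P 0 * y 0 + e 0 = T"
    and gap: "\<And>k. 1 \<le> k \<Longrightarrow> y (Suc k) \<le> y k + n\<^sup>2 * (theta P k)\<^sup>2 * (2 * cr k - 3 / 2 * dl k)"
    and Qrec: "\<And>k. Q (Suc k) = (1 - theta P k)\<^sup>2 * Q k
            - 2 * (1 - theta P k) * (1 - n * theta P k) * cr k + (1 - n * theta P k)\<^sup>2 * dl k"
    and prec: "\<And>k. 1 \<le> k \<Longrightarrow> p (Suc k) = n * theta P k * e (Suc k) + (1 - theta P k) * p k - (n - 1) * theta P k * e k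
            + (1 - theta P k) * (n - 1) * theta P k / (1 - n * theta P k) * Q k
            - n * theta P k / (1 - n * theta P k) * Q (Suc k)"
    and dl: "\<And>k. 0 \<le> dl k" and Q: "\<And>k. 0 \<le> Q k" and Q1: "Q 1 = 0" and p1: "p 1 = e 1"
  obtains S where "1 \<le> S" "Xw P (Suc k) / 2 \<le> S" "p (Suc k) \<le> T - S * y (Suc k)"
proof -
  \<comment> \<open>The weight for which \<open>y + c * Q\<close> decreases: with it, the
    correlation terms of \<open>gap\<close> and \<open>Qrec\<close> can be made to cancel.\<close>
  define c where "c k = n\<^sup>2 * (theta P k)\<^sup>2 * (1 - theta P k) / (1 - n * theta P k)" for k
  define G where "G k = y k + c k * Q k" for k
  have n: "1 \<le> n" using n1 unfolding n_def by simp
  have E: "Xw P k * y k + e k \<le> T" for k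
  proof (induction k)
    case (Suc k) then show ?case using lyap[of k] by linarith
  qed (use init in simp)
  have Gdec: "G (Suc (Suc k)) \<le> G (Suc k)" for k
  proof -
    define s r where "s = theta P (Suc k)" and "r = theta P (Suc (Suc k))"
    have s: "0 < s" "s < 1" "n * s < 1"
      using theta_pos[of "Suc k"] theta_Suc_less_1 n_theta_less_1 unfolding s_def n_def by blast+
    have r: "0 < r" "r < s" "n * r < 1"
      using theta_pos[of "Suc (Suc k)"] theta_decreasing n_theta_less_1 unfolding r_def s_def n_def by blast+
    have rr: "r\<^sup>2 = (1 - r) * s\<^sup>2" using theta_Suc[of "Suc k"] unfolding r_def s_def .
    have D0: "0 < (1 - s) * (1 - n * s)" and E0: "0 < 1 - n * r" using r s by auto
    \<comment> \<open>Fixed by the cancellation of \<open>cr\<close>. It dominates \<open>c\<close>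
      at the next index, and \<open>c' * (1 - s)^2\<close> is exactly \<open>c\<close> at the
      current one, so a single number links both ends of the inequality.\<close>
    define c' where "c' = n\<^sup>2 * s\<^sup>2 / ((1 - s) * (1 - n * s))"
    have "n\<^sup>2 * s\<^sup>2 * ((1 - r)\<^sup>2 * (1 - s) * (1 - n * s)) \<le> n\<^sup>2 * s\<^sup>2 * (1 * (1 - n * r))"
    proof (intro mult_left_mono mult_mono)
      show "(1 - r)\<^sup>2 * (1 - s) \<le> 1" using r s by (intro mult_le_one power_le_one) auto
      show "1 - n * s \<le> 1 - n * r" using r n by simp
    qed (use r s in auto)
    then have "n\<^sup>2 * s\<^sup>2 * (1 - r)\<^sup>2 / (1 - n * r) \<le> c'"
      unfolding c'_def pos_divide_le_eq[OF E0] times_divide_eq_left pos_le_divide_eq[OF D0] by (simp add: mult_ac)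
    also have "n\<^sup>2 * s\<^sup>2 * (1 - r)\<^sup>2 / (1 - n * r) = c (Suc (Suc k))"
      unfolding c_def r_def[symmetric] rr by (simp add: power2_eq_square)
    finally have "G (Suc (Suc k)) \<le> y (Suc (Suc k)) + c' * Q (Suc (Suc k))"
      unfolding G_def using Q[of "Suc (Suc k)"] by (simp add: mult_right_mono)
    also have "\<dots> \<le> y (Suc k) + n\<^sup>2 * s\<^sup>2 * (2 * cr (Suc k) - 3 / 2 * dl (Suc k)) +
       c' * ((1 - s)\<^sup>2 * Q (Suc k) - 2 * (1 - s) * (1 - n * s) * cr (Suc k) + (1 - n * s)\<^sup>2 * dl (Suc k))"
      using gap[of "Suc k"] Qrec[of "Suc k"] unfolding s_def by simp
    also have "\<dots> = y (Suc k) + c' * (1 - s)\<^sup>2 * Q (Suc k)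
       + 2 * cr (Suc k) * (n\<^sup>2 * s\<^sup>2 - c' * ((1 - s) * (1 - n * s)))
       + dl (Suc k) * (c' * (1 - n * s)\<^sup>2 - 3 / 2 * (n\<^sup>2 * s\<^sup>2))"
      by (simp add: algebra_simps)
    also have "c' * ((1 - s) * (1 - n * s)) = n\<^sup>2 * s\<^sup>2" unfolding c'_def using s by simp
    also have "c' * (1 - s)\<^sup>2 = c (Suc k)" unfolding c'_def c_def s_def[symmetric] using s
      by (simp add: power2_eq_square)
    also have "y (Suc k) + c (Suc k) * Q (Suc k) + 2 * cr (Suc k) * (n\<^sup>2 * s\<^sup>2 - n\<^sup>2 * s\<^sup>2)
       + dl (Suc k) * (c' * (1 - n * s)\<^sup>2 - 3 / 2 * (n\<^sup>2 * s\<^sup>2)) \<le> G (Suc k)"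
    proof -
      have "c' * (1 - n * s)\<^sup>2 = n\<^sup>2 * s\<^sup>2 * ((1 - n * s) / (1 - s))"
        unfolding c'_def using s by (simp add: power2_eq_square)
      also have "\<dots> \<le> n\<^sup>2 * s\<^sup>2 * 1"
      proof (rule mult_left_mono)
        have "1 * s \<le> n * s" using n s by (intro mult_right_mono) auto
        then show "(1 - n * s) / (1 - s) \<le> 1" using s by (simp add: divide_le_eq)
      qed simp
      finally have "c' * (1 - n * s)\<^sup>2 - 3 / 2 * (n\<^sup>2 * s\<^sup>2) \<le> 0"
        using mult_nonneg_nonneg[OF zero_le_power2[of n] zero_le_power2[of s]] by linarith
      then have "dl (Suc k) * (c' * (1 - n * s)\<^sup>2 - 3 / 2 * (n\<^sup>2 * s\<^sup>2)) \<le> 0"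
        using dl by (intro mult_nonneg_nonpos)
      then show ?thesis unfolding G_def by simp
    qed
    finally show ?thesis .
  qed
  \<comment> \<open>In the induction below \<open>S\<close> is the total weight of all gaps
    collected so far: \<open>b k\<close> of it sits on the newest gap, and the rest on
    \<open>G\<close>, which may be pushed forward in time by \<open>Gdec\<close>.\<close>
  define b where "b k = n * theta P k * Xw P (Suc k)" for k
  have "\<exists>S. 1 \<le> S \<and> Xw P (Suc k) / 2 \<le> S \<and> b k \<le> S \<and>
     p (Suc k) \<le> T - (S - b k) * G (Suc k) - b k * y (Suc k) - n * theta P k / (1 - n * theta P k) * Q (Suc k)" for k
  proof (induction k)
    case 0
    \<comment> \<open>The quotient \<open>n * theta / (1 - n * theta)\<close> has denominator 0 here
      and evaluates to 0; it is multiplied by \<open>Q 1 = 0\<close> in any case.\<close>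
    have nt: "n * theta P 0 = 1" using n1 unfolding n_def by simp
    have b0: "b 0 = 1" "Xw P (Suc 0) = 1" using n1 unfolding b_def n_def by (auto simp: power2_eq_square)
    show ?case using E[of 1] Q1 p1 b0 by (intro exI[of _ 1]) (auto simp: algebra_simps)
  next
    case (Suc k)
    then obtain S where S: "1 \<le> S" "Xw P (Suc k) / 2 \<le> S" "b k \<le> S"
      "p (Suc k) \<le> T - (S - b k) * G (Suc k) - b k * y (Suc k) - n * theta P k / (1 - n * theta P k) * Q (Suc k)"
      by blast
    define s t X X' where "s = theta P (Suc k)" and "t = theta P k"
      and "X = Xw P (Suc k)" and "X' = Xw P (Suc (Suc k))"
    have t: "0 < t" "n * t \<le> 1" using theta_pos[of k] n_theta_le_1[of k] unfolding t_def n_def by auto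
    have s: "0 < s" "s < 1" "n * s < 1" "s < t"
      using theta_pos[of "Suc k"] theta_Suc_less_1 n_theta_less_1 theta_decreasing unfolding s_def n_def t_def
      by blast+
    have ss: "s\<^sup>2 = (1 - s) * t\<^sup>2" using theta_Suc[of k] unfolding s_def t_def .
    have XX: "X = (1 - s) * X'" using Xw_step[of "Suc k"] unfolding X_def X'_def s_def by simp
    have X1: "1 \<le> X" using Xw_Suc_ge_1 unfolding X_def .
    have X'1: "1 \<le> X'" using Xw_Suc_ge_1 unfolding X'_def .
    define a where "a = (1 - s) * n * t - (n - 1) * s"
    have a: "0 \<le> a" using theta_ratio[of k] unfolding a_def s_def t_def n_def by simp
    have bk: "b k = n * t * X" "b (Suc k) = n * s * X'" unfolding b_def t_def s_def X_def X'_def by auto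
    \<comment> \<open>The total gap weight after one step: \<open>(1 - s) * S\<close> from the
      induction hypothesis, \<open>n * s * X'\<close> on the new gap, and a net
      \<open>- (n - 1) * s * X\<close> from the two bounds that eliminate the distances
      \<open>e\<close>.\<close>
    define S' where "S' = (1 - s) * S + n * s * X' - (n - 1) * s * X"
    have S'b: "S' - b (Suc k) = (1 - s) * (S - b k) + a * X" unfolding S'_def bk a_def by (simp add: algebra_simps)
    have bS': "b (Suc k) \<le> S'"
    proof -
      have "0 \<le> (1 - s) * (S - b k) + a * X" using s S(3) a X1 by (intro add_nonneg_nonneg mult_nonneg_nonneg) auto
      then show ?thesis using S'b by linarith
    qed
    \<comment> \<open>Inserting \<open>X = (1 - s) * X'\<close> reproduces exactly half of
      \<open>X'\<close> plus a nonnegative surplus; this is what the factor 1/2 in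
      \<open>rho\<close> rests on.\<close>
    have half: "X' / 2 \<le> S'"
    proof -
      have "(1 - s) * (X / 2) \<le> (1 - s) * S" using S(2) s unfolding X_def by (intro mult_left_mono) auto
      then have "(1 - s) * (X / 2) + n * s * X' - (n - 1) * s * X \<le> S'" unfolding S'_def by simp
      moreover have "(1 - s) * (X / 2) + n * s * X' - (n - 1) * s * X
         = X' / 2 + X' * (s\<^sup>2 / 2 + (n - 1) * s\<^sup>2)"
        unfolding XX by (simp add: power2_eq_square field_simps)
      moreover have "0 \<le> X' * (s\<^sup>2 / 2 + (n - 1) * s\<^sup>2)" using X'1 n by simp
      ultimately show ?thesis by linarith
    qed
    have one: "1 \<le> S'"
    proof -
      have "X \<le> X'" unfolding XX using s X'1 by (simp add: algebra_simps)
      then have "n * s * X \<le> n * s * X'" using n s by (intro mult_left_mono) auto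
      then have "(1 - s) * S + s * X \<le> S'" unfolding S'_def by (simp add: algebra_simps)
      moreover have "(1 - s) * 1 + s * 1 \<le> (1 - s) * S + s * X"
        using S(1) X1 s by (intro add_mono mult_left_mono) auto
      ultimately show ?thesis by simp
    qed
    let ?Q = "Q (Suc k)" and ?Q' = "Q (Suc (Suc k))"
    have Xc: "X * c (Suc k) = (1 - s)\<^sup>2 / (1 - n * s)"
    proof -
      have "c (Suc k) = n\<^sup>2 * t\<^sup>2 * ((1 - s)\<^sup>2 / (1 - n * s))"
        unfolding c_def s_def[symmetric] ss by (simp add: power2_eq_square)
      moreover have "n\<^sup>2 * t\<^sup>2 * X = 1" using Xw_Suc[of k] unfolding n_def t_def X_def .
      ultimately show ?thesis by (simp add: algebra_simps)
    qed
    \<comment> \<open>The total coefficient of \<open>Q (Suc k)\<close>: what \<open>prec\<close>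
      and the change from \<open>y\<close> to \<open>G\<close> add is paid for by the negative
      \<open>Q\<close> term carried along in the induction hypothesis.\<close>
    have br: "(a * X * c (Suc k) + (1 - s) * (n - 1) * s / (1 - n * s) - (1 - s) * (n * t / (1 - n * t))) * ?Q \<le> 0"
    proof (cases k)
      case (Suc j)
      have nt: "n * t < 1" using n_theta_less_1[of j] unfolding t_def n_def Suc .
      have "n * t / (1 - n * s) \<le> n * t / (1 - n * t)"
        using nt s t n by (intro divide_left_mono mult_pos_pos) (auto simp: mult_left_mono)
      then have 1: "(1 - s) * (n * t / (1 - n * s)) \<le> (1 - s) * (n * t / (1 - n * t))"
        using s by (intro mult_left_mono) auto
      have "a * (1 - s) \<le> a * 1" using a s by (intro mult_left_mono) auto
      also have "\<dots> \<le> n * t - (n - 1) * s" unfolding a_def using n t s by (simp add: algebra_simps)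
      finally have "(1 - s) * (a * (1 - s) + (n - 1) * s - n * t) / (1 - n * s) \<le> 0"
        using s by (intro divide_nonpos_pos mult_nonneg_nonpos) auto
      moreover have "(1 - s) * (a * (1 - s) + (n - 1) * s - n * t) / (1 - n * s)
        = a * (X * c (Suc k)) + (1 - s) * (n - 1) * s / (1 - n * s) - (1 - s) * (n * t / (1 - n * s))"
        unfolding Xc using s by (simp add: power2_eq_square add_divide_distrib diff_divide_distrib algebra_simps)
      ultimately show ?thesis using 1 Q[of "Suc k"] by (intro mult_nonpos_nonneg) (auto simp: mult.assoc)
    qed (use Q1 in simp)
    have "p (Suc (Suc k)) = n * s * e (Suc (Suc k)) + (1 - s) * p (Suc k) - (n - 1) * s * e (Suc k)
            + (1 - s) * (n - 1) * s / (1 - n * s) * ?Q - n * s / (1 - n * s) * ?Q'"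
      using prec[of "Suc k"] unfolding s_def by simp
    also have "n * s * e (Suc (Suc k)) \<le> n * s * (X * y (Suc k) + e (Suc k) - X' * y (Suc (Suc k)))"
      using lyap[of "Suc k"] s n unfolding X_def X'_def by (intro mult_left_mono) auto
    also have "(1 - s) * p (Suc k) \<le> (1 - s) * (T - (S - b k) * G (Suc k) - b k * y (Suc k) - n * t / (1 - n * t) * ?Q)"
      using S(4) s unfolding t_def by (intro mult_left_mono) auto
    finally have "p (Suc (Suc k)) \<le> s * e (Suc k) + n * s * (X * y (Suc k) - X' * y (Suc (Suc k)))
       + (1 - s) * (T - (S - b k) * G (Suc k) - b k * y (Suc k) - n * t / (1 - n * t) * ?Q)
       + (1 - s) * (n - 1) * s / (1 - n * s) * ?Q - n * s / (1 - n * s) * ?Q'"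
      by (simp add: algebra_simps)
    moreover have "s * e (Suc k) \<le> s * (T - X * y (Suc k))"
      using E[of "Suc k"] s unfolding X_def by (intro mult_left_mono) auto
    ultimately have "p (Suc (Suc k)) \<le> s * (T - X * y (Suc k)) + n * s * (X * y (Suc k) - X' * y (Suc (Suc k)))
       + (1 - s) * (T - (S - b k) * G (Suc k) - b k * y (Suc k) - n * t / (1 - n * t) * ?Q)
       + (1 - s) * (n - 1) * s / (1 - n * s) * ?Q - n * s / (1 - n * s) * ?Q'"
      by linarith
    also have "\<dots> = T - ((1 - s) * (S - b k) + a * X) * G (Suc k) - b (Suc k) * y (Suc (Suc k))
       - n * s / (1 - n * s) * ?Q' 
       + (a * X * c (Suc k) + (1 - s) * (n - 1) * s / (1 - n * s) - (1 - s) * (n * t / (1 - n * t))) * ?Q"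
      unfolding bk a_def G_def by (simp add: algebra_simps)
    also have "\<dots> \<le> T - ((1 - s) * (S - b k) + a * X) * G (Suc k) - b (Suc k) * y (Suc (Suc k))
       - n * s / (1 - n * s) * ?Q'"
      using br by linarith
    also have "((1 - s) * (S - b k) + a * X) = S' - b (Suc k)" using S'b by simp
    also have "T - (S' - b (Suc k)) * G (Suc k) - b (Suc k) * y (Suc (Suc k)) - n * s / (1 - n * s) * ?Q'
      \<le> T - (S' - b (Suc k)) * G (Suc (Suc k)) - b (Suc k) * y (Suc (Suc k)) - n * s / (1 - n * s) * ?Q'"
      using mult_left_mono[OF Gdec[of k], of "S' - b (Suc k)"] bS' by linarith
    finally show ?case using one half bS' unfolding s_def X'_def by (intro exI[of _ S']) simp
  qed
  then obtain S where S: "1 \<le> S" "Xw P (Suc k) / 2 \<le> S" "b k \<le> S"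
      "p (Suc k) \<le> T - (S - b k) * G (Suc k) - b k * y (Suc k) - n * theta P k / (1 - n * theta P k) * Q (Suc k)"
    by blast
  have "0 \<le> c (Suc k)" unfolding c_def
    using n_theta_le_1[of "Suc k"] theta_le_1[of "Suc k"] unfolding n_def by (intro divide_nonneg_nonneg) auto
  then have "y (Suc k) \<le> G (Suc k)" unfolding G_def using Q[of "Suc k"] by simp
  then have "(S - b k) * y (Suc k) \<le> (S - b k) * G (Suc k)" using S(3) by (intro mult_left_mono) auto
  moreover have "0 \<le> n * theta P k / (1 - n * theta P k) * Q (Suc k)"
    using n_theta_le_1[of k] theta_pos[of k] n Q unfolding n_def
    by (intro mult_nonneg_nonneg divide_nonneg_nonneg) auto
  ultimately have "p (Suc k) \<le> T - S * y (Suc k)" using S(4) by (simp add: algebra_simps)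
  with S show thesis using that by blast
qed

end

subsection \<open>Finite averages\<close>

text \<open>Expectation under the uniform law on a finite set, which keeps measure theory out of the
  argument.\<close>

definition avg :: "'b set \<Rightarrow> ('b \<Rightarrow> real) \<Rightarrow> real" where
  "avg A X = (\<Sum>x\<in>A. X x) / real (card A)"

lemma avg_cong: "(\<And>x. x \<in> A \<Longrightarrow> X x = Y x) \<Longrightarrow> avg A X = avg A Y"
  unfolding avg_def by simp

lemma avg_add: "avg A (\<lambda>x. X x + Y x) = avg A X + avg A Y"
  unfolding avg_def by (simp add: sum.distrib add_divide_distrib)

lemma avg_diff: "avg A (\<lambda>x. X x - Y x) = avg A X - avg A Y"
  unfolding avg_def by (simp add: sum_subtractf diff_divide_distrib)

lemma avg_cmult: "avg A (\<lambda>x. c * X x) = c * avg A X"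
  unfolding avg_def by (simp add: sum_distrib_left)

lemma avg_sum: "avg A (\<lambda>x. \<Sum>i\<in>B. X i x) = (\<Sum>i\<in>B. avg A (X i))"
  unfolding avg_def by (subst sum.swap) (simp add: sum_divide_distrib)

lemma avg_mono: "(\<And>x. x \<in> A \<Longrightarrow> X x \<le> Y x) \<Longrightarrow> avg A X \<le> avg A Y"
  unfolding avg_def by (intro divide_right_mono sum_mono) auto

lemma avg_nonneg: "(\<And>x. x \<in> A \<Longrightarrow> 0 \<le> X x) \<Longrightarrow> 0 \<le> avg A X"
  unfolding avg_def by (intro divide_nonneg_nonneg sum_nonneg) auto

lemma avg_const: "finite A \<Longrightarrow> A \<noteq> {} \<Longrightarrow> avg A (\<lambda>_. c) = c"
  unfolding avg_def by simp

lemma avg_square: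
  assumes "finite A" "A \<noteq> {}"
  shows "(avg A X)\<^sup>2 \<le> avg A (\<lambda>x. (X x)\<^sup>2)"
proof -
  let ?m = "avg A X"
  have "0 \<le> avg A (\<lambda>x. (X x - ?m)\<^sup>2)" by (rule avg_nonneg) simp
  also have "(\<lambda>x. (X x - ?m)\<^sup>2) = (\<lambda>x. ((X x)\<^sup>2 - (2 * ?m) * X x) + ?m\<^sup>2)"
    by (auto simp: power2_diff)
  finally show ?thesis unfolding avg_add avg_diff avg_cmult avg_const[OF assms]
    by (simp add: power2_eq_square)
qed

lemma avg_le_sqrt:
  assumes "finite A" "A \<noteq> {}" "avg A (\<lambda>x. (X x)\<^sup>2) \<le> c"
  shows "avg A X \<le> sqrt c"
  using avg_square[OF assms(1,2), of X] assms(3) by (intro real_le_rsqrt) linarith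

lemma avg_sqrt:
  assumes "finite A" "A \<noteq> {}" "\<And>x. x \<in> A \<Longrightarrow> 0 \<le> X x"
  shows "avg A (\<lambda>x. sqrt (X x)) \<le> sqrt (avg A X)"
proof (rule avg_le_sqrt[OF assms(1,2)])
  show "avg A (\<lambda>x. (sqrt (X x))\<^sup>2) \<le> avg A X" using assms(3) by (intro avg_mono) simp
qed

text \<open>Words of length \<open>k\<close> are padded with \<open>d\<close> to total functions:
  appending a letter is a function update and the set stays finite. \<open>d\<close> is a parameter
  because whole runs will be the letters of an outer word.\<close>

definition seqs :: "'b set \<Rightarrow> 'b \<Rightarrow> nat \<Rightarrow> (nat \<Rightarrow> 'b) set" where
  "seqs S d k = {s. (\<forall>j<k. s j \<in> S) \<and> (\<forall>j\<ge>k. s j = d)}"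

lemma seqs_0: "seqs S d 0 = {\<lambda>_. d}"
  unfolding seqs_def by auto

lemma seqs_Suc_bij: "bij_betw (\<lambda>(s, i). s(k := i)) (seqs S d k \<times> S) (seqs S d (Suc k))"
proof (rule bij_betwI[where g = "\<lambda>s. (s(k := d), s k)"])
  show "(\<lambda>(s, i). s(k := i)) \<in> seqs S d k \<times> S \<rightarrow> seqs S d (Suc k)"
    by (auto simp: seqs_def less_Suc_eq)
  show "(\<lambda>s. (s(k := d), s k)) \<in> seqs S d (Suc k) \<rightarrow> seqs S d k \<times> S"
    by (auto simp: seqs_def)
qed (auto simp: seqs_def fun_eq_iff)

lemma finite_seqs: "finite S \<Longrightarrow> finite (seqs S d k)"
proof (induction k)
  case (Suc k)
  then show ?case using bij_betw_finite[OF seqs_Suc_bij[of k S d]] by simp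
qed (simp add: seqs_0)

lemma seqs_nonempty: "S \<noteq> {} \<Longrightarrow> seqs S d k \<noteq> {}"
proof (induction k)
  case (Suc k)
  then show ?case using seqs_Suc_bij[of k S d, THEN bij_betw_imp_surj_on] by auto
qed (simp add: seqs_0)

text \<open>The tower rule: average over draw \<open>k\<close> first, for fixed earlier
  draws.\<close>

lemma avg_seqs_Suc:
  assumes "finite S"
  shows "avg (seqs S d (Suc k)) X = avg (seqs S d k) (\<lambda>s. avg S (\<lambda>i. X (s(k := i))))"
proof -
  have "(\<Sum>s\<in>seqs S d (Suc k). X s) = (\<Sum>(s, i)\<in>seqs S d k \<times> S. X (s(k := i)))"
    using sum.reindex_bij_betw[OF seqs_Suc_bij[of k S d], of X] by (simp add: case_prod_beta)
  also have "\<dots> = (\<Sum>s\<in>seqs S d k. \<Sum>i\<in>S. X (s(k := i)))" by (simp add: sum.cartesian_product)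
  finally show ?thesis
    using bij_betw_same_card[OF seqs_Suc_bij[of k S d]] unfolding avg_def
    by (simp add: card_cartesian_product sum_divide_distrib mult.commute flip: of_nat_mult)
qed

lemma avg_seqs_Suc_indep:
  assumes "finite S" "S \<noteq> {}" "\<And>s i. X (s(k := i)) = X s"
  shows "avg (seqs S d (Suc k)) X = avg (seqs S d k) X"
  using assms by (simp add: avg_seqs_Suc avg_const)

lemma avg_seqs_indep:
  assumes "finite S" "S \<noteq> {}" "\<And>s j i. k \<le> j \<Longrightarrow> X (s(j := i)) = X s" "k \<le> m"
  shows "avg (seqs S d m) X = avg (seqs S d k) X"
  using assms(4)
proof (induction m)
  case (Suc m)
  then show ?case using avg_seqs_Suc_indep[OF assms(1,2), of X m d] assms(3)
    by (cases "k = Suc m") auto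
qed simp

text \<open>For a separable function, changing one uniformly chosen coordinate achieves on average
  \<open>1 / n\<close> of the full change. The conditional expectations of squared norms and
  regularizer values are evaluated this way.\<close>

lemma avg_coordinate_update:
  fixes F :: "nat \<Rightarrow> real \<Rightarrow> real"
  assumes "1 \<le> n"
  shows "avg {..<n} (\<lambda>i. \<Sum>j<n. F j ((z(i := w i)) j))
       = (\<Sum>j<n. F j (z j)) + (\<Sum>j<n. F j (w j) - F j (z j)) / real n"
proof -
  have "(\<Sum>j<n. F j ((z(i := w i)) j)) = (\<Sum>j<n. F j (z j)) + (F i (w i) - F i (z i))" if "i < n" for i
  proof -
    have "(\<Sum>j<n. F j ((z(i := w i)) j)) = F i (w i) + (\<Sum>j\<in>{..<n} - {i}. F j (z j))"
      using that by (subst sum.remove[of _ i]) auto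
    moreover have "(\<Sum>j<n. F j (z j)) = F i (z i) + (\<Sum>j\<in>{..<n} - {i}. F j (z j))"
      using that by (subst sum.remove[of _ i]) auto
    ultimately show ?thesis by simp
  qed
  then have "avg {..<n} (\<lambda>i. \<Sum>j<n. F j ((z(i := w i)) j))
     = avg {..<n} (\<lambda>i. (\<Sum>j<n. F j (z j)) + (F i (w i) - F i (z i)))" by (intro avg_cong) auto
  also have "\<dots> = (\<Sum>j<n. F j (z j)) + avg {..<n} (\<lambda>i. F i (w i) - F i (z i))"
    using assms unfolding avg_add by (subst avg_const) (auto simp: lessThan_empty_iff)
  finally show ?thesis unfolding avg_def by simp
qed

subsection \<open>The dual problem\<close>

text \<open>The coefficient of \<open>u i\<close> in the Lagrangian, a common form for losses,
  equality rows and inequality constraints.\<close>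

definition cfun :: "('a::real_inner) cprob \<Rightarrow> nat \<Rightarrow> 'a \<Rightarrow> real" where
  "cfun P i x = (if i < nn P then (AA P i \<bullet> x) / real (nn P)
     else if i < nn P + pp P then Bro P (i - nn P) \<bullet> x + bb P (i - nn P)
     else gg P (i - nn P - pp P) x)"

text \<open>Infinite values collapse to 0, so the number is meaningful only under
  \<open>indom\<close>.\<close>

definition hr :: "'a cprob \<Rightarrow> nat \<Rightarrow> real \<Rightarrow> real" where
  "hr P i w = real_of_ereal (hfun P i w)"

definition indom :: "'a cprob \<Rightarrow> (nat \<Rightarrow> real) \<Rightarrow> bool" where
  "indom P u \<longleftrightarrow> (\<forall>i<nhat P. hfun P i (u i) < \<infinity>)"

definition Hr :: "'a cprob \<Rightarrow> (nat \<Rightarrow> real) \<Rightarrow> real" where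
  "Hr P u = (\<Sum>i<nhat P. hr P i (u i))"

definition nsq :: "('a::real_normed_vector) cprob \<Rightarrow> (nat \<Rightarrow> real) \<Rightarrow> real" where
  "nsq P w = (\<Sum>i<nhat P. Lc P i * (w i)\<^sup>2)"

text \<open>The primal function whose conjugate is the dual regularizer \<open>h\<^sub>i\<close>, up to the sign constraint.\<close>

definition psi :: "'a cprob \<Rightarrow> nat \<Rightarrow> real \<Rightarrow> real" where
  "psi P i s = (if i < nn P then phi P i (real (nn P) * s) / real (nn P) else 0)"

lemma sum_lessThan_add: "(\<Sum>i<a + b. f i) = (\<Sum>i<a. f i) + (\<Sum>i<b. f (a + i :: nat) :: 'b :: comm_monoid_add)"
  by (induction b) (auto simp: ac_simps)

lemma sum_nhat:
  fixes f :: "nat \<Rightarrow> 'b :: comm_monoid_add"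
  shows "(\<Sum>i<nhat P. f i) = (\<Sum>i<nn P. f i) + (\<Sum>j<pp P. f (nn P + j)) + (\<Sum>j<mm P. f (nn P + pp P + j))"
  unfolding nhat_def sum_lessThan_add by simp

lemma Lagr_cfun: "Lagr P x u = ff P x + (\<Sum>i<nhat P. u i * cfun P i x)"
  unfolding Lagr_def sum_nhat by (simp add: cfun_def)

lemma gradd_cfun: "gradd P u i = - cfun P i (xst P u)"
  unfolding gradd_def cfun_def Let_def by simp

text \<open>The Lagrangian is affine in the multipliers, so the linear model of \<open>dval\<close>
  at \<open>v\<close> is minus the Lagrangian at the fixed point \<open>xst P v\<close>.\<close>

lemma dval_linearization: "dval P v + (\<Sum>i<nhat P. gradd P v i * (u i - v i)) = - Lagr P (xst P v) u"
  unfolding dval_def Lagr_cfun gradd_cfun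
  by (simp add: sum.distrib sum_negf sum_subtractf algebra_simps)

lemma convex_on_affine: "convex_on UNIV (\<lambda>x::'a::real_inner. c * (a \<bullet> x + b))"
  by (rule convex_onI) (auto simp: inner_add_right algebra_simps)

lemma conjugate_le_iff: "conjugate f w \<le> ereal c \<longleftrightarrow> (\<forall>t. w * t - f t \<le> c)"
  unfolding conjugate_def by (simp add: SUP_le_iff)

lemma convex_on_sum_fun:
  assumes "finite I" "\<And>i. i \<in> I \<Longrightarrow> convex_on UNIV (f i)"
  shows "convex_on UNIV (\<lambda>x::'a::real_vector. \<Sum>i\<in>I. f i x)"
  using assms by (induction I rule: finite_induct) (auto intro!: convex_on_add simp: convex_on_const)

locale dual_problem =
  fixes P :: "('a::euclidean_space) cprob" and ust :: "nat \<Rightarrow> real"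
  assumes n_pos: "nn P \<ge> 1"
    and mu_pos: "mu P > 0"
    and f_sc: "strongly_convex (mu P) (ff P)"
    and phi_cvx: "\<forall>i<nn P. convex_on UNIV (phi P i)"
    and phi_lip: "\<forall>i<nn P. (MM P)-lipschitz_on UNIV (phi P i)"
    and g_cvx: "\<forall>i<mm P. convex_on UNIV (gg P i)"
    and g_subgrad: "\<forall>i<mm P. \<forall>x s. (\<forall>y. gg P i y \<ge> gg P i x + s \<bullet> (y - x)) \<longrightarrow> norm s \<le> Lg P i"
    and Lc_pos: "\<forall>i<nhat P. Lc P i > 0"
    and ust: "ust \<in> Dstar P"
begin

lemma n1: "1 \<le> nhat P"
  using n_pos unfolding nhat_def by simp

lemma Lagr_convex_part:
  assumes "u \<in> Dset P"
  shows "convex_on UNIV (\<lambda>x. \<Sum>i<nhat P. u i * cfun P i x)"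
proof (rule convex_on_sum_fun)
  fix i assume i: "i \<in> {..<nhat P}"
  consider "i < nn P" | "nn P \<le> i" "i < nn P + pp P" | "nn P + pp P \<le> i" by linarith
  then show "convex_on UNIV (\<lambda>x. u i * cfun P i x)"
  proof cases
    case 1
    then show ?thesis using convex_on_affine[of "u i / real (nn P)" "AA P i" 0] by (simp add: cfun_def)
  next
    case 2
    then show ?thesis unfolding cfun_def by (simp add: convex_on_affine)
  next
    case 3
    moreover have "convex_on UNIV (gg P (i - nn P - pp P))" using g_cvx i 3 unfolding nhat_def by auto
    moreover have "0 \<le> u i" using assms i 3 unfolding Dset_def by auto
    ultimately show ?thesis unfolding cfun_def by (simp add: convex_on_cmul)
  qed
qed simp

lemma Lagr_strongly_convex: "u \<in> Dset P \<Longrightarrow> strongly_convex (mu P) (\<lambda>x. Lagr P x u)"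
  unfolding Lagr_cfun by (intro strongly_convex_add f_sc Lagr_convex_part)

text \<open>Also justifies the choice in \<open>xst\<close>: on \<open>Dset\<close> the Lagrangian
  is strongly convex and therefore has a minimizer.\<close>

lemma xst_growth:
  assumes "u \<in> Dset P"
  shows "Lagr P (xst P u) u + mu P / 2 * (norm (x - xst P u))\<^sup>2 \<le> Lagr P x u"
proof -
  obtain y where "\<And>x. Lagr P y u \<le> Lagr P x u"
    using strongly_convex_attains_min[OF Lagr_strongly_convex[OF assms] mu_pos] by blast
  then have "\<forall>x. Lagr P (xst P u) u \<le> Lagr P x u"
    unfolding xst_def by (intro someI[where P = "\<lambda>x. \<forall>y. Lagr P x u \<le> Lagr P y u"]) blast
  then show ?thesis by (intro strongly_convex_min_growth[OF Lagr_strongly_convex[OF assms]]) blast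
qed

lemma dval_ge: "u \<in> Dset P \<Longrightarrow> - Lagr P x u \<le> dval P u"
proof -
  assume u: "u \<in> Dset P"
  have "0 \<le> mu P / 2 * (norm (x - xst P u))\<^sup>2" using mu_pos by simp
  with xst_growth[OF u, of x] show ?thesis unfolding dval_def by linarith
qed

lemma dval_convex_linearization:
  "u \<in> Dset P \<Longrightarrow> dval P v + (\<Sum>i<nhat P. gradd P v i * (u i - v i)) \<le> dval P u"
  unfolding dval_linearization by (rule dval_ge)

text \<open>Explains \<open>Lc\<close>: in each branch it is a squared Lipschitz constant of
  \<open>cfun\<close> divided by \<open>mu P\<close>.\<close>

lemma cfun_lipschitz:
  assumes i: "i < nhat P"
  obtains l where "\<And>x y. \<bar>cfun P i x - cfun P i y\<bar> \<le> l * norm (x - y)" "l\<^sup>2 = Lc P i * mu P"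
proof -
  consider "i < nn P" | "nn P \<le> i" "i < nn P + pp P" | "nn P + pp P \<le> i" by linarith
  then show thesis
  proof cases
    case 1
    show thesis
    proof (rule that)
      fix x y
      have "\<bar>cfun P i x - cfun P i y\<bar> = \<bar>AA P i \<bullet> (x - y)\<bar> / real (nn P)"
        using 1 by (simp add: cfun_def inner_diff_right flip: diff_divide_distrib)
      also have "\<dots> \<le> norm (AA P i) * norm (x - y) / real (nn P)"
        by (intro divide_right_mono Cauchy_Schwarz_ineq2) simp
      finally show "\<bar>cfun P i x - cfun P i y\<bar> \<le> (norm (AA P i) / real (nn P)) * norm (x - y)" by simp
      show "(norm (AA P i) / real (nn P))\<^sup>2 = Lc P i * mu P"
        using 1 mu_pos by (simp add: Lc_def power_divide)
    qed
  next
    case 2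
    show thesis
    proof (rule that)
      fix x y
      show "\<bar>cfun P i x - cfun P i y\<bar> \<le> norm (Bro P (i - nn P)) * norm (x - y)"
        using 2 Cauchy_Schwarz_ineq2[of "Bro P (i - nn P)" "x - y"] by (simp add: cfun_def inner_diff_right)
      show "(norm (Bro P (i - nn P)))\<^sup>2 = Lc P i * mu P"
        using 2 mu_pos by (simp add: Lc_def)
    qed
  next
    case 3
    have j: "i - nn P - pp P < mm P" using i 3 unfolding nhat_def by simp
    show thesis
    proof (rule that)
      fix x y
      show "\<bar>cfun P i x - cfun P i y\<bar> \<le> Lg P (i - nn P - pp P) * norm (x - y)"
        using 3 subgradient_bound_imp_lipschitz[of "gg P (i - nn P - pp P)"] g_cvx g_subgrad j
        by (simp add: cfun_def)
      show "(Lg P (i - nn P - pp P))\<^sup>2 = Lc P i * mu P"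
        using 3 mu_pos by (simp add: Lc_def)
    qed
  qed
qed

text \<open>With \<open>r\<close> the distance between the two minimizers, growth of the Lagrangian
  at \<open>v\<close> subtracts \<open>mu P / 2 * r^2\<close>, while the Lipschitz bound on
  \<open>cfun\<close> adds at most \<open>l * \<bar>t\<bar> * r\<close>. The worst \<open>r\<close>
  gives \<open>l^2 * t^2 / (2 * mu P)\<close>.\<close>

lemma dval_coordinate_smooth:
  assumes v: "v \<in> Dset P" and v': "v(i := v i + t) \<in> Dset P" and i: "i < nhat P"
  shows "dval P (v(i := v i + t)) \<le> dval P v + gradd P v i * t + Lc P i / 2 * t\<^sup>2"
proof -
  define v' x x' where "v' = v(i := v i + t)" and "x = xst P v" and "x' = xst P v'"
  obtain l where l: "\<And>x y. \<bar>cfun P i x - cfun P i y\<bar> \<le> l * norm (x - y)" "l\<^sup>2 = Lc P i * mu P"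
    using cfun_lipschitz[OF i] by blast
  define r where "r = norm (x' - x)"
  have "Lagr P x' v' = Lagr P x' v + t * cfun P i x'"
  proof -
    have "(\<Sum>j<nhat P. v' j * cfun P j x') = v' i * cfun P i x' + (\<Sum>j\<in>{..<nhat P} - {i}. v j * cfun P j x')"
      using i by (subst sum.remove[of _ i]) (auto simp: v'_def)
    moreover have "(\<Sum>j<nhat P. v j * cfun P j x') = v i * cfun P i x' + (\<Sum>j\<in>{..<nhat P} - {i}. v j * cfun P j x')"
      using i by (subst sum.remove[of _ i]) auto
    ultimately show ?thesis unfolding Lagr_cfun by (simp add: v'_def algebra_simps)
  qed
  then have "dval P v' = - Lagr P x' v - t * cfun P i x'" unfolding dval_def x'_def by simp
  also have "\<dots> \<le> dval P v - mu P / 2 * r\<^sup>2 - t * cfun P i x'"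
    using xst_growth[OF v, of x'] unfolding dval_def r_def x_def by simp
  also have "\<dots> = dval P v + gradd P v i * t + (t * (cfun P i x - cfun P i x') - mu P / 2 * r\<^sup>2)"
    unfolding gradd_cfun x_def by (simp add: algebra_simps)
  also have "t * (cfun P i x - cfun P i x') - mu P / 2 * r\<^sup>2 \<le> Lc P i / 2 * t\<^sup>2"
  proof -
    have "t * (cfun P i x - cfun P i x') \<le> \<bar>t\<bar> * \<bar>cfun P i x - cfun P i x'\<bar>"
      by (metis abs_ge_self abs_mult)
    also have "\<dots> \<le> \<bar>t\<bar> * (l * r)" using l(1)[of x x'] unfolding r_def
      by (intro mult_left_mono) (auto simp: norm_minus_commute)
    finally have 1: "t * (cfun P i x - cfun P i x') \<le> \<bar>t\<bar> * (l * r)" .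
    have "0 \<le> (mu P * r - l * \<bar>t\<bar>)\<^sup>2" by simp
    also have "\<dots> = mu P * (mu P * r\<^sup>2 - 2 * (\<bar>t\<bar> * (l * r)) + Lc P i * t\<^sup>2)"
      using l(2) by (simp add: power2_diff power_mult_distrib power2_eq_square algebra_simps)
    finally have "0 \<le> mu P * r\<^sup>2 - 2 * (\<bar>t\<bar> * (l * r)) + Lc P i * t\<^sup>2"
      using mu_pos by (simp add: zero_le_mult_iff)
    with 1 show ?thesis by simp
  qed
  finally show ?thesis unfolding v'_def by simp
qed

lemma conjugate_phi:
  assumes i: "i < nn P" and h: "hfun P i w < \<infinity>"
  shows "(w * t - phi P i t) / real (nn P) \<le> hr P i w"
proof -
  let ?c = "conjugate (phi P i) w"
  have "ereal (w * t - phi P i t) \<le> ?c" unfolding conjugate_def by (rule SUP_upper) simp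
  moreover from h have "?c \<noteq> \<infinity>" using i n_pos unfolding hfun_def by auto
  ultimately obtain c where c: "?c = ereal c" "w * t - phi P i t \<le> c" by (cases ?c) auto
  then show ?thesis using i unfolding hr_def hfun_def by (simp add: divide_right_mono)
qed

lemma hr_eq_0: "nn P \<le> i \<Longrightarrow> hr P i w = 0"
  unfolding hr_def hfun_def by simp

text \<open>The affine families are: the scaled lines defining the conjugate for a loss, the zero
  function for an equality row, and all lines of nonpositive slope through the origin for a sign
  constraint.\<close>

lemma hfun_pcc:
  assumes i: "i < nhat P"
  shows "proper_closed_convex (hfun P i)"
proof -
  consider "i < nn P" | "nn P \<le> i" "i < nn P + pp P" | "nn P + pp P \<le> i" by linarith
  then show ?thesis
  proof cases
    case 1
    let ?N = "real (nn P)"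
    let ?A = "range (\<lambda>t. (t / ?N, - phi P i t / ?N))"
    have N: "0 < ?N" using n_pos by simp
    have "hfun P i w = (SUP ab\<in>?A. ereal (fst ab * w + snd ab))" for w
    proof -
      have "hfun P i w = ereal (1 / ?N) * (SUP t. ereal (w * t - phi P i t))"
        using 1 unfolding hfun_def conjugate_def by simp
      also have "\<dots> = (SUP t. ereal (1 / ?N) * ereal (w * t - phi P i t))"
        using N by (subst Sup_ereal_mult_left') simp_all
      also have "\<dots> = (SUP ab\<in>?A. ereal (fst ab * w + snd ab))"
      proof -
        have "1 / ?N * (w * t - phi P i t) = t / ?N * w + - phi P i t / ?N" for t
          by (simp add: diff_divide_distrib)
        then show ?thesis by (simp add: image_image)
      qed
      finally show ?thesis .
    qed
    then have "hfun P i = (\<lambda>w. SUP ab\<in>?A. ereal (fst ab * w + snd ab))" by (rule ext)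
    \<comment> \<open>A subgradient of the loss at 0 lies in the domain of its conjugate.\<close>
    moreover have "\<exists>w. hfun P i w < \<infinity>"
    proof -
      obtain s where s: "\<And>y. phi P i 0 + s \<bullet> (y - 0) \<le> phi P i y"
        using convex_on_subgradient_exists[of "phi P i"] phi_cvx 1 by blast
      have "conjugate (phi P i) s \<le> ereal (- phi P i 0)"
        unfolding conjugate_le_iff using s by (auto simp: algebra_simps)
      then have "conjugate (phi P i) s < \<infinity>" by (cases "conjugate (phi P i) s") auto
      then have "hfun P i s < \<infinity>" using 1 N unfolding hfun_def
        by (cases "conjugate (phi P i) s") auto
      then show ?thesis by blast
    qed
    ultimately show ?thesis unfolding proper_closed_convex_def by blast
  next
    case 2
    then have "hfun P i = (\<lambda>w. SUP ab\<in>{(0, 0)}. ereal (fst ab * w + snd ab))"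
      by (auto simp: hfun_def fun_eq_iff zero_ereal_def)
    then show ?thesis unfolding proper_closed_convex_def by (intro conjI exI[of _ "{(0,0)}"]) auto
  next
    case 3
    let ?A = "{..0::real} \<times> {0::real}"
    have h: "hfun P i w = (if 0 \<le> w then 0 else \<infinity>)" for w using 3 by (simp add: hfun_def)
    have "hfun P i w = (SUP ab\<in>?A. ereal (fst ab * w + snd ab))" for w
    proof (cases "0 \<le> w")
      case True
      have "(SUP ab\<in>?A. ereal (fst ab * w + snd ab)) = ereal 0"
      proof (rule antisym)
        show "(SUP ab\<in>?A. ereal (fst ab * w + snd ab)) \<le> ereal 0"
          using True by (auto simp: SUP_le_iff mult_nonpos_nonneg)
        show "ereal 0 \<le> (SUP ab\<in>?A. ereal (fst ab * w + snd ab))"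
          by (rule SUP_upper2[of "(0, 0)"]) auto
      qed
      then show ?thesis using True by (simp add: h zero_ereal_def)
    next
      case False
      have "(SUP ab\<in>?A. ereal (fst ab * w + snd ab)) = \<infinity>"
      proof (rule ereal_top)
        fix B :: real
        \<comment> \<open>At a negative \<open>w\<close>, the line of slope \<open>B / w\<close>
          reaches height \<open>B\<close>; the minimum with 0 keeps the slope admissible when
          \<open>B\<close> is negative.\<close>
        have "B \<le> min 0 (B / w) * w"
        proof (cases "0 \<le> B / w")
          case True
          then have "B \<le> 0" using False by (simp add: zero_le_divide_iff)
          then show ?thesis using True by simp
        qed (use False in simp)
        then have "ereal B \<le> ereal (min 0 (B / w) * w + 0)" by simp
        also have "\<dots> \<le> (SUP ab\<in>?A. ereal (fst ab * w + snd ab))"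
          by (rule SUP_upper2[of "(min 0 (B / w), 0)"]) auto
        finally show "ereal B \<le> (SUP ab\<in>?A. ereal (fst ab * w + snd ab))" .
      qed
      then show ?thesis using False by (simp add: h)
    qed
    then have "hfun P i = (\<lambda>w. SUP ab\<in>?A. ereal (fst ab * w + snd ab))" by (rule ext)
    moreover have "hfun P i 0 < \<infinity>" by (simp add: h)
    moreover have "?A \<noteq> {}" by auto
    ultimately show ?thesis unfolding proper_closed_convex_def by (intro conjI exI[of _ ?A] exI[of _ 0])
  qed
qed

lemma hfun_real: "i < nhat P \<Longrightarrow> hfun P i w < \<infinity> \<Longrightarrow> hfun P i w = ereal (hr P i w)"
  unfolding hr_def using pcc_finite(2)[OF hfun_pcc] .

lemma hr_convex:
  assumes "i < nhat P" "hfun P i x < \<infinity>" "hfun P i y < \<infinity>" "0 \<le> a" "0 \<le> b" "a + b = 1"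
  shows "hfun P i (a * x + b * y) < \<infinity>" "hr P i (a * x + b * y) \<le> a * hr P i x + b * hr P i y"
  using pcc_convex[OF hfun_pcc] assms unfolding hr_def by blast+

lemma indom_Dset: "indom P u \<Longrightarrow> u \<in> Dset P"
  unfolding indom_def Dset_def hfun_def nhat_def by (auto split: if_splits)

lemma Dfun_real:
  assumes "indom P u"
  shows "Dfun P u = ereal (dval P u + Hr P u)"
proof -
  have "(\<Sum>i<nhat P. hfun P i (u i)) = (\<Sum>i<nhat P. ereal (hr P i (u i)))"
    using assms hfun_real unfolding indom_def by (intro sum.cong) auto
  then show ?thesis unfolding Dfun_def Hr_def by simp
qed

lemma Dfun_infinite:
  assumes "\<not> indom P u"
  shows "Dfun P u = \<infinity>"
proof -
  have "(\<Sum>i<nhat P. hfun P i (u i)) = \<infinity>"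
  proof (subst sum_Pinfty, intro conjI)
    show "\<exists>i\<in>{..<nhat P}. hfun P i (u i) = \<infinity>" using assms unfolding indom_def by auto
  qed simp
  then show ?thesis unfolding Dfun_def by simp
qed

lemma Dstar_indom: "w \<in> Dstar P \<Longrightarrow> indom P w"
proof (rule ccontr)
  assume w: "w \<in> Dstar P" and n: "\<not> indom P w"
  have "\<forall>i. \<exists>t. i < nhat P \<longrightarrow> hfun P i t < \<infinity>"
    using hfun_pcc unfolding proper_closed_convex_def by blast
  then obtain u where "\<forall>i. i < nhat P \<longrightarrow> hfun P i (u i) < \<infinity>" by metis
  then have "indom P u" unfolding indom_def by blast
  moreover have "Dfun P w \<le> Dfun P u" using w unfolding Dstar_def by blast
  ultimately show False using Dfun_real[of u] Dfun_infinite[OF n] by simp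
qed

definition Dopt :: real where "Dopt = dval P ust + Hr P ust"

lemma Dopt: "Dfun P ust = ereal Dopt"
  unfolding Dopt_def by (intro Dfun_real Dstar_indom ust)

lemma Dopt_le: "indom P u \<Longrightarrow> Dopt \<le> dval P u + Hr P u"
  using ust Dopt Dfun_real[of u] unfolding Dstar_def by (metis (mono_tags, lifting) ereal_less_eq(3) mem_Collect_eq)

lemma Dstar_iff: "w \<in> Dstar P \<longleftrightarrow> indom P w \<and> dval P w + Hr P w \<le> Dopt"
proof
  assume w: "w \<in> Dstar P"
  then have "indom P w" by (rule Dstar_indom)
  moreover have "Dfun P w \<le> Dfun P ust" using w unfolding Dstar_def by blast
  ultimately show "indom P w \<and> dval P w + Hr P w \<le> Dopt" using Dopt Dfun_real[of w] by simp
next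
  assume w: "indom P w \<and> dval P w + Hr P w \<le> Dopt"
  have "Dfun P w \<le> Dfun P u" for u
  proof (cases "indom P u")
    case True
    have "dval P w + Hr P w \<le> dval P u + Hr P u" using w Dopt_le[OF True] by linarith
    then show ?thesis using w True by (simp add: Dfun_real)
  qed (simp add: Dfun_infinite)
  then show "w \<in> Dstar P" unfolding Dstar_def by blast
qed

lemma Dstar_value: "w \<in> Dstar P \<Longrightarrow> dval P w + Hr P w = Dopt"
  using Dstar_iff Dopt_le by (meson order_antisym)

text \<open>Justifies the choice operator in \<open>coord_min\<close> and records optimality:
  \<open>cfun\<close> at the primal point, corrected by the prox displacement, is a subgradient of
  the regularizer at the new coordinate.\<close>

lemma coord_min:
  fixes z v :: "nat \<Rightarrow> real"
  assumes i: "i < nhat P" and th: "0 < th"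
  defines "w \<equiv> coord_min P th z v i"
  shows "hfun P i w < \<infinity>"
    and "hfun P i w' < \<infinity> \<Longrightarrow>
      hr P i w + (cfun P i (xst P v) - 2 * real (nhat P) * th * Lc P i * (w - z i)) * (w' - w) \<le> hr P i w'"
proof -
  let ?q = "real (nhat P) * th * Lc P i"
  have q: "0 < ?q" using n1 th Lc_pos i by simp
  obtain y where y: "\<forall>w'. ereal (?q * (y - z i)\<^sup>2 + gradd P v i * (y - z i)) + hfun P i y
      \<le> ereal (?q * (w' - z i)\<^sup>2 + gradd P v i * (w' - z i)) + hfun P i w'"
    using pcc_prox_exists[OF hfun_pcc[OF i] q, of "z i" "gradd P v i"] by blast
  have min: "ereal (?q * (w - z i)\<^sup>2 + gradd P v i * (w - z i)) + hfun P i w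
      \<le> ereal (?q * (w' - z i)\<^sup>2 + gradd P v i * (w' - z i)) + hfun P i w'" for w'
    using someI[where P = "\<lambda>w. \<forall>w'. ereal (?q * (w - z i)\<^sup>2 + gradd P v i * (w - z i)) + hfun P i w
      \<le> ereal (?q * (w' - z i)\<^sup>2 + gradd P v i * (w' - z i)) + hfun P i w'", OF y]
    unfolding w_def coord_min_def by blast
  show "hfun P i w < \<infinity>" by (rule pcc_prox_subgradient(1)[OF hfun_pcc[OF i] min])
  show "hr P i w + (cfun P i (xst P v) - 2 * real (nhat P) * th * Lc P i * (w - z i)) * (w' - w) \<le> hr P i w'"
    if "hfun P i w' < \<infinity>"
    using pcc_prox_subgradient(2)[OF hfun_pcc[OF i] min that] unfolding hr_def gradd_cfun
    by (simp add: mult.assoc)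
qed

text \<open>The nontrivial half of Fenchel equality: a subgradient of the regularizer at
  \<open>w\<close> makes Fenchel-Young tight. For constraint coordinates, the domain of the
  regularizer alone restricts \<open>s\<close>.\<close>

lemma psi_le:
  assumes i: "i < nhat P" and w: "hfun P i w < \<infinity>"
    and sub: "\<And>w'. hfun P i w' < \<infinity> \<Longrightarrow> hr P i w + s * (w' - w) \<le> hr P i w'"
  shows "psi P i s \<le> w * s - hr P i w"
    and "nn P \<le> i \<Longrightarrow> i < nn P + pp P \<Longrightarrow> s = 0"
    and "nn P + pp P \<le> i \<Longrightarrow> s \<le> 0"
proof -
  show eq: "s = 0" if "nn P \<le> i" "i < nn P + pp P"
  proof -
    have "hfun P i (w + s) < \<infinity>" using that unfolding hfun_def by simp
    from sub[OF this] have "s * s \<le> 0" using that by (simp add: hr_eq_0)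
    then show ?thesis by (auto simp: mult_le_0_iff)
  qed
  show neg: "s \<le> 0" if "nn P + pp P \<le> i"
  proof -
    have "0 \<le> w" using w that unfolding hfun_def by (auto split: if_splits)
    then have "hfun P i (w + 1) < \<infinity>" using that unfolding hfun_def by simp
    from sub[OF this] show ?thesis using that by (simp add: hr_eq_0)
  qed
  consider "i < nn P" | "nn P \<le> i" "i < nn P + pp P" | "nn P + pp P \<le> i" by linarith
  then show "psi P i s \<le> w * s - hr P i w"
  proof cases
    case 1
    define N t where "N = real (nn P)" and "t = N * s"
    have N: "0 < N" using n_pos unfolding N_def by simp
    \<comment> \<open>A subgradient \<open>r\<close> of the loss at \<open>t\<close> is a dual point
      where the conjugate is attained at \<open>t\<close>; testing the hypothesis on
      \<open>s\<close> at \<open>r\<close> gives the bound.\<close>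
    obtain r where r: "\<And>y. phi P i t + r \<bullet> (y - t) \<le> phi P i y"
      using convex_on_subgradient_exists[of "phi P i"] phi_cvx 1 by blast
    have c: "conjugate (phi P i) r \<le> ereal (r * t - phi P i t)"
      unfolding conjugate_le_iff using r by (auto simp: algebra_simps)
    have "hfun P i r = ereal (1 / N) * conjugate (phi P i) r"
      using 1 by (simp add: hfun_def N_def)
    also have "\<dots> \<le> ereal (1 / N) * ereal (r * t - phi P i t)"
      by (rule ereal_mult_left_mono[OF c]) (use N in simp)
    finally have h: "hfun P i r \<le> ereal ((r * t - phi P i t) / N)" by simp
    then have hfin: "hfun P i r < \<infinity>" by (cases "hfun P i r") auto
    have "hr P i r \<le> (r * t - phi P i t) / N" using h hfun_real[OF i hfin] by simp
    with sub[OF hfin] have "hr P i w + s * (r - w) \<le> (r * t - phi P i t) / N" by linarith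
    also have "\<dots> = r * s - phi P i t / N" using N unfolding t_def by (simp add: diff_divide_distrib)
    finally show ?thesis unfolding psi_def using 1 by (simp add: N_def t_def algebra_simps)
  next
    case 2
    then show ?thesis using eq by (simp add: psi_def hr_eq_0)
  next
    case 3
    have w0: "0 \<le> w" using w 3 unfolding hfun_def by (auto split: if_splits)
    have "hfun P i 0 < \<infinity>" using 3 unfolding hfun_def by simp
    from sub[OF this] have "0 \<le> w * s" using 3 by (simp add: hr_eq_0 algebra_simps)
    then show ?thesis using 3 by (simp add: psi_def hr_eq_0)
  qed
qed

lemma nsq_nonneg: "0 \<le> nsq P w"
  unfolding nsq_def using Lc_pos by (intro sum_nonneg) (simp add: less_imp_le)

lemma normL_nsq: "normL P w = sqrt (nsq P w)" "(normL P w)\<^sup>2 = nsq P w"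
  using nsq_nonneg unfolding normL_def nsq_def by auto

end

section \<open>Closedness of the dual solution set and projection onto it\<close>

context dual_problem
begin

lemma dval_cong:
  assumes "\<And>i. i < nhat P \<Longrightarrow> u i = v i"
  shows "dval P u = dval P v"
proof -
  have "Lagr P x u = Lagr P x v" for x unfolding Lagr_cfun using assms by simp
  then show ?thesis unfolding dval_def xst_def by simp
qed

lemma indom_cong: "(\<And>i. i < nhat P \<Longrightarrow> u i = v i) \<Longrightarrow> indom P u = indom P v"
  unfolding indom_def by auto

lemma Hr_cong: "(\<And>i. i < nhat P \<Longrightarrow> u i = v i) \<Longrightarrow> Hr P u = Hr P v"
  unfolding Hr_def by auto

lemma Dstar_cong:
  assumes "\<And>i. i < nhat P \<Longrightarrow> u i = v i"
  shows "u \<in> Dstar P \<longleftrightarrow> v \<in> Dstar P"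
proof -
  note eq = dval_cong[OF assms] indom_cong[OF assms] Hr_cong[OF assms]
  show ?thesis unfolding Dstar_iff by (simp add: eq)
qed

text \<open>The dual function and the conjugates are suprema over \<open>x\<close> and over
  \<open>t\<close>, so optimality becomes a family of inequalities affine in \<open>w\<close>, from
  which closedness is immediate.\<close>

lemma Dstar_halfspaces:
  "Dstar P = {w. (\<forall>i. nn P + pp P \<le> i \<and> i < nhat P \<longrightarrow> 0 \<le> w i) \<and>
     (\<forall>x t. - Lagr P x w + (\<Sum>i<nn P. (w i * t i - phi P i (t i)) / real (nn P)) \<le> Dopt)}"
    (is "_ = {w. ?A w \<and> ?B w}")
proof (intro set_eqI iffI)
  fix w assume w: "w \<in> Dstar P"
  then have dom: "indom P w" by (rule Dstar_indom)
  have "?B w"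
  proof (intro allI)
    fix x t
    have "(\<Sum>i<nn P. (w i * t i - phi P i (t i)) / real (nn P)) \<le> (\<Sum>i<nn P. hr P i (w i))"
      using dom unfolding indom_def nhat_def by (intro sum_mono conjugate_phi) auto
    also have "\<dots> = Hr P w" unfolding Hr_def sum_nhat by (simp add: hr_eq_0)
    finally show "- Lagr P x w + (\<Sum>i<nn P. (w i * t i - phi P i (t i)) / real (nn P)) \<le> Dopt"
      using dval_ge[OF indom_Dset[OF dom], of x] Dstar_value[OF w] by linarith
  qed
  moreover have "?A w" using indom_Dset[OF dom] unfolding Dset_def by blast
  ultimately show "w \<in> {w. ?A w \<and> ?B w}" by blast
next
  fix w assume "w \<in> {w. ?A w \<and> ?B w}"
  then have A: "?A w" and B: "?B w" by auto
  define N where "N = real (nn P)"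
  have N: "0 < N" using n_pos unfolding N_def by simp
  \<comment> \<open>The test values are independent across coordinates: varying only
    \<open>t i\<close> bounds the conjugate number \<open>i\<close>.\<close>
  have fin: "conjugate (phi P i) (w i) < \<infinity>" if i: "i < nn P" for i
  proof -
    define c where "c = (\<Sum>j\<in>{..<nn P} - {i}. (w j * 0 - phi P j 0) / N)"
    have "w i * t - phi P i t \<le> N * (Dopt + Lagr P 0 w - c)" for t
    proof -
      have "(\<Sum>j<nn P. (w j * (if j = i then t else 0) - phi P j (if j = i then t else 0)) / N)
         = (w i * t - phi P i t) / N + c"
        unfolding c_def using i by (subst sum.remove[of _ i]) (auto intro!: sum.cong)
      then have "- Lagr P 0 w + ((w i * t - phi P i t) / N + c) \<le> Dopt"
        using B[rule_format, of 0 "\<lambda>j. if j = i then t else 0"] unfolding N_def by simp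
      then have "(w i * t - phi P i t) / N \<le> Dopt + Lagr P 0 w - c" by linarith
      then show ?thesis using N by (simp add: divide_le_eq mult.commute)
    qed
    then have "conjugate (phi P i) (w i) \<le> ereal (N * (Dopt + Lagr P 0 w - c))"
      unfolding conjugate_le_iff by blast
    then show ?thesis by (cases "conjugate (phi P i) (w i)") auto
  qed
  have dom: "indom P w"
    unfolding indom_def
  proof (intro allI impI)
    fix i assume i: "i < nhat P"
    show "hfun P i (w i) < \<infinity>"
    proof (cases "i < nn P")
      case True
      then show ?thesis using fin[OF True] n_pos unfolding hfun_def
        by (cases "conjugate (phi P i) (w i)") auto
    next
      case False
      then show ?thesis using A i unfolding hfun_def by auto
    qed
  qed
  have "dval P w + Hr P w \<le> Dopt"
  proof (rule field_le_epsilon)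
    fix e :: real assume e: "0 < e"
    \<comment> \<open>Near-maximizers with slack \<open>e / N\<close> for each loss, adding up to
      \<open>e\<close>.\<close>
    have "\<exists>t. i < nn P \<longrightarrow> hr P i (w i) - e / N \<le> (w i * t - phi P i t) / N" for i
    proof (cases "i < nn P")
      case True
      let ?c = "conjugate (phi P i) (w i)"
      have ih: "i < nhat P" using True unfolding nhat_def by simp
      have "\<not> ?c \<le> ereal (N * hr P i (w i) - e)"
      proof
        assume c: "?c \<le> ereal (N * hr P i (w i) - e)"
        have "ereal (hr P i (w i)) = hfun P i (w i)"
          using hfun_real[OF ih] dom ih unfolding indom_def by simp
        also have "\<dots> = ereal (1 / N) * ?c" using True by (simp add: hfun_def N_def)
        also have "\<dots> \<le> ereal (1 / N) * ereal (N * hr P i (w i) - e)"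
          by (rule ereal_mult_left_mono[OF c]) (use N in simp)
        finally show False using e N by (simp add: field_simps)
      qed
      then obtain t where "N * hr P i (w i) - e < w i * t - phi P i t"
        unfolding conjugate_le_iff by (auto simp: not_le)
      then have "(N * hr P i (w i) - e) / N \<le> (w i * t - phi P i t) / N" using N by (intro divide_right_mono) auto
      then have "hr P i (w i) - e / N \<le> (w i * t - phi P i t) / N" using N by (simp add: diff_divide_distrib)
      then show ?thesis by blast
    qed simp
    then obtain t where t: "\<And>i. i < nn P \<Longrightarrow> hr P i (w i) - e / N \<le> (w i * t i - phi P i (t i)) / N"
      by metis
    have "Hr P w - e = (\<Sum>i<nn P. hr P i (w i) - e / N)"
      using N unfolding Hr_def sum_nhat by (simp add: hr_eq_0 sum_subtractf N_def)
    also have "\<dots> \<le> (\<Sum>i<nn P. (w i * t i - phi P i (t i)) / N)" by (intro sum_mono t) auto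
    finally have "Hr P w - e \<le> (\<Sum>i<nn P. (w i * t i - phi P i (t i)) / N)" .
    moreover have "dval P w + (\<Sum>i<nn P. (w i * t i - phi P i (t i)) / N) \<le> Dopt"
      using B[rule_format, of "xst P w" t] unfolding dval_def N_def .
    ultimately show "dval P w + Hr P w \<le> Dopt + e" by linarith
  qed
  with dom show "w \<in> Dstar P" unfolding Dstar_iff by blast
qed

lemma closed_Dstar: "closed (Dstar P)"
proof -
  have c: "continuous_on UNIV (\<lambda>w::nat \<Rightarrow> real. w i)" for i by simp
  show ?thesis
    unfolding Dstar_halfspaces Lagr_cfun
    by (intro closed_Collect_conj closed_Collect_all closed_Collect_imp open_Collect_const
        closed_Collect_le continuous_intros c) (use n_pos in auto)
qed

text \<open>Dual points are functions on all naturals, of which only the first \<open>nhat P\<close>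
  values count. Setting the others to 0 and confining these to a box given by the distance to
  \<open>ust\<close> makes the search compact in the product topology.\<close>

lemma ProjD:
  shows "ProjD P u \<in> Dstar P" and "w \<in> Dstar P \<Longrightarrow> normL P (u - ProjD P u) \<le> normL P (u - w)"
proof -
  define tr where "tr w i = (if i < nhat P then w i else 0)" for w :: "nat \<Rightarrow> real" and i
  have tr: "tr w \<in> Dstar P \<longleftrightarrow> w \<in> Dstar P" for w by (rule Dstar_cong) (simp add: tr_def)
  have ntr: "normL P (u - tr w) = normL P (u - w)" for w unfolding normL_def tr_def by simp
  define R where "R = normL P (u - ust)"
  have R0: "0 \<le> R" unfolding R_def normL_nsq using nsq_nonneg by simp
  define I where "I i = (if i < nhat P then {u i - R / sqrt (Lc P i) .. u i + R / sqrt (Lc P i)} else {0})" for i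
  have "compact (I i)" for i unfolding I_def by simp
  then have "compactin (product_topology (\<lambda>_. euclidean) UNIV) (PiE UNIV I)"
    unfolding compactin_PiE by simp
  then have cI: "compact (PiE UNIV I)"
    by (simp add: euclidean_product_topology flip: compactin_euclidean_iff)
  have cC: "compact (PiE UNIV I \<inter> Dstar P)" using cI closed_Dstar by (rule compact_Int_closed)
  have inI: "tr w \<in> PiE UNIV I \<inter> Dstar P" if w: "w \<in> Dstar P" "normL P (u - w) \<le> R" for w
  proof -
    have "tr w i \<in> I i" for i
    proof (cases "i < nhat P")
      case True
      then have L: "0 < Lc P i" using Lc_pos by blast
      have "Lc P i * (u i - w i)\<^sup>2 \<le> nsq P (u - w)"
        unfolding nsq_def minus_apply using True Lc_pos
        by (intro member_le_sum[where f = "\<lambda>i. Lc P i * (u i - w i)\<^sup>2"]) (auto simp: less_imp_le)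
      also have "\<dots> \<le> R\<^sup>2" using w(2) nsq_nonneg unfolding normL_nsq by (simp add: sqrt_le_D)
      finally have "(u i - w i)\<^sup>2 \<le> (R / sqrt (Lc P i))\<^sup>2" using L by (simp add: power_divide field_simps)
      then have "\<bar>u i - w i\<bar> \<le> R / sqrt (Lc P i)"
        using R0 L abs_le_square_iff[of "u i - w i" "R / sqrt (Lc P i)"] by (simp add: abs_of_nonneg)
      then show ?thesis using True unfolding tr_def I_def by auto
    qed (simp add: tr_def I_def)
    then show ?thesis using w(1) tr by auto
  qed
  have ne: "PiE UNIV I \<inter> Dstar P \<noteq> {}" using inI[OF ust] unfolding R_def by auto
  have "continuous_on (PiE UNIV I \<inter> Dstar P) (\<lambda>w. normL P (u - w))"
  proof -
    have c: "continuous_on S (\<lambda>w::nat \<Rightarrow> real. w i)" for i S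
      by (rule continuous_on_subset[of UNIV]) auto
    show ?thesis unfolding normL_def minus_apply by (intro continuous_intros c)
  qed
  from continuous_attains_inf[OF cC ne this] obtain w where
    w: "w \<in> Dstar P" "\<And>v. v \<in> PiE UNIV I \<inter> Dstar P \<Longrightarrow> normL P (u - w) \<le> normL P (u - v)" by blast
  have "normL P (u - w) \<le> normL P (u - v)" if v: "v \<in> Dstar P" for v
  proof (cases "normL P (u - v) \<le> R")
    case True
    from w(2)[OF inI[OF v True]] show ?thesis unfolding ntr .
  next
    case False
    have "normL P (u - w) \<le> R" using w(2)[OF inI[OF ust]] unfolding ntr R_def by simp
    with False show ?thesis by simp
  qed
  with w(1) have "w \<in> Dstar P \<and> (\<forall>v\<in>Dstar P. normL P (u - w) \<le> normL P (u - v))" by blast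
  from someI[where P = "\<lambda>w. w \<in> Dstar P \<and> (\<forall>v\<in>Dstar P. normL P (u - w) \<le> normL P (u - v))", OF this]
  show "ProjD P u \<in> Dstar P" and "w \<in> Dstar P \<Longrightarrow> normL P (u - ProjD P u) \<le> normL P (u - w)" for w
    unfolding ProjD_def by blast+
qed

subsection \<open>One step of the method\<close>

abbreviation "Ecoord X \<equiv> avg {..<nhat P} X"

text \<open>One step from a fixed state: \<open>zt\<close> is the prox step in every coordinate at
  once, \<open>z' i\<close> and \<open>u' i\<close> are the outcomes of drawing \<open>i\<close>,
  and \<open>step_s\<close> is the subgradient of the regularizer at \<open>zt\<close>.
  \<open>Hh\<close> stands for the current value of the majorant.\<close>

context
  fixes k :: nat and z u :: "nat \<Rightarrow> real" and Hh :: real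
  fixes n th v zt z' u' x step_s
  defines "n \<equiv> real (nhat P)"
    and "th \<equiv> theta P k"
    and "v \<equiv> (\<lambda>j. th * z j + (1 - th) * u j)"
    and "zt \<equiv> (\<lambda>i. coord_min P th z v i)"
    and "z' \<equiv> (\<lambda>i. z(i := zt i))"
    and "u' \<equiv> (\<lambda>i j. v j + n * th * (z' i j - z j))"
    and "x \<equiv> xst P v"
    and "step_s \<equiv> (\<lambda>i. cfun P i x - 2 * n * th * Lc P i * (zt i - z i))"
  assumes z: "z \<in> Dset P" and u: "u \<in> Dset P" and u': "\<And>i. i < nhat P \<Longrightarrow> u' i \<in> Dset P"
begin

lemma step_th: "0 < th" "th \<le> 1" "0 < n"
  using theta_pos[OF n1] theta_le_1[OF n1] n1 unfolding th_def n_def by auto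

lemma step_v: "v \<in> Dset P"
  using z u step_th unfolding v_def Dset_def by auto

lemma step_zt: "i < nhat P \<Longrightarrow> hfun P i (zt i) < \<infinity>"
  unfolding zt_def using coord_min(1) step_th by blast

lemma avg_nsq_step:
  "Ecoord (\<lambda>i. nsq P (\<lambda>j. w j - z' i j))
     = nsq P (\<lambda>j. w j - z j) + (nsq P (\<lambda>j. w j - zt j) - nsq P (\<lambda>j. w j - z j)) / n"
  "Ecoord (\<lambda>i. nsq P (z' i)) = nsq P z + (nsq P zt - nsq P z) / n"
  "Ecoord (\<lambda>i. nsq P (\<lambda>j. z' i j - z j)) = nsq P (\<lambda>j. zt j - z j) / n"
  "Ecoord (\<lambda>i. Hr P (z' i)) = Hr P z + (Hr P zt - Hr P z) / n"
  unfolding nsq_def Hr_def z'_def n_def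
  subgoal using avg_coordinate_update[OF n1, of "\<lambda>j t. Lc P j * (w j - t)\<^sup>2" z zt] by (simp add: sum_subtractf)
  subgoal using avg_coordinate_update[OF n1, of "\<lambda>j t. Lc P j * t\<^sup>2" z zt] by (simp add: sum_subtractf)
  subgoal using avg_coordinate_update[OF n1, of "\<lambda>j t. Lc P j * (t - z j)\<^sup>2" z zt] by (simp add: sum_subtractf)
  subgoal using avg_coordinate_update[OF n1, of "\<lambda>j t. hr P j t" z zt] by (simp add: sum_subtractf)
  done

text \<open>Coordinate smoothness is averaged over the draw, and the linear model at
  \<open>v = th * z + (1 - th) * u\<close> is split accordingly: the part towards \<open>u\<close>
  is bounded by convexity of \<open>dval\<close>, the part towards \<open>zt\<close> remains a
  Lagrangian value.\<close>

lemma step_base: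
  "Ecoord (\<lambda>i. dval P (u' i) + ((1 - th) * Hh + th * (1 - n) * Hr P z + n * th * Hr P (z' i)))
   \<le> (1 - th) * (dval P u + Hh) + th * (Hr P zt - Lagr P x zt) + n * th\<^sup>2 / 2 * nsq P (\<lambda>j. zt j - z j)"
proof -
  have fin: "finite {..<nhat P}" "{..<nhat P} \<noteq> {}" using n1 by (auto simp: lessThan_empty_iff)
  define g where "g = gradd P v"
  have "dval P (u' i) \<le> dval P v + (g i * (n * th * (zt i - z i)) + Lc P i / 2 * (n * th * (zt i - z i))\<^sup>2)"
    if i: "i < nhat P" for i
  proof -
    have eq: "u' i = v(i := v i + n * th * (zt i - z i))" unfolding u'_def z'_def by auto
    show ?thesis unfolding eq g_def
      using dval_coordinate_smooth[OF step_v _ i, of "n * th * (zt i - z i)"] u'[OF i] unfolding eq by simp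
  qed
  then have "Ecoord (\<lambda>i. dval P (u' i))
     \<le> Ecoord (\<lambda>i. dval P v + (g i * (n * th * (zt i - z i)) + Lc P i / 2 * (n * th * (zt i - z i))\<^sup>2))"
    by (intro avg_mono) auto
  also have "\<dots> = dval P v + (\<Sum>i<nhat P. g i * (n * th * (zt i - z i)) + Lc P i / 2 * (n * th * (zt i - z i))\<^sup>2) / n"
    unfolding avg_add[of _ "\<lambda>_. dval P v"] avg_const[OF fin] by (simp add: avg_def n_def)
  also have "(\<Sum>i<nhat P. g i * (n * th * (zt i - z i)) + Lc P i / 2 * (n * th * (zt i - z i))\<^sup>2)
     = n * (th * (\<Sum>i<nhat P. g i * (zt i - z i)) + n * th\<^sup>2 / 2 * nsq P (\<lambda>j. zt j - z j))"
    unfolding nsq_def sum_distrib_left distrib_left sum.distrib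
    by (intro arg_cong2[where f = "(+)"] sum.cong) (auto simp: power2_eq_square)
  finally have 1: "Ecoord (\<lambda>i. dval P (u' i))
     \<le> dval P v + th * (\<Sum>i<nhat P. g i * (zt i - z i)) + n * th\<^sup>2 / 2 * nsq P (\<lambda>j. zt j - z j)"
    using step_th by simp
  have "th * (\<Sum>i<nhat P. g i * (zt i - z i)) = th * (\<Sum>i<nhat P. g i * (zt i - v i)) + (1 - th) * (\<Sum>i<nhat P. g i * (u i - v i))"
    unfolding sum_distrib_left sum.distrib[symmetric]
    by (intro sum.cong) (auto simp: v_def algebra_simps)
  then have "dval P v + th * (\<Sum>i<nhat P. g i * (zt i - z i)) =
    th * (dval P v + (\<Sum>i<nhat P. g i * (zt i - v i))) + (1 - th) * (dval P v + (\<Sum>i<nhat P. g i * (u i - v i)))"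
    by (simp add: algebra_simps)
  also have "\<dots> \<le> th * (- Lagr P x zt) + (1 - th) * dval P u"
    unfolding g_def x_def dval_linearization[of P v zt]
    using dval_convex_linearization[OF u, of v] step_th by (intro add_mono mult_left_mono) auto
  finally have 2: "dval P v + th * (\<Sum>i<nhat P. g i * (zt i - z i)) \<le> th * (- Lagr P x zt) + (1 - th) * dval P u" .
  \<comment> \<open>The factor \<open>n\<close> undoes the draw probability, so the negatively
    weighted \<open>Hr P z\<close> drops out of the average.\<close>
  have 3: "Ecoord (\<lambda>i. (1 - th) * Hh + th * (1 - n) * Hr P z + n * th * Hr P (z' i)) = (1 - th) * Hh + th * Hr P zt"
    unfolding avg_add[of _ "\<lambda>_. (1 - th) * Hh + th * (1 - n) * Hr P z"] avg_const[OF fin] avg_cmult avg_nsq_step(4)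
    using step_th by (simp add: field_simps)
  show ?thesis unfolding avg_add[of _ "\<lambda>i. dval P (u' i)"] 3 using 1 2 by (simp add: algebra_simps)
qed

text \<open>The three-point inequality of the prox step subtracts \<open>n * th^2\<close> times the
  squared full step; smoothness in \<open>step_base\<close> uses half of it, and the other half is
  kept on the left.\<close>

lemma step_reference:
  assumes w: "indom P w"
  shows "Ecoord (\<lambda>i. dval P (u' i) + ((1 - th) * Hh + th * (1 - n) * Hr P z + n * th * Hr P (z' i)))
      + n\<^sup>2 * th\<^sup>2 * Ecoord (\<lambda>i. nsq P (\<lambda>j. w j - z' i j))
      + n\<^sup>2 * th\<^sup>2 / 2 * Ecoord (\<lambda>i. nsq P (\<lambda>j. z' i j - z j))
   \<le> (1 - th) * (dval P u + Hh) + th * (Hr P w - Lagr P x w) + n\<^sup>2 * th\<^sup>2 * nsq P (\<lambda>j. w j - z j)"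
proof -
  define AD where "AD = Ecoord (\<lambda>i. dval P (u' i) + ((1 - th) * Hh + th * (1 - n) * Hr P z + n * th * Hr P (z' i)))"
  define AW AZ where "AW = Ecoord (\<lambda>i. nsq P (\<lambda>j. w j - z' i j))"
    and "AZ = Ecoord (\<lambda>i. nsq P (\<lambda>j. z' i j - z j))"
  have "hr P i (zt i) - zt i * cfun P i x \<le> hr P i (w i) - w i * cfun P i x
     + n * th * (Lc P i * (w i - z i)\<^sup>2 - Lc P i * (w i - zt i)\<^sup>2 - Lc P i * (zt i - z i)\<^sup>2)" if i: "i < nhat P" for i
  proof -
    have "hr P i (zt i) + (cfun P i x - 2 * n * th * Lc P i * (zt i - z i)) * (w i - zt i) \<le> hr P i (w i)"
      using coord_min(2)[OF i step_th(1), of "w i" z v] w i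
      unfolding indom_def zt_def x_def n_def by blast
    then show ?thesis by (simp add: power2_eq_square algebra_simps)
  qed
  then have "(\<Sum>i<nhat P. hr P i (zt i) - zt i * cfun P i x) \<le> (\<Sum>i<nhat P. hr P i (w i) - w i * cfun P i x
     + n * th * (Lc P i * (w i - z i)\<^sup>2 - Lc P i * (w i - zt i)\<^sup>2 - Lc P i * (zt i - z i)\<^sup>2))"
    by (intro sum_mono) auto
  then have "Hr P zt - Lagr P x zt \<le> Hr P w - Lagr P x w
     + n * th * (nsq P (\<lambda>j. w j - z j) - nsq P (\<lambda>j. w j - zt j) - nsq P (\<lambda>j. zt j - z j))"
    unfolding Hr_def Lagr_cfun nsq_def by (simp add: sum.distrib sum_subtractf sum_distrib_left algebra_simps)
  then have "th * (Hr P zt - Lagr P x zt) \<le> th * (Hr P w - Lagr P x w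
     + n * th * (nsq P (\<lambda>j. w j - z j) - nsq P (\<lambda>j. w j - zt j) - nsq P (\<lambda>j. zt j - z j)))"
    using step_th by (intro mult_left_mono) auto
  moreover have "n\<^sup>2 * th\<^sup>2 * AW
     = n\<^sup>2 * th\<^sup>2 * nsq P (\<lambda>j. w j - z j) + n * th\<^sup>2 * (nsq P (\<lambda>j. w j - zt j) - nsq P (\<lambda>j. w j - z j))"
    unfolding AW_def avg_nsq_step using step_th by (simp add: field_simps power2_eq_square)
  moreover have zz: "nsq P (\<lambda>j. zt j - z j) = n * AZ"
    unfolding AZ_def avg_nsq_step using step_th by simp
  ultimately show ?thesis using step_base unfolding AD_def[symmetric] AW_def[symmetric] AZ_def[symmetric] zz
    by (simp add: algebra_simps power2_eq_square)
qed

lemma step_subgradient: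
  assumes i: "i < nhat P"
  shows "psi P i (step_s i) \<le> zt i * step_s i - hr P i (zt i)"
    and "nn P \<le> i \<Longrightarrow> i < nn P + pp P \<Longrightarrow> step_s i = 0"
    and "nn P + pp P \<le> i \<Longrightarrow> step_s i \<le> 0"
  using psi_le[OF i step_zt[OF i], of "step_s i"] coord_min(2)[OF i step_th(1), of _ z v]
  unfolding step_s_def zt_def x_def n_def by blast+

text \<open>Instead of comparing with a reference point, Fenchel equality at \<open>zt\<close> is
  used, so a primal value appears on the right and the distances of \<open>z\<close> are measured
  from the origin.\<close>

lemma step_primal:
  "Ecoord (\<lambda>i. dval P (u' i) + ((1 - th) * Hh + th * (1 - n) * Hr P z + n * th * Hr P (z' i)))
      + n\<^sup>2 * th\<^sup>2 * Ecoord (\<lambda>i. nsq P (z' i))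
   \<le> (1 - th) * (dval P u + Hh) - th * (ff P x + (\<Sum>i<nhat P. psi P i (step_s i))) + n\<^sup>2 * th\<^sup>2 * nsq P z"
proof -
  define AD where "AD = Ecoord (\<lambda>i. dval P (u' i) + ((1 - th) * Hh + th * (1 - n) * Hr P z + n * th * Hr P (z' i)))"
  define AZ where "AZ = Ecoord (\<lambda>i. nsq P (z' i))"
  have "psi P i (step_s i) \<le> zt i * cfun P i x - hr P i (zt i)
     - n * th * (Lc P i * (zt i)\<^sup>2 - Lc P i * (z i)\<^sup>2 + Lc P i * (zt i - z i)\<^sup>2)" if i: "i < nhat P" for i
    using step_subgradient(1)[OF i] unfolding step_s_def by (simp add: power2_eq_square algebra_simps)
  then have "(\<Sum>i<nhat P. psi P i (step_s i)) \<le> (\<Sum>i<nhat P. zt i * cfun P i x - hr P i (zt i)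
     - n * th * (Lc P i * (zt i)\<^sup>2 - Lc P i * (z i)\<^sup>2 + Lc P i * (zt i - z i)\<^sup>2))"
    by (intro sum_mono) auto
  then have "Hr P zt - Lagr P x zt \<le> - (ff P x + (\<Sum>i<nhat P. psi P i (step_s i)))
     - n * th * (nsq P zt - nsq P z + nsq P (\<lambda>j. zt j - z j))"
    unfolding Hr_def Lagr_cfun nsq_def by (simp add: sum.distrib sum_subtractf sum_distrib_left algebra_simps)
  then have "th * (Hr P zt - Lagr P x zt) \<le> th * (- (ff P x + (\<Sum>i<nhat P. psi P i (step_s i)))
     - n * th * (nsq P zt - nsq P z + nsq P (\<lambda>j. zt j - z j)))"
    using step_th by (intro mult_left_mono) auto
  moreover have "n\<^sup>2 * th\<^sup>2 * AZ = n\<^sup>2 * th\<^sup>2 * nsq P z + n * th\<^sup>2 * (nsq P zt - nsq P z)"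
    unfolding AZ_def avg_nsq_step using step_th by (simp add: field_simps power2_eq_square)
  moreover have "0 \<le> n * th\<^sup>2 / 2 * nsq P (\<lambda>j. zt j - z j)" using step_th nsq_nonneg by simp
  ultimately show ?thesis using step_base unfolding AD_def[symmetric] AZ_def[symmetric]
    by (simp add: algebra_simps power2_eq_square)
qed

end

end

subsection \<open>A single run\<close>

definition run_z :: "('a::real_inner) cprob \<Rightarrow> (nat \<Rightarrow> real) \<Rightarrow> nat \<Rightarrow> (nat \<Rightarrow> nat) \<Rightarrow> nat \<Rightarrow> real" where
  "run_z P u0 k s = fst (ardca_state P u0 s k)"

definition run_zt :: "('a::real_inner) cprob \<Rightarrow> (nat \<Rightarrow> real) \<Rightarrow> nat \<Rightarrow> (nat \<Rightarrow> nat) \<Rightarrow> nat \<Rightarrow> real" where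
  "run_zt P u0 k s i = coord_min P (theta P k) (run_z P u0 k s) (ardca_v P u0 s k) i"

fun run_H :: "('a::real_inner) cprob \<Rightarrow> (nat \<Rightarrow> real) \<Rightarrow> nat \<Rightarrow> (nat \<Rightarrow> nat) \<Rightarrow> real" where
  "run_H P u0 0 s = Hr P u0"
| "run_H P u0 (Suc k) s = (1 - theta P k) * run_H P u0 k s
     + theta P k * (1 - real (nhat P)) * Hr P (run_z P u0 k s)
     + real (nhat P) * theta P k * Hr P (run_z P u0 (Suc k) s)"

definition run_D :: "('a::real_inner) cprob \<Rightarrow> (nat \<Rightarrow> real) \<Rightarrow> nat \<Rightarrow> (nat \<Rightarrow> nat) \<Rightarrow> real" where
  "run_D P u0 k s = dval P (ardca_u P u0 s k) + run_H P u0 k s"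

definition run_s :: "('a::real_inner) cprob \<Rightarrow> (nat \<Rightarrow> real) \<Rightarrow> nat \<Rightarrow> (nat \<Rightarrow> nat) \<Rightarrow> nat \<Rightarrow> real" where
  "run_s P u0 k s i = cfun P i (xst P (ardca_v P u0 s k))
     - 2 * real (nhat P) * theta P k * Lc P i * (run_zt P u0 k s i - run_z P u0 k s i)"

lemma run_0: "run_z P u0 0 s = u0" "ardca_u P u0 s 0 = u0"
  unfolding run_z_def ardca_u_def by auto

lemma ardca_v_eq: "ardca_v P u0 s k = (\<lambda>j. theta P k * run_z P u0 k s j + (1 - theta P k) * ardca_u P u0 s k j)"
  unfolding ardca_v_def run_z_def ardca_u_def by simp

lemma run_z_Suc: "run_z P u0 (Suc k) s = (run_z P u0 k s)(s k := run_zt P u0 k s (s k))"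
  unfolding run_zt_def ardca_v_eq run_z_def ardca_u_def by (simp add: Let_def)

lemma run_u_Suc: "ardca_u P u0 s (Suc k) = (\<lambda>j. ardca_v P u0 s k j
     + real (nhat P) * theta P k * (run_z P u0 (Suc k) s j - run_z P u0 k s j))"
  unfolding ardca_v_eq run_z_def ardca_u_def by (simp add: Let_def)

lemma ardca_state_upd: "k \<le> j \<Longrightarrow> ardca_state P u0 (s(j := i)) k = ardca_state P u0 s k"
  by (induction k) (auto simp: Let_def)

text \<open>Adaptedness: everything at time \<open>k\<close> is determined by the draws before
  \<open>k\<close>.\<close>

lemma run_upd:
  assumes "k \<le> j"
  shows "run_z P u0 k (s(j := i)) = run_z P u0 k s"
    and "ardca_u P u0 (s(j := i)) k = ardca_u P u0 s k"
    and "ardca_v P u0 (s(j := i)) k = ardca_v P u0 s k"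
    and "run_zt P u0 k (s(j := i)) = run_zt P u0 k s"
    and "run_H P u0 k (s(j := i)) = run_H P u0 k s"
    and "run_D P u0 k (s(j := i)) = run_D P u0 k s"
proof -
  note st = ardca_state_upd[OF assms]
  show 1: "run_z P u0 k (s(j := i)) = run_z P u0 k s"
    and 2: "ardca_u P u0 (s(j := i)) k = ardca_u P u0 s k"
    and 3: "ardca_v P u0 (s(j := i)) k = ardca_v P u0 s k"
    unfolding run_z_def ardca_u_def ardca_v_def st by auto
  show "run_zt P u0 k (s(j := i)) = run_zt P u0 k s"
    unfolding run_zt_def 1 3 by auto
  show 4: "run_H P u0 k (s(j := i)) = run_H P u0 k s"
    using assms by (induction k) (auto simp: run_z_def ardca_state_upd simp del: ardca_state.simps)
  show "run_D P u0 k (s(j := i)) = run_D P u0 k s"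
    unfolding run_D_def 2 4 ..
qed

text \<open>\<open>U'\<close> is an affine combination of \<open>Z'\<close> and a point V with
  weights \<open>n * t\<close> and \<open>1 - n * t\<close>, and V one of \<open>U\<close> and
  \<open>Z\<close>. Stewart's identity for both, with V eliminated, gives the formula.\<close>

lemma three_point_identity:
  fixes W U Z Z' t n :: real
  assumes "n * t \<noteq> 1"
  defines "U' \<equiv> t * Z + (1 - t) * U + n * t * (Z' - Z)"
  shows "(W - U')\<^sup>2 = n * t * (W - Z')\<^sup>2 + (1 - t) * (W - U)\<^sup>2 - (n - 1) * t * (W - Z)\<^sup>2
     + (1 - t) * (n - 1) * t / (1 - n * t) * (U - Z)\<^sup>2 - n * t / (1 - n * t) * (U' - Z')\<^sup>2"
proof -
  have nz: "1 - n * t \<noteq> 0" using assms(1) by simp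
  have "(1 - n * t) * (W - U')\<^sup>2 = (1 - n * t) * (n * t * (W - Z')\<^sup>2 + (1 - t) * (W - U)\<^sup>2 - (n - 1) * t * (W - Z)\<^sup>2)
     + (1 - t) * (n - 1) * t * (U - Z)\<^sup>2 - n * t * (U' - Z')\<^sup>2"
    unfolding U'_def by algebra
  also have "\<dots> = (1 - n * t) * (n * t * (W - Z')\<^sup>2 + (1 - t) * (W - U)\<^sup>2 - (n - 1) * t * (W - Z)\<^sup>2
     + (1 - t) * (n - 1) * t / (1 - n * t) * (U - Z)\<^sup>2 - n * t / (1 - n * t) * (U' - Z')\<^sup>2)"
    using nz by (simp add: distrib_left right_diff_distrib)
  finally show ?thesis using nz by simp
qed

context dual_problem
begin

lemma Hr_convex:
  assumes "indom P x" "indom P y" "0 \<le> a" "0 \<le> b" "a + b = 1"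
  shows "indom P (\<lambda>j. a * x j + b * y j)" "Hr P (\<lambda>j. a * x j + b * y j) \<le> a * Hr P x + b * Hr P y"
proof -
  show "indom P (\<lambda>j. a * x j + b * y j)"
    using assms hr_convex(1) unfolding indom_def by blast
  have "Hr P (\<lambda>j. a * x j + b * y j) \<le> (\<Sum>i<nhat P. a * hr P i (x i) + b * hr P i (y i))"
    using assms hr_convex(2) unfolding indom_def Hr_def by (intro sum_mono) auto
  then show "Hr P (\<lambda>j. a * x j + b * y j) \<le> a * Hr P x + b * Hr P y"
    unfolding Hr_def by (simp add: sum.distrib sum_distrib_left)
qed

abbreviation "Eseq k X \<equiv> avg (seqs {..<nhat P} 0 k) X"

text \<open>No length is fixed: the padding value 0 is a valid coordinate itself, so one predicate
  serves runs of every length.\<close>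

definition "good s \<longleftrightarrow> (\<forall>j. s j < nhat P)" for s :: "nat \<Rightarrow> nat"

lemma seqs_good: "s \<in> seqs {..<nhat P} 0 k \<Longrightarrow> good s"
  using n1 unfolding seqs_def good_def by (auto, metis less_le_trans not_less zero_less_one)

lemma seqs_fin: "finite (seqs {..<nhat P} (0::nat) k)" "seqs {..<nhat P} (0::nat) k \<noteq> {}"
  using n1 by (auto intro!: finite_seqs seqs_nonempty simp: lessThan_empty_iff)

lemma Eseq_step: "Eseq (Suc k) X = Eseq k (\<lambda>s. Ecoord (\<lambda>i. X (s(k := i))))"
  by (rule avg_seqs_Suc) simp

lemma Eseq_indep: "(\<And>s i. X (s(k := i)) = X s) \<Longrightarrow> Eseq (Suc k) X = Eseq k X"
  using n1 by (intro avg_seqs_Suc_indep) (auto simp: lessThan_empty_iff)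

lemma Eseq_later: "(\<And>s j i. k \<le> j \<Longrightarrow> X (s(j := i)) = X s) \<Longrightarrow> k \<le> m \<Longrightarrow> Eseq m X = Eseq k X"
  using n1 by (intro avg_seqs_indep) (auto simp: lessThan_empty_iff)

end

text \<open>The reference solution \<open>w\<close> is chosen separately for each run. The
  alternative \<open>nhat P = 1\<close> admits a start point of infinite dual value, whose gap has
  weight \<open>1 - theta P 0 = 0\<close>.\<close>

locale ardca_run = dual_problem P ust
  for P :: "('a::euclidean_space) cprob" and ust +
  fixes u0 w :: "nat \<Rightarrow> real"
  assumes u0: "u0 \<in> Dset P" and init: "nhat P = 1 \<or> indom P u0" and w: "w \<in> Dstar P"
begin

lemma run_z_indom:
  assumes s: "good s"
  shows "indom P (run_z P u0 (Suc k) s)"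
proof -
  have zt: "hfun P i (run_zt P u0 k s i) < \<infinity>" if "i < nhat P" for i k
    unfolding run_zt_def using coord_min(1)[OF that] theta_pos[OF n1] by blast
  show ?thesis
  proof (induction k)
    case 0
    show ?case
    proof (cases "nhat P = 1")
      case True
      then have "s 0 = 0" using s unfolding good_def by (metis less_one)
      then show ?thesis using True zt[of 0 0] unfolding indom_def run_z_Suc by simp
    next
      case False
      then show ?thesis using init zt unfolding indom_def run_z_Suc run_0 by auto
    qed
  next
    case (Suc k)
    then show ?case using zt unfolding indom_def run_z_Suc[of _ _ "Suc k"] by auto
  qed
qed

text \<open>By convexity \<open>run_H\<close> dominates the regularizer at \<open>u\<close>: from the first step on, \<open>u\<close> is a convex
  combination of the \<open>z\<close>-iterates, and \<open>run_H\<close> is the same combination of the values.\<close>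

lemma run_u_decomp:
  assumes s: "good s"
  defines "n \<equiv> real (nhat P)"
  shows "\<exists>r. indom P r \<and> ardca_u P u0 s (Suc k)
       = (\<lambda>j. n * theta P k * run_z P u0 (Suc k) s j + (1 - n * theta P k) * r j)
     \<and> n * theta P k * Hr P (run_z P u0 (Suc k) s) + (1 - n * theta P k) * Hr P r \<le> run_H P u0 (Suc k) s"
proof (induction k)
  case 0
  have nt: "n * theta P 0 = 1" using n1 unfolding n_def by simp
  have "run_H P u0 (Suc 0) s = (1 - n * theta P 0) * Hr P u0 + n * theta P 0 * Hr P (run_z P u0 (Suc 0) s)"
    unfolding n_def run_H.simps run_0 by (simp add: algebra_simps del: theta.simps)
  moreover have "ardca_u P u0 s (Suc 0) = run_z P u0 (Suc 0) s"
    unfolding run_u_Suc ardca_v_eq run_0 n_def[symmetric] nt by (auto simp: algebra_simps)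
  ultimately show ?case using nt run_z_indom[of s 0, OF s] by (intro exI[of _ "run_z P u0 (Suc 0) s"]) auto
next
  case (Suc k)
  let ?z = "run_z P u0 (Suc k) s" and ?z' = "run_z P u0 (Suc (Suc k)) s"
  obtain r where r: "indom P r" "ardca_u P u0 s (Suc k) = (\<lambda>j. n * theta P k * ?z j + (1 - n * theta P k) * r j)"
     "n * theta P k * Hr P ?z + (1 - n * theta P k) * Hr P r \<le> run_H P u0 (Suc k) s"
    using Suc by blast
  \<comment> \<open>Splitting off the newest \<open>z\<close> leaves weight \<open>c\<close>, shared
    as \<open>a + b\<close> by the previous \<open>z\<close> and the previous mixture
    \<open>r\<close>.\<close>
  define t th c a b where "t = theta P k" and "th = theta P (Suc k)" and "c = 1 - n * th"
    and "a = (1 - th) * n * t - (n - 1) * th" and "b = (1 - th) * (1 - n * t)"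
  have c: "0 < c" using n_theta_less_1[OF n1] unfolding c_def th_def n_def by simp
  have a: "0 \<le> a" using theta_ratio[OF n1, of k] unfolding a_def th_def t_def n_def by simp
  have th1: "th \<le> 1" using theta_le_1[OF n1] unfolding th_def by blast
  have b: "0 \<le> b" using n_theta_le_1[OF n1, of k] th1
    unfolding b_def t_def n_def by (intro mult_nonneg_nonneg) auto
  have abc: "a + b = c" unfolding a_def b_def c_def by (simp add: algebra_simps)
  define r' where "r' = (\<lambda>j. a / c * ?z j + b / c * r j)"
  have r': "indom P r'" "Hr P r' \<le> a / c * Hr P ?z + b / c * Hr P r"
    unfolding r'_def using run_z_indom[of s k, OF s] r(1) a b c abc
    by (intro Hr_convex; simp flip: add_divide_distrib)+
  have cr': "c * r' j = a * ?z j + b * r j" for j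
    unfolding r'_def using c by (simp add: field_simps)
  have "ardca_u P u0 s (Suc (Suc k)) j = n * th * ?z' j + c * r' j" for j
    unfolding run_u_Suc[of _ _ _ "Suc k"] ardca_v_eq r(2) cr' a_def b_def n_def[symmetric] th_def[symmetric] t_def[symmetric]
    by (simp add: algebra_simps)
  moreover have "n * th * Hr P ?z' + c * Hr P r' \<le> run_H P u0 (Suc (Suc k)) s"
  proof -
    have "c * Hr P r' \<le> c * (a / c * Hr P ?z + b / c * Hr P r)" using r'(2) c by (intro mult_left_mono) auto
    also have "\<dots> = a * Hr P ?z + b * Hr P r" using c by (simp add: field_simps)
    also have "\<dots> = (1 - th) * (n * t * Hr P ?z + (1 - n * t) * Hr P r) + th * (1 - n) * Hr P ?z"
      unfolding a_def b_def by (simp add: algebra_simps)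
    also have "\<dots> \<le> (1 - th) * run_H P u0 (Suc k) s + th * (1 - n) * Hr P ?z"
      using r(3) th1 unfolding t_def by (intro add_right_mono mult_left_mono) auto
    finally show ?thesis unfolding run_H.simps(2)[of _ _ "Suc k"] n_def[symmetric] th_def[symmetric] by simp
  qed
  ultimately show ?case using r'(1) unfolding c_def th_def by blast
qed

lemma run_u_indom:
  assumes s: "good s"
  shows "indom P (ardca_u P u0 s (Suc k))" "Hr P (ardca_u P u0 s (Suc k)) \<le> run_H P u0 (Suc k) s"
proof -
  define a where "a = real (nhat P) * theta P k"
  have a: "0 \<le> a" "a \<le> 1"
    using n_theta_le_1[OF n1, of k] theta_pos[OF n1, of k] unfolding a_def by auto
  obtain r where r: "indom P r" "ardca_u P u0 s (Suc k) = (\<lambda>j. a * run_z P u0 (Suc k) s j + (1 - a) * r j)"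
     "a * Hr P (run_z P u0 (Suc k) s) + (1 - a) * Hr P r \<le> run_H P u0 (Suc k) s"
    using run_u_decomp[of s k, OF s] unfolding a_def by blast
  show "indom P (ardca_u P u0 s (Suc k))" "Hr P (ardca_u P u0 s (Suc k)) \<le> run_H P u0 (Suc k) s"
    using Hr_convex[OF run_z_indom[of s k, OF s] r(1) a(1), of "1 - a"] a r(3) unfolding r(2) by auto
qed

lemma run_Dset:
  assumes s: "good s"
  shows "run_z P u0 k s \<in> Dset P" "ardca_u P u0 s k \<in> Dset P"
  using u0 run_z_indom[OF s] run_u_indom(1)[OF s] indom_Dset by (cases k; auto simp: run_0)+

lemma run_D_ge: "good s \<Longrightarrow>
    dval P (ardca_u P u0 s (Suc k)) + Hr P (ardca_u P u0 s (Suc k)) \<le> run_D P u0 (Suc k) s"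
  using run_u_indom(2) unfolding run_D_def by simp

context
  fixes k and s :: "nat \<Rightarrow> nat" and n th
  assumes s: "good s"
  defines "n \<equiv> real (nhat P)" and "th \<equiv> theta P k"
begin

lemma s_upd: "i < nhat P \<Longrightarrow> good (s(k := i))"
  using s unfolding good_def by simp

lemma run_Suc_upd:
  "run_z P u0 (Suc k) (s(k := i)) = (run_z P u0 k s)(i := coord_min P (theta P k) (run_z P u0 k s)
      (\<lambda>j. theta P k * run_z P u0 k s j + (1 - theta P k) * ardca_u P u0 s k j) i)"
  "ardca_u P u0 (s(k := i)) (Suc k) = (\<lambda>j. theta P k * run_z P u0 k s j + (1 - theta P k) * ardca_u P u0 s k j
     + real (nhat P) * theta P k * (((run_z P u0 k s)(i := coord_min P (theta P k) (run_z P u0 k s)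
      (\<lambda>j. theta P k * run_z P u0 k s j + (1 - theta P k) * ardca_u P u0 s k j) i)) j - run_z P u0 k s j))"
  unfolding run_z_Suc run_u_Suc run_upd[OF order_refl] run_zt_def ardca_v_eq by auto

lemma run_D_Suc_upd:
  "run_D P u0 (Suc k) (s(k := i)) = dval P (ardca_u P u0 (s(k := i)) (Suc k))
     + ((1 - theta P k) * run_H P u0 k s + theta P k * (1 - real (nhat P)) * Hr P (run_z P u0 k s)
        + real (nhat P) * theta P k * Hr P (run_z P u0 (Suc k) (s(k := i))))"
  unfolding run_D_def run_H.simps run_upd[OF order_refl] ..

lemmas run_step_assms = run_Dset[of s k, OF s]
  run_Dset(2)[of "s(k := i)" "Suc k" for i, OF s_upd[of i for i], unfolded run_Suc_upd]

lemma run_reference: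
  assumes r: "indom P r"
  shows "Ecoord (\<lambda>i. run_D P u0 (Suc k) (s(k := i)))
      + n\<^sup>2 * th\<^sup>2 * Ecoord (\<lambda>i. nsq P (\<lambda>j. r j - run_z P u0 (Suc k) (s(k := i)) j))
      + n\<^sup>2 * th\<^sup>2 / 2 * Ecoord (\<lambda>i. nsq P (\<lambda>j. run_z P u0 (Suc k) (s(k := i)) j - run_z P u0 k s j))
   \<le> (1 - th) * run_D P u0 k s + th * (Hr P r - Lagr P (xst P (ardca_v P u0 s k)) r)
      + n\<^sup>2 * th\<^sup>2 * nsq P (\<lambda>j. r j - run_z P u0 k s j)"
  using step_reference[OF run_step_assms r, of "run_H P u0 k s"]
  unfolding run_D_Suc_upd unfolding run_Suc_upd ardca_v_eq run_D_def n_def th_def by simp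

lemma run_s:
  assumes i: "i < nhat P"
  shows "nn P \<le> i \<Longrightarrow> i < nn P + pp P \<Longrightarrow> run_s P u0 k s i = 0"
    and "nn P + pp P \<le> i \<Longrightarrow> run_s P u0 k s i \<le> 0"
  using step_subgradient(2,3)[OF run_step_assms i]
  unfolding run_s_def run_zt_def ardca_v_eq by auto

lemma run_primal:
  "Ecoord (\<lambda>i. run_D P u0 (Suc k) (s(k := i)))
      + n\<^sup>2 * th\<^sup>2 * Ecoord (\<lambda>i. nsq P (run_z P u0 (Suc k) (s(k := i))))
   \<le> (1 - th) * run_D P u0 k s
      - th * (ff P (xst P (ardca_v P u0 s k)) + (\<Sum>i<nhat P. psi P i (run_s P u0 k s i)))
      + n\<^sup>2 * th\<^sup>2 * nsq P (run_z P u0 k s)"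
  using step_primal[OF run_step_assms, of "run_H P u0 k s"]
  unfolding run_D_Suc_upd unfolding run_Suc_upd ardca_v_eq run_D_def n_def th_def run_s_def run_zt_def
  by simp

lemma run_nsq_step:
  "Ecoord (\<lambda>i. nsq P (\<lambda>j. run_z P u0 (Suc k) (s(k := i)) j - run_z P u0 k s j))
     = nsq P (\<lambda>j. run_zt P u0 k s j - run_z P u0 k s j) / n"
  using avg_nsq_step(3)[OF run_step_assms]
  unfolding run_Suc_upd ardca_v_eq run_zt_def n_def by simp

end

section \<open>Expected gaps, distances and step lengths along a run\<close>

definition "Edist k = Eseq k (\<lambda>s. nsq P (\<lambda>j. w j - run_z P u0 k s j))"
definition "Egap k = Eseq k (run_D P u0 k) - Dopt"
definition "Euz k = Eseq k (\<lambda>s. nsq P (\<lambda>j. ardca_u P u0 s k j - run_z P u0 k s j))"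
definition "Eudist k = Eseq k (\<lambda>s. nsq P (\<lambda>j. w j - ardca_u P u0 s k j))"
definition "Estep k = Eseq (Suc k) (\<lambda>s. nsq P (\<lambda>j. run_z P u0 (Suc k) s j - run_z P u0 k s j))"
definition "Ecorr k = Eseq (Suc k) (\<lambda>s. \<Sum>j<nhat P. Lc P j * ((ardca_u P u0 s k j - run_z P u0 k s j)
   * (run_z P u0 (Suc k) s j - run_z P u0 k s j)))"
definition "Tinit = (1 - theta P 0) * (dval P u0 + Hr P u0 - Dopt) + nsq P (\<lambda>j. w j - u0 j)"

text \<open>With \<open>w\<close> as reference point, the reference value is at most
  \<open>Dopt\<close>; multiplying by \<open>Xw P (Suc k)\<close> normalises the coefficient of the
  distances to 1.\<close>

lemma lyapunov: "Xw P (Suc k) * Egap (Suc k) + Edist (Suc k) + Estep k / 2 \<le> Xw P k * Egap k + Edist k"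
proof -
  define n th where "n = real (nhat P)" and "th = theta P k"
  have th: "0 < th" using theta_pos[OF n1] unfolding th_def by blast
  have X: "n\<^sup>2 * th\<^sup>2 * Xw P (Suc k) = 1" "Xw P k = (1 - th) * Xw P (Suc k)" "0 \<le> Xw P (Suc k)"
    using Xw_Suc[OF n1] Xw_step[OF n1, of k] Xw_nonneg[OF n1] unfolding n_def th_def by blast+
  note wd = Dstar_indom[OF w]
  have "Ecoord (\<lambda>i. run_D P u0 (Suc k) (s(k := i)))
      + n\<^sup>2 * th\<^sup>2 * Ecoord (\<lambda>i. nsq P (\<lambda>j. w j - run_z P u0 (Suc k) (s(k := i)) j))
      + n\<^sup>2 * th\<^sup>2 / 2 * Ecoord (\<lambda>i. nsq P (\<lambda>j. run_z P u0 (Suc k) (s(k := i)) j - run_z P u0 k (s(k := i)) j))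
    \<le> (1 - th) * run_D P u0 k s + th * Dopt + n\<^sup>2 * th\<^sup>2 * nsq P (\<lambda>j. w j - run_z P u0 k s j)"
    if s: "s \<in> seqs {..<nhat P} 0 k" for s
  proof -
    have "Hr P w - Lagr P (xst P (ardca_v P u0 s k)) w \<le> Dopt"
      using dval_ge[OF indom_Dset[OF wd], of "xst P (ardca_v P u0 s k)"] Dstar_value[OF w] by linarith
    then have "th * (Hr P w - Lagr P (xst P (ardca_v P u0 s k)) w) \<le> th * Dopt"
      using th by (intro mult_left_mono) auto
    with run_reference[OF seqs_good[OF s] wd, of k] show ?thesis
      unfolding run_upd[OF order_refl] n_def th_def by linarith
  qed
  from avg_mono[OF this, of "seqs {..<nhat P} 0 k" "\<lambda>s. s"]
  have "Eseq (Suc k) (run_D P u0 (Suc k)) + n\<^sup>2 * th\<^sup>2 * Edist (Suc k) + n\<^sup>2 * th\<^sup>2 / 2 * Estep k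
    \<le> (1 - th) * Eseq k (run_D P u0 k) + th * Dopt + n\<^sup>2 * th\<^sup>2 * Edist k"
    unfolding avg_add avg_cmult avg_const[OF seqs_fin] Edist_def Estep_def Eseq_step by simp
  then have "Egap (Suc k) + n\<^sup>2 * th\<^sup>2 * Edist (Suc k) + n\<^sup>2 * th\<^sup>2 / 2 * Estep k
    \<le> (1 - th) * Egap k + n\<^sup>2 * th\<^sup>2 * Edist k" unfolding Egap_def by (simp add: algebra_simps)
  from mult_left_mono[OF this X(3)]
  have "Xw P (Suc k) * Egap (Suc k) + (n\<^sup>2 * th\<^sup>2 * Xw P (Suc k)) * Edist (Suc k) + (n\<^sup>2 * th\<^sup>2 * Xw P (Suc k)) * (Estep k / 2)
    \<le> ((1 - th) * Xw P (Suc k)) * Egap k + (n\<^sup>2 * th\<^sup>2 * Xw P (Suc k)) * Edist k"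
    by (simp add: algebra_simps del: Xw.simps)
  then show ?thesis unfolding X(1) X(2)[symmetric] by simp
qed

lemma Eseq_0: "Eseq 0 X = X (\<lambda>_. 0)"
  unfolding seqs_0 avg_def by simp

lemma Tinit: "Xw P 0 * Egap 0 + Edist 0 = Tinit"
  unfolding Tinit_def Egap_def Edist_def Eseq_0 run_D_def run_0 by simp

lemma Estep_nonneg: "0 \<le> Estep k"
  unfolding Estep_def by (intro avg_nonneg nsq_nonneg)

lemma Egap_ge: "Eseq (Suc k) (\<lambda>s. dval P (ardca_u P u0 s (Suc k)) + Hr P (ardca_u P u0 s (Suc k))) - Dopt \<le> Egap (Suc k)"
  unfolding Egap_def using run_D_ge[OF seqs_good] by (intro diff_right_mono avg_mono) blast

text \<open>Stated with the weight because for \<open>nhat P = 1\<close> the initial gap may be a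
  meaningless number, while \<open>Xw P 0 = 0\<close>.\<close>

lemma Egap_nonneg: "0 \<le> Xw P k * Egap k"
proof (cases k)
  case 0
  show ?thesis
  proof (cases "nhat P = 1")
    case True then show ?thesis unfolding 0 by simp
  next
    case False
    then have "Dopt \<le> dval P u0 + Hr P u0" using init Dopt_le by blast
    then show ?thesis using Xw_nonneg[OF n1, of 0] unfolding 0 Egap_def Eseq_0 run_D_def run_0 by simp
  qed
next
  case (Suc j)
  have "Eseq (Suc j) (\<lambda>_. Dopt) \<le> Eseq (Suc j) (run_D P u0 (Suc j))"
  proof (rule avg_mono)
    fix s assume s: "s \<in> seqs {..<nhat P} 0 (Suc j)"
    show "Dopt \<le> run_D P u0 (Suc j) s"
      using Dopt_le[OF run_u_indom(1)[of s j, OF seqs_good[OF s]]] run_D_ge[of s j, OF seqs_good[OF s]] by linarith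
  qed
  then show ?thesis using Xw_nonneg[OF n1, of k] unfolding Egap_def avg_const[OF seqs_fin] Suc by simp
qed

text \<open>The reference point is the current \<open>u\<close> itself, so the reference value is at
  most the current one; expanding the distance from \<open>u\<close> to the new \<open>z\<close>
  around the old \<open>z\<close> produces the correlation. From index 1 on, \<open>u\<close> lies
  in the domain of the regularizer.\<close>

lemma Egap_step:
  assumes "1 \<le> k"
  shows "Egap (Suc k) \<le> Egap k + (real (nhat P))\<^sup>2 * (theta P k)\<^sup>2 * (2 * Ecorr k - 3 / 2 * Estep k)"
proof -
  define n th where "n = real (nhat P)" and "th = theta P k"
  have th: "0 < th" "th \<le> 1" using theta_pos[OF n1] theta_le_1[OF n1] unfolding th_def by blast+
  define C where "C s = (\<Sum>j<nhat P. Lc P j * ((ardca_u P u0 s k j - run_z P u0 k s j)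
     * (run_z P u0 (Suc k) s j - run_z P u0 k s j)))" for s
  define B where "B s = nsq P (\<lambda>j. run_z P u0 (Suc k) s j - run_z P u0 k s j)" for s
  obtain k' where k': "k = Suc k'" using assms by (cases k) auto
  have "Ecoord (\<lambda>i. run_D P u0 (Suc k) (s(k := i)))
     \<le> run_D P u0 k s + n\<^sup>2 * th\<^sup>2 * (2 * Ecoord (\<lambda>i. C (s(k := i))) - 3 / 2 * Ecoord (\<lambda>i. B (s(k := i))))"
    if s': "s \<in> seqs {..<nhat P} 0 k" for s
  proof -
    note s = seqs_good[OF s']
    let ?u = "ardca_u P u0 s k"
    have ud: "indom P ?u" "Hr P ?u \<le> run_H P u0 k s" using run_u_indom[of s k', OF s] unfolding k' by auto
    have "Hr P ?u - Lagr P (xst P (ardca_v P u0 s k)) ?u \<le> run_D P u0 k s"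
      using dval_ge[OF indom_Dset[OF ud(1)], of "xst P (ardca_v P u0 s k)"] ud(2) unfolding run_D_def by linarith
    then have 1: "th * (Hr P ?u - Lagr P (xst P (ardca_v P u0 s k)) ?u) \<le> th * run_D P u0 k s"
      using th by (intro mult_left_mono) auto
    have 2: "nsq P (\<lambda>j. ?u j - run_z P u0 (Suc k) (s(k := i)) j)
        = nsq P (\<lambda>j. ?u j - run_z P u0 k s j) - 2 * C (s(k := i)) + B (s(k := i))" for i
      unfolding nsq_def C_def B_def run_upd[OF order_refl] sum_distrib_left sum.distrib[symmetric] sum_subtractf[symmetric]
      by (intro sum.cong) (auto simp: power2_eq_square algebra_simps)
    have 3: "Ecoord (\<lambda>i. nsq P (\<lambda>j. ?u j - run_z P u0 (Suc k) (s(k := i)) j))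
      = nsq P (\<lambda>j. ?u j - run_z P u0 k s j) - 2 * Ecoord (\<lambda>i. C (s(k := i))) + Ecoord (\<lambda>i. B (s(k := i)))"
      unfolding 2 avg_add avg_diff avg_cmult using n1 by (subst avg_const) (auto simp: lessThan_empty_iff)
    have 4: "B (s(k := i)) = nsq P (\<lambda>j. run_z P u0 (Suc k) (s(k := i)) j - run_z P u0 k s j)" for i
      unfolding B_def run_upd[OF order_refl] ..
    have 5: "Ecoord (\<lambda>i. B (s(k := i))) = Ecoord (\<lambda>i. nsq P (\<lambda>j. run_z P u0 (Suc k) (s(k := i)) j - run_z P u0 k s j))"
      unfolding 4 ..
    show ?thesis
      using run_reference[OF s ud(1), of k] 1 unfolding 3 5[symmetric] n_def[symmetric] th_def[symmetric]
      by (simp add: algebra_simps)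
  qed
  from avg_mono[OF this, of "seqs {..<nhat P} 0 k" "\<lambda>s. s"]
  have "Eseq (Suc k) (run_D P u0 (Suc k)) \<le> Eseq k (run_D P u0 k)
     + n\<^sup>2 * th\<^sup>2 * (2 * Eseq (Suc k) C - 3 / 2 * Eseq (Suc k) B)"
    unfolding avg_add avg_cmult avg_diff Eseq_step by simp
  then show ?thesis unfolding Egap_def Ecorr_def Estep_def C_def B_def n_def th_def by simp
qed

text \<open>The difference of new \<open>u\<close> and new \<open>z\<close> is \<open>1 - th\<close>
  times the old difference minus \<open>1 - n * th\<close> times the step of
  \<open>z\<close>.\<close>

lemma Euz_Suc: "Euz (Suc k) = (1 - theta P k)\<^sup>2 * Euz k
     - 2 * (1 - theta P k) * (1 - real (nhat P) * theta P k) * Ecorr k + (1 - real (nhat P) * theta P k)\<^sup>2 * Estep k"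
proof -
  define n th where "n = real (nhat P)" and "th = theta P k"
  have "nsq P (\<lambda>j. ardca_u P u0 s (Suc k) j - run_z P u0 (Suc k) s j)
    = (1 - th)\<^sup>2 * nsq P (\<lambda>j. ardca_u P u0 s k j - run_z P u0 k s j)
     - (2 * (1 - th) * (1 - n * th)) * (\<Sum>j<nhat P. Lc P j * ((ardca_u P u0 s k j - run_z P u0 k s j)
          * (run_z P u0 (Suc k) s j - run_z P u0 k s j)))
     + (1 - n * th)\<^sup>2 * nsq P (\<lambda>j. run_z P u0 (Suc k) s j - run_z P u0 k s j)" for s
    unfolding nsq_def sum_distrib_left sum.distrib[symmetric] sum_subtractf[symmetric]
      run_u_Suc ardca_v_eq n_def th_def
    by (intro sum.cong refl) algebra
  then have "Euz (Suc k) = (1 - th)\<^sup>2 * Eseq (Suc k) (\<lambda>s. nsq P (\<lambda>j. ardca_u P u0 s k j - run_z P u0 k s j))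
     - (2 * (1 - th) * (1 - n * th)) * Ecorr k + (1 - n * th)\<^sup>2 * Estep k"
    unfolding Euz_def Ecorr_def Estep_def by (simp add: avg_add avg_diff avg_cmult)
  also have "Eseq (Suc k) (\<lambda>s. nsq P (\<lambda>j. ardca_u P u0 s k j - run_z P u0 k s j)) = Euz k"
    unfolding Euz_def by (rule Eseq_indep) (simp add: run_upd)
  finally show ?thesis unfolding n_def th_def .
qed

text \<open>\<open>three_point_identity\<close> in every coordinate; from index 1 on,
  \<open>n * th\<close> stays below 1.\<close>

lemma Eudist_Suc:
  assumes "1 \<le> k"
  shows "Eudist (Suc k) = real (nhat P) * theta P k * Edist (Suc k) + (1 - theta P k) * Eudist k
     - (real (nhat P) - 1) * theta P k * Edist k
     + (1 - theta P k) * (real (nhat P) - 1) * theta P k / (1 - real (nhat P) * theta P k) * Euz k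
     - real (nhat P) * theta P k / (1 - real (nhat P) * theta P k) * Euz (Suc k)"
proof -
  define n th where "n = real (nhat P)" and "th = theta P k"
  obtain k' where k': "k = Suc k'" using assms by (cases k) auto
  have nt: "n * th \<noteq> 1" using n_theta_less_1[OF n1, of k'] unfolding n_def th_def k' by simp
  have L: "Lc P j * (w j - ardca_u P u0 s (Suc k) j)\<^sup>2 = n * th * (Lc P j * (w j - run_z P u0 (Suc k) s j)\<^sup>2)
     + (1 - th) * (Lc P j * (w j - ardca_u P u0 s k j)\<^sup>2) - (n - 1) * th * (Lc P j * (w j - run_z P u0 k s j)\<^sup>2)
     + (1 - th) * (n - 1) * th / (1 - n * th) * (Lc P j * (ardca_u P u0 s k j - run_z P u0 k s j)\<^sup>2)
     - n * th / (1 - n * th) * (Lc P j * (ardca_u P u0 s (Suc k) j - run_z P u0 (Suc k) s j)\<^sup>2)" for s j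
    using arg_cong[OF three_point_identity[OF nt, of "w j" "run_z P u0 k s j" "ardca_u P u0 s k j" "run_z P u0 (Suc k) s j"],
        of "\<lambda>t. Lc P j * t"]
    unfolding run_u_Suc ardca_v_eq n_def[symmetric] th_def[symmetric]
    by (simp only: distrib_left right_diff_distrib mult.left_commute[of "Lc P j"])
  have "nsq P (\<lambda>j. w j - ardca_u P u0 s (Suc k) j) = n * th * nsq P (\<lambda>j. w j - run_z P u0 (Suc k) s j)
     + (1 - th) * nsq P (\<lambda>j. w j - ardca_u P u0 s k j) - (n - 1) * th * nsq P (\<lambda>j. w j - run_z P u0 k s j)
     + (1 - th) * (n - 1) * th / (1 - n * th) * nsq P (\<lambda>j. ardca_u P u0 s k j - run_z P u0 k s j)
     - n * th / (1 - n * th) * nsq P (\<lambda>j. ardca_u P u0 s (Suc k) j - run_z P u0 (Suc k) s j)" for s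
    unfolding nsq_def sum_distrib_left sum.distrib[symmetric] sum_subtractf[symmetric]
    by (intro sum.cong refl L)
  then have "Eudist (Suc k) = n * th * Edist (Suc k) + (1 - th) * Eseq (Suc k) (\<lambda>s. nsq P (\<lambda>j. w j - ardca_u P u0 s k j))
     - (n - 1) * th * Eseq (Suc k) (\<lambda>s. nsq P (\<lambda>j. w j - run_z P u0 k s j))
     + (1 - th) * (n - 1) * th / (1 - n * th) * Eseq (Suc k) (\<lambda>s. nsq P (\<lambda>j. ardca_u P u0 s k j - run_z P u0 k s j))
     - n * th / (1 - n * th) * Euz (Suc k)"
    unfolding Eudist_def Edist_def Euz_def by (simp only: avg_add avg_diff avg_cmult)
  also have "Eseq (Suc k) (\<lambda>s. nsq P (\<lambda>j. w j - ardca_u P u0 s k j)) = Eudist k"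
    unfolding Eudist_def by (rule Eseq_indep) (simp add: run_upd)
  also have "Eseq (Suc k) (\<lambda>s. nsq P (\<lambda>j. w j - run_z P u0 k s j)) = Edist k"
    unfolding Edist_def by (rule Eseq_indep) (simp add: run_upd)
  also have "Eseq (Suc k) (\<lambda>s. nsq P (\<lambda>j. ardca_u P u0 s k j - run_z P u0 k s j)) = Euz k"
    unfolding Euz_def by (rule Eseq_indep) (simp add: run_upd)
  finally show ?thesis unfolding n_def th_def .
qed

lemma run_u_1: "ardca_u P u0 s 1 = run_z P u0 1 s"
proof -
  have "real (nhat P) * theta P 0 = 1" using n1 by simp
  then show ?thesis unfolding One_nat_def run_u_Suc ardca_v_eq run_0 by (auto simp: algebra_simps)
qed

lemma run_distance_gap:
  obtains S where "1 \<le> S" "Xw P (Suc K) / 2 \<le> S" "Eudist (Suc K) \<le> Tinit - S * Egap (Suc K)"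
proof (rule distance_gap_tradeoff[OF n1, of Egap Edist Tinit Ecorr Estep Euz Eudist K])
  show "Xw P (Suc k) * Egap (Suc k) + Edist (Suc k) \<le> Xw P k * Egap k + Edist k" for k
    using lyapunov[of k] Estep_nonneg[of k] by linarith
  show "0 \<le> Euz k" for k unfolding Euz_def by (intro avg_nonneg nsq_nonneg)
  show "Euz 1 = 0" unfolding Euz_def run_u_1 by (simp add: nsq_def avg_def)
  show "Eudist 1 = Edist 1" unfolding Eudist_def Edist_def run_u_1 ..
qed (use Tinit Egap_step Euz_Suc Eudist_Suc Estep_nonneg that in auto)

lemma Tinit_nonneg: "0 \<le> Tinit"
proof -
  have "0 \<le> Edist 0" unfolding Edist_def by (intro avg_nonneg nsq_nonneg)
  then show ?thesis using Tinit Egap_nonneg[of 0] by linarith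
qed

text \<open>For the expected gap \<open>Y\<close> and the expected squared distance \<open>W\<close>
  of the last \<open>u\<close>, the trade-off \<open>S * Y + W \<le> Tinit\<close> is combined with
  quadratic growth \<open>kappa * W \<le> Y\<close>.\<close>

lemma run_contraction:
  fixes kappa :: real
  assumes kappa: "0 < kappa"
    and qg: "\<And>u. indom P u \<Longrightarrow> kappa * nsq P (u - ProjD P u) \<le> dval P u + Hr P u - Dopt"
  shows "Eseq (Suc K) (\<lambda>s. (1 - theta P 0) * (dval P (ardca_u P u0 s (Suc K)) + Hr P (ardca_u P u0 s (Suc K)) - Dopt)
        + nsq P (ardca_u P u0 s (Suc K) - ProjD P (ardca_u P u0 s (Suc K))))
     \<le> (1 + (1 - theta P 0) * kappa) / (1 + kappa / 2 * (real K / (2 * real (nhat P)) + 1)\<^sup>2) * Tinit"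
proof -
  define c where "c = 1 - theta P 0"
  have c: "0 \<le> c" "c \<le> 1" using theta_le_1[OF n1, of 0] theta_pos[OF n1, of 0] unfolding c_def by auto
  define Y where "Y = Eseq (Suc K) (\<lambda>s. dval P (ardca_u P u0 s (Suc K)) + Hr P (ardca_u P u0 s (Suc K)) - Dopt)"
  define W where "W = Eseq (Suc K) (\<lambda>s. nsq P (ardca_u P u0 s (Suc K) - ProjD P (ardca_u P u0 s (Suc K))))"
  obtain S where S: "1 \<le> S" "Xw P (Suc K) / 2 \<le> S" "Eudist (Suc K) \<le> Tinit - S * Egap (Suc K)"
    by (rule run_distance_gap)
  have Y: "Y \<le> Egap (Suc K)" using Egap_ge[of K] unfolding Y_def avg_diff avg_const[OF seqs_fin] .
  have "W \<le> Eudist (Suc K)" unfolding W_def Eudist_def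
  proof (rule avg_mono)
    fix s
    have "normL P (ardca_u P u0 s (Suc K) - ProjD P (ardca_u P u0 s (Suc K))) \<le> normL P (ardca_u P u0 s (Suc K) - w)"
      by (rule ProjD(2)[OF w])
    then have "nsq P (ardca_u P u0 s (Suc K) - ProjD P (ardca_u P u0 s (Suc K))) \<le> nsq P (ardca_u P u0 s (Suc K) - w)"
      unfolding normL_nsq by simp
    also have "\<dots> = nsq P (\<lambda>j. w j - ardca_u P u0 s (Suc K) j)"
      unfolding nsq_def by (simp add: power2_commute)
    finally show "nsq P (ardca_u P u0 s (Suc K) - ProjD P (ardca_u P u0 s (Suc K))) \<le> nsq P (\<lambda>j. w j - ardca_u P u0 s (Suc K) j)" .
  qed
  moreover have "S * Y \<le> S * Egap (Suc K)" using Y S(1) by (intro mult_left_mono) auto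
  ultimately have 1: "S * Y + W \<le> Tinit" using S(3) by linarith
  have "Eseq (Suc K) (\<lambda>s. kappa * nsq P (ardca_u P u0 s (Suc K) - ProjD P (ardca_u P u0 s (Suc K)))) \<le> Y"
    unfolding Y_def using run_u_indom(1)[OF seqs_good] qg by (intro avg_mono) blast
  then have 2: "kappa * W \<le> Y" unfolding W_def avg_cmult .
  \<comment> \<open>The multipliers are chosen so that \<open>c * Y + W\<close> appears; the second
    one, \<open>S - c\<close>, is nonnegative because \<open>c \<le> 1 \<le> S\<close>.\<close>
  have "(1 + kappa * S) * (c * Y + W) = (1 + c * kappa) * (S * Y + W) + (S - c) * (kappa * W - Y)"
    by (simp add: algebra_simps)
  also have "\<dots> \<le> (1 + c * kappa) * Tinit + 0"
    using 1 2 c kappa S(1) by (intro add_mono mult_left_mono mult_nonneg_nonpos) auto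
  finally have 3: "(1 + kappa * S) * (c * Y + W) \<le> (1 + c * kappa) * Tinit" by simp
  have kS: "0 < 1 + kappa * S" using kappa S(1) by (simp add: add_pos_nonneg)
  define x where "x = (real K / (2 * real (nhat P)) + 1)\<^sup>2"
  have x: "x \<le> Xw P (Suc K)" using Xw_ge[OF n1, of K] unfolding x_def by (simp add: add.commute)
  have "kappa / 2 * x = kappa * (x / 2)" by simp
  also have "\<dots> \<le> kappa * S" using kappa S(2) x by (intro mult_left_mono) auto
  finally have xS: "1 + kappa / 2 * x \<le> 1 + kappa * S" by simp
  have xp: "0 < 1 + kappa / 2 * x" using kappa unfolding x_def by (simp add: add_pos_nonneg)
  have "c * Y + W \<le> (1 + c * kappa) * Tinit / (1 + kappa * S)"
    using 3 kS by (simp add: pos_le_divide_eq mult.commute)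
  also have "\<dots> \<le> (1 + c * kappa) * Tinit / (1 + kappa / 2 * x)"
    using xS xp kS c kappa Tinit_nonneg by (intro divide_left_mono mult_nonneg_nonneg) auto
  finally show ?thesis unfolding avg_add avg_cmult c_def[symmetric] Y_def[symmetric] W_def[symmetric] x_def[symmetric]
    by simp
qed

end

subsection \<open>Primal bounds for a single run\<close>

context dual_problem
begin

lemma normL_L2: "normL P a = L2_set (\<lambda>i. sqrt (Lc P i) * a i) {..<nhat P}"
  unfolding normL_def L2_set_def using Lc_pos
  by (intro arg_cong[of _ _ sqrt] sum.cong) (auto simp: power_mult_distrib less_imp_le)

lemma normL_nonneg: "0 \<le> normL P a"
  unfolding normL_L2 by simp

lemma normL_triangle: "normL P (\<lambda>i. a i + b i) \<le> normL P a + normL P b"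
  unfolding normL_L2 distrib_left by (rule L2_set_triangle_ineq)

lemma normL_scale: "normL P (\<lambda>i. c * a i) = \<bar>c\<bar> * normL P a"
proof -
  have "nsq P (\<lambda>i. c * a i) = c\<^sup>2 * nsq P a"
    unfolding nsq_def sum_distrib_left by (intro sum.cong) (auto simp: power_mult_distrib)
  then show ?thesis unfolding normL_nsq by (simp add: real_sqrt_mult)
qed

lemma inner_normL: "(\<Sum>j<nhat P. Lc P j * (a j * b j)) \<le> normL P a * normL P b"
proof -
  have "(\<Sum>j<nhat P. Lc P j * (a j * b j)) \<le> (\<Sum>j<nhat P. \<bar>sqrt (Lc P j) * a j\<bar> * \<bar>sqrt (Lc P j) * b j\<bar>)"
  proof (rule sum_mono)
    fix j assume "j \<in> {..<nhat P}"
    then have "0 < Lc P j" using Lc_pos by simp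
    then have "Lc P j * (a j * b j) = (sqrt (Lc P j) * sqrt (Lc P j)) * (a j * b j)" by simp
    also have "\<dots> = (sqrt (Lc P j) * a j) * (sqrt (Lc P j) * b j)" by (simp only: mult_ac)
    also have "\<dots> \<le> \<bar>sqrt (Lc P j) * a j\<bar> * \<bar>sqrt (Lc P j) * b j\<bar>" by (metis abs_ge_self abs_mult)
    finally show "Lc P j * (a j * b j) \<le> \<bar>sqrt (Lc P j) * a j\<bar> * \<bar>sqrt (Lc P j) * b j\<bar>" .
  qed
  also have "\<dots> \<le> normL P a * normL P b" unfolding normL_L2 by (rule L2_set_mult_ineq)
  finally show ?thesis .
qed

lemma Fobj_psi: "Fobj P x = ff P x + (\<Sum>i<nn P. psi P i (cfun P i x))"
  unfolding Fobj_def using n_pos by (simp add: sum_distrib_left psi_def cfun_def)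

lemma psi_lipschitz:
  assumes i: "i < nn P"
  shows "psi P i a \<le> psi P i b + MM P * \<bar>a - b\<bar>"
proof -
  define N where "N = real (nn P)"
  have N: "0 < N" using n_pos unfolding N_def by simp
  have "dist (phi P i (N * a)) (phi P i (N * b)) \<le> MM P * dist (N * a) (N * b)"
    using phi_lip i by (auto intro: lipschitz_onD)
  then have "phi P i (N * a) - phi P i (N * b) \<le> MM P * \<bar>N * a - N * b\<bar>" by (simp add: dist_real_def)
  also have "\<bar>N * a - N * b\<bar> = N * \<bar>a - b\<bar>" using N by (simp add: abs_mult flip: right_diff_distrib)
  finally have "(phi P i (N * a) - phi P i (N * b)) / N \<le> (MM P * (N * \<bar>a - b\<bar>)) / N"
    using N by (intro divide_right_mono) auto
  also have "\<dots> = MM P * \<bar>a - b\<bar>" using N by simp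
  finally show ?thesis unfolding psi_def using i by (simp add: N_def diff_divide_distrib)
qed

lemma MM_nonneg: "0 \<le> MM P"
  using phi_lip n_pos by (auto dest!: spec[of _ 0] intro: lipschitz_on_nonneg)

lemma psi_convex: "convex_on UNIV (psi P i)"
proof (cases "i < nn P")
  case True
  show ?thesis
  proof (rule convex_onI)
    fix t a b :: real assume t: "0 < t" "t < 1"
    have "phi P i ((1 - t) *\<^sub>R (real (nn P) * a) + t *\<^sub>R (real (nn P) * b))
       \<le> (1 - t) * phi P i (real (nn P) * a) + t * phi P i (real (nn P) * b)"
      using phi_cvx True t unfolding convex_on_def by auto
    then have "phi P i (real (nn P) * ((1 - t) *\<^sub>R a + t *\<^sub>R b)) / real (nn P)
       \<le> ((1 - t) * phi P i (real (nn P) * a) + t * phi P i (real (nn P) * b)) / real (nn P)"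
      by (intro divide_right_mono) (auto simp: algebra_simps)
    then show "psi P i ((1 - t) *\<^sub>R a + t *\<^sub>R b) \<le> (1 - t) * psi P i a + t * psi P i b"
      using True by (simp add: psi_def add_divide_distrib)
  qed simp
next
  case False
  then have "psi P i = (\<lambda>_. 0)" by (auto simp: psi_def)
  then show ?thesis by (simp add: convex_on_const)
qed

lemma cfun_affine_sum:
  assumes i: "i < nn P + pp P" and I: "finite I" "(\<Sum>k\<in>I. a k) = 1"
  shows "cfun P i (\<Sum>k\<in>I. a k *\<^sub>R y k) = (\<Sum>k\<in>I. a k * cfun P i (y k))"
proof (cases "i < nn P")
  case True
  then show ?thesis unfolding cfun_def by (simp add: inner_sum_right sum_divide_distrib)
next
  case False
  then show ?thesis using i I(2) unfolding cfun_def
    by (simp add: inner_sum_right distrib_left sum.distrib flip: sum_distrib_right)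
qed

lemma cfun_convex_sum:
  assumes i: "nn P + pp P \<le> i" "i < nhat P" and I: "finite I" "(\<Sum>k\<in>I. a k) = 1" "\<And>k. k \<in> I \<Longrightarrow> 0 \<le> a k"
  shows "cfun P i (\<Sum>k\<in>I. a k *\<^sub>R y k) \<le> (\<Sum>k\<in>I. a k * cfun P i (y k))"
proof -
  have "I \<noteq> {}" using I(2) by auto
  moreover have "convex_on UNIV (gg P (i - nn P - pp P))" using g_cvx i unfolding nhat_def by auto
  ultimately show ?thesis unfolding cfun_def using i I by (auto intro: convex_on_sum)
qed

lemma constr_dnorm_le:
  assumes B: "\<And>i. nn P \<le> i \<Longrightarrow> i < nn P + pp P \<Longrightarrow> cfun P i x = eta i"
    and g: "\<And>i. nn P + pp P \<le> i \<Longrightarrow> i < nhat P \<Longrightarrow> cfun P i x \<le> eta i"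
  shows "constr_dnorm P x \<le> sqrt (\<Sum>i<nhat P. (eta i)\<^sup>2 / Lc P i)"
  unfolding constr_dnorm_def
proof (rule real_sqrt_le_mono)
  have "(Bro P j \<bullet> x + bb P j)\<^sup>2 / Lc P (nn P + j) = (eta (nn P + j))\<^sup>2 / Lc P (nn P + j)" if "j < pp P" for j
    using B[of "nn P + j"] that by (simp add: cfun_def)
  then have 1: "(\<Sum>j<pp P. (Bro P j \<bullet> x + bb P j)\<^sup>2 / Lc P (nn P + j)) = (\<Sum>j<pp P. (eta (nn P + j))\<^sup>2 / Lc P (nn P + j))"
    by (intro sum.cong) auto
  have 2: "(\<Sum>j<mm P. (max 0 (gg P j x))\<^sup>2 / Lc P (nn P + pp P + j))
     \<le> (\<Sum>j<mm P. (eta (nn P + pp P + j))\<^sup>2 / Lc P (nn P + pp P + j))"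
  proof (rule sum_mono)
    fix j assume j: "j \<in> {..<mm P}"
    then have i: "nn P + pp P + j < nhat P" unfolding nhat_def by simp
    have "\<bar>max 0 (gg P j x)\<bar> \<le> \<bar>eta (nn P + pp P + j)\<bar>" using g[OF _ i] by (simp add: cfun_def)
    then have "(max 0 (gg P j x))\<^sup>2 \<le> (eta (nn P + pp P + j))\<^sup>2" by (simp only: abs_le_square_iff)
    then show "(max 0 (gg P j x))\<^sup>2 / Lc P (nn P + pp P + j) \<le> (eta (nn P + pp P + j))\<^sup>2 / Lc P (nn P + pp P + j)"
      using Lc_pos i by (intro divide_right_mono) (auto simp: less_imp_le)
  qed
  have "0 \<le> (\<Sum>i<nn P. (eta i)\<^sup>2 / Lc P i)"
    using Lc_pos unfolding nhat_def by (intro sum_nonneg divide_nonneg_nonneg) (auto simp: less_imp_le)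
  then show "(\<Sum>j<pp P. (Bro P j \<bullet> x + bb P j)\<^sup>2 / Lc P (nn P + j)) + (\<Sum>j<mm P. (max 0 (gg P j x))\<^sup>2 / Lc P (nn P + pp P + j))
    \<le> (\<Sum>i<nhat P. (eta i)\<^sup>2 / Lc P i)"
    unfolding sum_nhat[of "\<lambda>i. (eta i)\<^sup>2 / Lc P i"] using 1 2 by linarith
qed

lemma constr_dnorm_nonneg: "0 \<le> constr_dnorm P x"
  unfolding constr_dnorm_def using Lc_pos unfolding nhat_def
  by (intro real_sqrt_ge_zero add_nonneg_nonneg sum_nonneg divide_nonneg_nonneg) (auto simp: less_imp_le)

text \<open>Weak duality at a possibly infeasible point: Fenchel-Young handles the losses, and the
  multipliers are paired with the residual by Cauchy-Schwarz in the weighted norms. Multipliers of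
  \<open>gg\<close> are nonnegative, so positive parts suffice.\<close>

lemma Fobj_ge:
  assumes w: "w \<in> Dstar P"
  shows "- Dopt - normL P w * constr_dnorm P x \<le> Fobj P x"
proof -
  note dom = Dstar_indom[OF w]
  define c where "c i = (if i < nn P then 0 else if i < nn P + pp P then cfun P i x else max 0 (cfun P i x))" for i
  have "(\<Sum>i<nn P. w i * cfun P i x - hr P i (w i)) \<le> (\<Sum>i<nn P. psi P i (cfun P i x))"
  proof (rule sum_mono)
    fix i assume i: "i \<in> {..<nn P}"
    then have "hfun P i (w i) < \<infinity>" using dom unfolding indom_def nhat_def by simp
    from conjugate_phi[OF _ this, of "real (nn P) * cfun P i x"] i
    show "w i * cfun P i x - hr P i (w i) \<le> psi P i (cfun P i x)"
      using n_pos by (simp add: psi_def diff_divide_distrib)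
  qed
  moreover have "Hr P w = (\<Sum>i<nn P. hr P i (w i))" unfolding Hr_def sum_nhat by (simp add: hr_eq_0)
  moreover have "(\<Sum>i<nhat P. w i * cfun P i x) \<le> (\<Sum>i<nn P. w i * cfun P i x) + (\<Sum>i<nhat P. w i * c i)"
  proof -
    have "(\<Sum>j<mm P. w (nn P + pp P + j) * cfun P (nn P + pp P + j) x) \<le> (\<Sum>j<mm P. w (nn P + pp P + j) * c (nn P + pp P + j))"
      using indom_Dset[OF dom] unfolding c_def Dset_def nhat_def by (intro sum_mono mult_left_mono) auto
    then show ?thesis unfolding sum_nhat by (simp add: c_def)
  qed
  moreover have "(\<Sum>i<nhat P. w i * c i) \<le> normL P w * constr_dnorm P x"
  proof -
    have "(\<Sum>i<nhat P. w i * c i) = (\<Sum>i<nhat P. Lc P i * (w i * (c i / Lc P i)))"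
    proof (intro sum.cong refl)
      fix i assume "i \<in> {..<nhat P}"
      then have "0 < Lc P i" using Lc_pos by simp
      then show "w i * c i = Lc P i * (w i * (c i / Lc P i))" by simp
    qed
    also have "\<dots> \<le> normL P w * normL P (\<lambda>i. c i / Lc P i)" by (rule inner_normL)
    also have "normL P (\<lambda>i. c i / Lc P i) = constr_dnorm P x"
    proof -
      have "(\<Sum>i<nhat P. Lc P i * (c i / Lc P i)\<^sup>2) = (\<Sum>i<nhat P. (c i)\<^sup>2 / Lc P i)"
      proof (intro sum.cong refl)
        fix i assume "i \<in> {..<nhat P}"
        then have "0 < Lc P i" using Lc_pos by simp
        then show "Lc P i * (c i / Lc P i)\<^sup>2 = (c i)\<^sup>2 / Lc P i" by (simp add: power2_eq_square)
      qed
      also have "\<dots> = (\<Sum>j<pp P. (Bro P j \<bullet> x + bb P j)\<^sup>2 / Lc P (nn P + j))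
         + (\<Sum>j<mm P. (max 0 (gg P j x))\<^sup>2 / Lc P (nn P + pp P + j))"
        unfolding sum_nhat by (simp add: c_def cfun_def)
      finally show ?thesis unfolding normL_def constr_dnorm_def by simp
    qed
    finally show ?thesis .
  qed
  moreover have "- Lagr P x w \<le> dval P w" by (rule dval_ge[OF indom_Dset[OF dom]])
  ultimately show ?thesis
    using Dstar_value[OF w] unfolding Lagr_cfun Fobj_psi by (simp add: sum_subtractf)
qed

end

context ardca_run
begin

text \<open>Summing \<open>lyapunov\<close> retains every spare half step; their total is the
  variance budget of the martingale.\<close>

lemma run_budget: "(\<Sum>j<k. Estep j) / 2 + Xw P k * Egap k + Edist k \<le> Tinit"
proof (induction k)
  case (Suc k) then show ?case using lyapunov[of k] by (simp add: add_divide_distrib del: Xw.simps)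
qed (use Tinit in simp)

lemma Edist_le: "Edist k \<le> Tinit"
proof -
  have "0 \<le> (\<Sum>j<k. Estep j)" by (intro sum_nonneg Estep_nonneg)
  then show ?thesis using run_budget[of k] Egap_nonneg[of k] by linarith
qed

lemma Edist_nonneg: "0 \<le> Edist k"
  unfolding Edist_def by (intro avg_nonneg nsq_nonneg)

lemma sum_Estep_le: "(\<Sum>j\<in>{K0..<k}. Estep j) \<le> 2 * Tinit"
proof -
  have "(\<Sum>j\<in>{K0..<k}. Estep j) \<le> (\<Sum>j<k. Estep j)"
    by (rule sum_mono2) (auto simp: Estep_nonneg)
  then show ?thesis using run_budget[of k] Egap_nonneg[of k] Edist_nonneg[of k] by linarith
qed

lemma Edist_later: "k \<le> m \<Longrightarrow> Eseq m (\<lambda>s. nsq P (\<lambda>j. w j - run_z P u0 k s j)) = Edist k"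
  unfolding Edist_def by (rule Eseq_later) (auto simp: run_upd)

lemma Enorm_le: "k \<le> m \<Longrightarrow> Eseq m (\<lambda>s. normL P (\<lambda>j. w j - run_z P u0 k s j)) \<le> sqrt Tinit"
  by (intro avg_le_sqrt[OF seqs_fin]) (simp add: normL_nsq(2) Edist_later Edist_le)

text \<open>The prox step in all coordinates is \<open>nhat\<close> times the conditional expectation of the random step;
  \<open>noise\<close> accumulates the martingale differences.\<close>

definition "noise K0 k s i = (\<Sum>j\<in>{K0..<k}. real (nhat P) * (run_z P u0 (Suc j) s i - run_z P u0 j s i)
    - (run_zt P u0 j s i - run_z P u0 j s i))"

definition "drift K0 K s i = (\<Sum>j\<in>{K0..K}. run_zt P u0 j s i - run_z P u0 j s i)"

lemma noise_upd: "k \<le> m \<Longrightarrow> noise K0 k (s(m := i)) = noise K0 k s"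
  unfolding noise_def by (auto simp: run_upd intro!: sum.cong)

text \<open>One draw realises \<open>1 / nhat P\<close> of the full prox step in conditional mean,
  so the increments are centred and cross terms vanish; each adds \<open>nhat P - 1\<close> times
  the squared full step.\<close>

lemma noise_variance: "Eseq k (\<lambda>s. nsq P (noise K0 k s)) \<le> (real (nhat P))\<^sup>2 * (\<Sum>j\<in>{K0..<k}. Estep j)"
proof (induction k)
  case 0
  show ?case by (simp add: noise_def nsq_def avg_def)
next
  case (Suc k)
  show ?case
  proof (cases "K0 \<le> k")
    case False
    then show ?thesis by (simp add: noise_def nsq_def avg_def)
  next
    case True
    define n where "n = real (nhat P)"
    have n: "1 \<le> n" using n1 unfolding n_def by simp
    have "Ecoord (\<lambda>i. nsq P (noise K0 (Suc k) (s(k := i))))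
       \<le> nsq P (noise K0 k s) + n\<^sup>2 * Ecoord (\<lambda>i. nsq P (\<lambda>j. run_z P u0 (Suc k) (s(k := i)) j - run_z P u0 k s j))"
      if s: "s \<in> seqs {..<nhat P} 0 k" for s
    proof -
      define z zt M where "z = run_z P u0 k s" and "zt = run_zt P u0 k s" and "M = noise K0 k s"
      have "noise K0 (Suc k) (s(k := i)) = (\<lambda>j. M j + (n * ((z(i := zt i)) j - z j) - (zt j - z j)))" for i
      proof
        fix j
        have "noise K0 (Suc k) (s(k := i)) j = noise K0 k (s(k := i)) j
           + (n * (run_z P u0 (Suc k) (s(k := i)) j - run_z P u0 k (s(k := i)) j)
            - (run_zt P u0 k (s(k := i)) j - run_z P u0 k (s(k := i)) j))"
          using True unfolding noise_def n_def by simp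
        then show "noise K0 (Suc k) (s(k := i)) j = M j + (n * ((z(i := zt i)) j - z j) - (zt j - z j))"
          unfolding noise_upd[OF order_refl] run_z_Suc run_upd[OF order_refl] z_def zt_def M_def by simp
      qed
      then have "Ecoord (\<lambda>i. nsq P (noise K0 (Suc k) (s(k := i))))
        = Ecoord (\<lambda>i. \<Sum>j<nhat P. Lc P j * (M j + (n * ((z(i := zt i)) j - z j) - (zt j - z j)))\<^sup>2)"
        unfolding nsq_def by simp
      also have "\<dots> = (\<Sum>j<nhat P. Lc P j * (M j + (n * (z j - z j) - (zt j - z j)))\<^sup>2)
         + (\<Sum>j<nhat P. Lc P j * (M j + (n * (zt j - z j) - (zt j - z j)))\<^sup>2
              - Lc P j * (M j + (n * (z j - z j) - (zt j - z j)))\<^sup>2) / real (nhat P)"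
        by (rule avg_coordinate_update[OF n1, of "\<lambda>j t. Lc P j * (M j + (n * (t - z j) - (zt j - z j)))\<^sup>2"])
      also have "\<dots> = (\<Sum>j<nhat P. Lc P j * ((M j)\<^sup>2 + (n - 1) * (zt j - z j)\<^sup>2))"
        unfolding sum_divide_distrib sum.distrib[symmetric] n_def[symmetric]
        using n by (intro sum.cong refl) (simp add: power2_eq_square field_simps)
      also have "\<dots> \<le> (\<Sum>j<nhat P. Lc P j * ((M j)\<^sup>2 + n * (zt j - z j)\<^sup>2))"
        using Lc_pos by (intro sum_mono mult_left_mono add_left_mono mult_right_mono) (auto simp: less_imp_le)
      also have "\<dots> = nsq P M + n * nsq P (\<lambda>j. zt j - z j)"
        unfolding nsq_def sum_distrib_left by (simp add: sum.distrib algebra_simps)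
      also have "n * nsq P (\<lambda>j. zt j - z j) = n\<^sup>2 * Ecoord (\<lambda>i. nsq P (\<lambda>j. run_z P u0 (Suc k) (s(k := i)) j - run_z P u0 k s j))"
        unfolding run_nsq_step[OF seqs_good[OF s]] z_def zt_def n_def[symmetric] using n by (simp add: power2_eq_square)
      finally show ?thesis unfolding M_def .
    qed
    from avg_mono[OF this, of "seqs {..<nhat P} 0 k" "\<lambda>s. s"]
    have "Eseq (Suc k) (\<lambda>s. nsq P (noise K0 (Suc k) s)) \<le> Eseq k (\<lambda>s. nsq P (noise K0 k s)) + n\<^sup>2 * Estep k"
      unfolding Eseq_step Estep_def avg_add avg_cmult run_upd[OF order_refl] by simp
    then show ?thesis using Suc True unfolding n_def by (simp add: distrib_left)
  qed
qed

text \<open>The drift is \<open>nhat P\<close> times the displacement of \<open>z\<close> minus the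
  noise. Measuring the displacement through \<open>w\<close> costs \<open>sqrt Tinit\<close> at each
  end; the budget \<open>2 * Tinit\<close> for the steps gives the \<open>sqrt 2\<close> of the
  noise.\<close>

lemma drift_bound:
  assumes K: "K0 \<le> K"
  shows "Eseq (Suc K) (\<lambda>s. normL P (drift K0 K s)) \<le> real (nhat P) * (2 + sqrt 2) * sqrt Tinit"
proof -
  define n where "n = real (nhat P)"
  have n: "1 \<le> n" using n1 unfolding n_def by simp
  let ?a = "\<lambda>k s. (\<lambda>j. w j - run_z P u0 k s j)"
  have "normL P (drift K0 K s) \<le> n * normL P (?a K0 s) + n * normL P (?a (Suc K) s) + normL P (noise K0 (Suc K) s)" for s
  proof -
    have eq: "drift K0 K s = (\<lambda>i. (n * ?a K0 s i + (- n) * ?a (Suc K) s i) + (- 1) * noise K0 (Suc K) s i)"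
    proof
      fix i
      have "noise K0 (Suc K) s i = n * (\<Sum>j\<in>{K0..<Suc K}. run_z P u0 (Suc j) s i - run_z P u0 j s i)
         - (\<Sum>j\<in>{K0..<Suc K}. run_zt P u0 j s i - run_z P u0 j s i)"
        unfolding noise_def n_def sum_subtractf[of "\<lambda>j. real (nhat P) * (run_z P u0 (Suc j) s i - run_z P u0 j s i)"]
          sum_distrib_left ..
      also have "(\<Sum>j\<in>{K0..<Suc K}. run_z P u0 (Suc j) s i - run_z P u0 j s i) = run_z P u0 (Suc K) s i - run_z P u0 K0 s i"
        using K by (intro sum_Suc_diff') simp
      finally show "drift K0 K s i = (n * ?a K0 s i + (- n) * ?a (Suc K) s i) + (- 1) * noise K0 (Suc K) s i"
        unfolding drift_def by (simp add: algebra_simps atLeastLessThanSuc_atLeastAtMost)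
    qed
    have "normL P (drift K0 K s) \<le> normL P (\<lambda>i. n * ?a K0 s i + (- n) * ?a (Suc K) s i) + normL P (\<lambda>i. (- 1) * noise K0 (Suc K) s i)"
      unfolding eq by (rule normL_triangle)
    also have "normL P (\<lambda>i. n * ?a K0 s i + (- n) * ?a (Suc K) s i) \<le> normL P (\<lambda>i. n * ?a K0 s i) + normL P (\<lambda>i. (- n) * ?a (Suc K) s i)"
      by (rule normL_triangle)
    finally show ?thesis unfolding normL_scale using n by simp
  qed
  then have "Eseq (Suc K) (\<lambda>s. normL P (drift K0 K s))
     \<le> Eseq (Suc K) (\<lambda>s. n * normL P (?a K0 s) + n * normL P (?a (Suc K) s) + normL P (noise K0 (Suc K) s))"
    by (intro avg_mono)
  also have "\<dots> = n * Eseq (Suc K) (\<lambda>s. normL P (?a K0 s)) + n * Eseq (Suc K) (\<lambda>s. normL P (?a (Suc K) s))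
      + Eseq (Suc K) (\<lambda>s. normL P (noise K0 (Suc K) s))"
    unfolding avg_add avg_cmult ..
  also have "\<dots> \<le> n * sqrt Tinit + n * sqrt Tinit + n * (sqrt 2 * sqrt Tinit)"
  proof (intro add_mono mult_left_mono)
    show "Eseq (Suc K) (\<lambda>s. normL P (?a K0 s)) \<le> sqrt Tinit"
      using K by (intro Enorm_le) simp
    show "Eseq (Suc K) (\<lambda>s. normL P (?a (Suc K) s)) \<le> sqrt Tinit"
      by (intro Enorm_le) simp
    have "Eseq (Suc K) (\<lambda>s. normL P (noise K0 (Suc K) s)) \<le> sqrt (n\<^sup>2 * (2 * Tinit))"
    proof (rule avg_le_sqrt[OF seqs_fin])
      have "Eseq (Suc K) (\<lambda>s. (normL P (noise K0 (Suc K) s))\<^sup>2) \<le> n\<^sup>2 * (\<Sum>j\<in>{K0..<Suc K}. Estep j)"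
        unfolding normL_nsq(2) n_def by (rule noise_variance)
      also have "\<dots> \<le> n\<^sup>2 * (2 * Tinit)" by (intro mult_left_mono sum_Estep_le) simp
      finally show "Eseq (Suc K) (\<lambda>s. (normL P (noise K0 (Suc K) s))\<^sup>2) \<le> n\<^sup>2 * (2 * Tinit)" .
    qed
    also have "\<dots> = n * (sqrt 2 * sqrt Tinit)" using n by (simp add: real_sqrt_mult)
    finally show "Eseq (Suc K) (\<lambda>s. normL P (noise K0 (Suc K) s)) \<le> n * (sqrt 2 * sqrt Tinit)" .
  qed (use n in auto)
  finally show ?thesis unfolding n_def by (simp add: algebra_simps)
qed

lemma sum_inverse_theta: "K0 \<le> Suc K \<Longrightarrow> (\<Sum>k=K0..K. 1 / theta P k) = (real (nhat P))\<^sup>2 * (Xw P (Suc K) - Xw P K0)"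
proof -
  assume K: "K0 \<le> Suc K"
  have "1 / theta P k = (real (nhat P))\<^sup>2 * (Xw P (Suc k) - Xw P k)" for k
    unfolding Xw_diff[OF n1] using n1 by simp
  then have "(\<Sum>k=K0..K. 1 / theta P k) = (\<Sum>k=K0..K. (real (nhat P))\<^sup>2 * (Xw P (Suc k) - Xw P k))" by simp
  also have "\<dots> = (real (nhat P))\<^sup>2 * (\<Sum>k=K0..K. Xw P (Suc k) - Xw P k)"
    by (simp only: sum_distrib_left)
  also have "(\<Sum>k=K0..K. Xw P (Suc k) - Xw P k) = Xw P (Suc K) - Xw P K0"
    using K by (rule sum_Suc_diff)
  finally show ?thesis .
qed

section \<open>The weighted primal average: infeasibility and objective error\<close>

context
  fixes K0 K :: nat and Sx lam
  assumes K: "K0 \<le> K"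
  defines "Sx \<equiv> Xw P (Suc K) - Xw P K0"
    and "lam \<equiv> (\<lambda>k. 1 / theta P k / ((real (nhat P))\<^sup>2 * Sx))"
begin

lemma Sx_pos: "0 < Sx"
proof -
  have "0 < (\<Sum>k=K0..K. 1 / theta P k)"
    using K theta_pos[OF n1] by (intro sum_pos) auto
  then show ?thesis using sum_inverse_theta[of K0 K] K n1 unfolding Sx_def
    by (simp add: zero_less_mult_iff del: Xw.simps)
qed

lemma lam: "0 \<le> lam k" "(\<Sum>k=K0..K. lam k) = 1"
  "lam k = (Xw P (Suc k) - Xw P k) / Sx"
proof -
  show 1: "lam k = (Xw P (Suc k) - Xw P k) / Sx" for k
    unfolding lam_def Xw_diff[OF n1] by simp
  show "0 \<le> lam k" unfolding lam_def
    using theta_pos[OF n1, of k] Sx_pos by (intro divide_nonneg_nonneg mult_nonneg_nonneg) auto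
  have "(\<Sum>k=K0..K. lam k) = (\<Sum>k=K0..K. 1 / theta P k) / ((real (nhat P))\<^sup>2 * Sx)"
    unfolding lam_def by (simp add: sum_divide_distrib)
  then show "(\<Sum>k=K0..K. lam k) = 1"
    using sum_inverse_theta[of K0 K] K n1 Sx_pos unfolding Sx_def[symmetric] by simp
qed

lemma xhat_lam: "ardca_xhat P u0 s K0 K = (\<Sum>k=K0..K. lam k *\<^sub>R xst P (ardca_v P u0 s k))"
  unfolding ardca_xhat_def scaleR_sum_right lam_def
  using sum_inverse_theta[of K0 K] K unfolding Sx_def
  by (intro sum.cong) (auto simp: divide_inverse ac_simps)

text \<open>The averaged coefficients split into averaged subgradients \<open>sh\<close> and an
  error \<open>eta\<close>. On constraints \<open>sh\<close> is zero or nonpositive, so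
  \<open>eta\<close> alone controls infeasibility; on losses \<open>eta\<close> is charged at the
  Lipschitz constant.\<close>

lemma xhat_pointwise:
  assumes s: "good s"
  defines "d \<equiv> 2 / (real (nhat P) * Sx) * normL P (drift K0 K s)"
  shows "constr_dnorm P (ardca_xhat P u0 s K0 K) \<le> d"
    and "Fobj P (ardca_xhat P u0 s K0 K)
      \<le> (\<Sum>k=K0..K. lam k * (ff P (xst P (ardca_v P u0 s k)) + (\<Sum>i<nhat P. psi P i (run_s P u0 k s i))))
        + MM P * sqrt (\<Sum>i<nn P. Lc P i) * d"
proof -
  let ?I = "{K0..K}"
  define n x xh where "n = real (nhat P)" and "x k = xst P (ardca_v P u0 s k)" and "xh = ardca_xhat P u0 s K0 K" for k
  have n: "1 \<le> n" using n1 unfolding n_def by simp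
  have xh: "xh = (\<Sum>k\<in>?I. lam k *\<^sub>R x k)" unfolding xh_def x_def xhat_lam ..
  define eta where "eta i = 2 * Lc P i / (n * Sx) * drift K0 K s i" for i
  define sh where "sh i = (\<Sum>k\<in>?I. lam k * run_s P u0 k s i)" for i
  have avgc: "(\<Sum>k\<in>?I. lam k * cfun P i (x k)) = sh i + eta i" for i
  proof -
    have "lam k * cfun P i (x k) = lam k * run_s P u0 k s i
       + 2 * Lc P i / (n * Sx) * (run_zt P u0 k s i - run_z P u0 k s i)" for k
    proof -
      \<comment> \<open>Weights proportional to \<open>1 / theta P k\<close> cancel the
        \<open>theta P k\<close> of the prox step, so all steps enter \<open>eta\<close> equally and
        add up to \<open>drift\<close>.\<close>
      have "lam k * (2 * n * theta P k) = 2 / (n * Sx)"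
        using theta_pos[OF n1, of k] n Sx_pos unfolding lam_def n_def by (simp add: power2_eq_square field_simps)
      then have "lam k * (2 * n * theta P k * Lc P i * (run_zt P u0 k s i - run_z P u0 k s i))
         = 2 / (n * Sx) * Lc P i * (run_zt P u0 k s i - run_z P u0 k s i)" by (metis mult.assoc)
      then show ?thesis unfolding run_s_def x_def n_def by (simp add: algebra_simps)
    qed
    then show ?thesis unfolding sh_def eta_def drift_def by (simp add: sum.distrib sum_distrib_left)
  qed
  have fin: "finite ?I" "?I \<noteq> {}" using K by auto
  have c1: "cfun P i xh = sh i + eta i" if "i < nn P + pp P" for i
    unfolding xh cfun_affine_sum[OF that fin(1) lam(2)] avgc ..
  have sqrt_eta: "sqrt (\<Sum>i<nhat P. (eta i)\<^sup>2 / Lc P i) = d"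
  proof -
    have "(\<Sum>i<nhat P. (eta i)\<^sup>2 / Lc P i) = nsq P (\<lambda>i. 2 / (n * Sx) * drift K0 K s i)"
      unfolding nsq_def
    proof (intro sum.cong refl)
      fix i assume "i \<in> {..<nhat P}"
      then have "0 < Lc P i" using Lc_pos by simp
      then show "(eta i)\<^sup>2 / Lc P i = Lc P i * (2 / (n * Sx) * drift K0 K s i)\<^sup>2"
        unfolding eta_def by (simp add: power2_eq_square mult_ac)
    qed
    then have "sqrt (\<Sum>i<nhat P. (eta i)\<^sup>2 / Lc P i) = normL P (\<lambda>i. 2 / (n * Sx) * drift K0 K s i)"
      unfolding normL_nsq by simp
    then show ?thesis unfolding normL_scale d_def n_def using Sx_pos by simp
  qed
  have "constr_dnorm P xh \<le> sqrt (\<Sum>i<nhat P. (eta i)\<^sup>2 / Lc P i)"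
  proof (rule constr_dnorm_le)
    fix i assume i: "nn P \<le> i" "i < nn P + pp P"
    then have "i < nhat P" unfolding nhat_def by simp
    then have "sh i = 0" unfolding sh_def using run_s(1)[OF s _ i] by simp
    then show "cfun P i xh = eta i" using c1 i by simp
  next
    fix i assume i: "nn P + pp P \<le> i" "i < nhat P"
    have "cfun P i xh \<le> (\<Sum>k\<in>?I. lam k * cfun P i (x k))"
      unfolding xh by (rule cfun_convex_sum[OF i fin(1) lam(2,1)])
    also have "\<dots> = sh i + eta i" by (rule avgc)
    also have "sh i \<le> 0" unfolding sh_def using run_s(2)[OF s i(2) i(1)] lam(1)
      by (intro sum_nonpos mult_nonneg_nonpos) auto
    finally show "cfun P i xh \<le> eta i" by simp
  qed
  then show "constr_dnorm P (ardca_xhat P u0 s K0 K) \<le> d" unfolding sqrt_eta xh_def .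
  have "(\<Sum>i<nn P. psi P i (cfun P i xh)) \<le> (\<Sum>i<nn P. psi P i (sh i) + MM P * \<bar>eta i\<bar>)"
  proof (rule sum_mono)
    fix i assume "i \<in> {..<nn P}"
    then show "psi P i (cfun P i xh) \<le> psi P i (sh i) + MM P * \<bar>eta i\<bar>"
      using psi_lipschitz[of i "cfun P i xh" "sh i"] c1[of i] by simp
  qed
  also have "\<dots> = (\<Sum>i<nn P. psi P i (sh i)) + MM P * (\<Sum>i<nn P. \<bar>eta i\<bar>)"
    by (simp add: sum.distrib sum_distrib_left)
  also have "(\<Sum>i<nn P. psi P i (sh i)) = (\<Sum>i<nhat P. psi P i (sh i))"
    unfolding sum_nhat by (simp add: psi_def)
  also have "(\<Sum>i<nhat P. psi P i (sh i)) \<le> (\<Sum>i<nhat P. \<Sum>k\<in>?I. lam k * psi P i (run_s P u0 k s i))"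
    unfolding sh_def using convex_on_sum[OF fin psi_convex lam(2)] lam(1) by (intro sum_mono) auto
  also have "\<dots> = (\<Sum>k\<in>?I. lam k * (\<Sum>i<nhat P. psi P i (run_s P u0 k s i)))"
    unfolding sum_distrib_left by (rule sum.swap)
  also have "(\<Sum>i<nn P. \<bar>eta i\<bar>) \<le> sqrt (\<Sum>i<nn P. Lc P i) * d"
  proof -
    have Lp: "0 < Lc P i" if "i < nn P" for i using Lc_pos that unfolding nhat_def by simp
    have "(\<Sum>i<nn P. \<bar>eta i\<bar>) = (\<Sum>i<nn P. \<bar>sqrt (Lc P i)\<bar> * \<bar>eta i / sqrt (Lc P i)\<bar>)"
      using Lp by (intro sum.cong) (auto simp: abs_mult dest: Lp)
    also have "\<dots> \<le> L2_set (\<lambda>i. sqrt (Lc P i)) {..<nn P} * L2_set (\<lambda>i. eta i / sqrt (Lc P i)) {..<nn P}"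
      by (rule L2_set_mult_ineq)
    also have "L2_set (\<lambda>i. sqrt (Lc P i)) {..<nn P} = sqrt (\<Sum>i<nn P. Lc P i)"
      unfolding L2_set_def using Lp by (intro arg_cong[of _ _ sqrt] sum.cong) (auto simp: less_imp_le)
    finally have 1: "(\<Sum>i<nn P. \<bar>eta i\<bar>) \<le> sqrt (\<Sum>i<nn P. Lc P i) * L2_set (\<lambda>i. eta i / sqrt (Lc P i)) {..<nn P}" .
    have 2: "L2_set (\<lambda>i. eta i / sqrt (Lc P i)) {..<nn P} \<le> d"
    proof -
      have "(\<Sum>i<nn P. (eta i / sqrt (Lc P i))\<^sup>2) = (\<Sum>i<nn P. (eta i)\<^sup>2 / Lc P i)"
        using Lp by (intro sum.cong) (auto simp: power_divide less_imp_le)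
      also have "\<dots> \<le> (\<Sum>i<nhat P. (eta i)\<^sup>2 / Lc P i)"
        using Lc_pos unfolding nhat_def by (intro sum_mono2) (auto simp: less_imp_le)
      finally show ?thesis unfolding L2_set_def sqrt_eta[symmetric] by simp
    qed
    have "sqrt (\<Sum>i<nn P. Lc P i) * L2_set (\<lambda>i. eta i / sqrt (Lc P i)) {..<nn P} \<le> sqrt (\<Sum>i<nn P. Lc P i) * d"
      using 2 Lp by (intro mult_left_mono) (auto intro!: sum_nonneg simp: less_imp_le)
    with 1 show ?thesis by linarith
  qed
  finally have "(\<Sum>i<nn P. psi P i (cfun P i xh)) \<le> (\<Sum>k\<in>?I. lam k * (\<Sum>i<nhat P. psi P i (run_s P u0 k s i)))
      + MM P * (sqrt (\<Sum>i<nn P. Lc P i) * d)"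
    using MM_nonneg by (simp add: mult_left_mono)
  moreover have "ff P xh \<le> (\<Sum>k\<in>?I. lam k * ff P (x k))"
    unfolding xh using strongly_convex_imp_convex_on[OF f_sc] mu_pos lam
    by (intro convex_on_sum[OF fin]) auto
  ultimately show "Fobj P (ardca_xhat P u0 s K0 K)
      \<le> (\<Sum>k=K0..K. lam k * (ff P (xst P (ardca_v P u0 s k)) + (\<Sum>i<nhat P. psi P i (run_s P u0 k s i))))
        + MM P * sqrt (\<Sum>i<nn P. Lc P i) * d"
    unfolding Fobj_psi xh_def[symmetric] x_def by (simp add: distrib_left sum.distrib mult.assoc)
qed

text \<open>The primal objective with each loss evaluated at the subgradient \<open>run_s\<close> in
  place of the true argument, which is what Fenchel equality delivers.\<close>

definition "primal_value k s = ff P (xst P (ardca_v P u0 s k)) + (\<Sum>i<nhat P. psi P i (run_s P u0 k s i))"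

lemma primal_value_upd: "k \<le> j \<Longrightarrow> primal_value k (s(j := i)) = primal_value k s"
  unfolding primal_value_def run_s_def by (simp add: run_upd)

lemma primal_step:
  "Xw P (Suc k) * Egap (Suc k) + (Xw P (Suc k) - Xw P k) * (Eseq k (primal_value k) + Dopt)
     + Eseq (Suc k) (\<lambda>s. nsq P (run_z P u0 (Suc k) s))
   \<le> Xw P k * Egap k + Eseq k (\<lambda>s. nsq P (run_z P u0 k s))"
proof -
  define n th where "n = real (nhat P)" and "th = theta P k"
  have X: "n\<^sup>2 * th\<^sup>2 * Xw P (Suc k) = 1" "Xw P k = (1 - th) * Xw P (Suc k)" "0 \<le> Xw P (Suc k)"
    using Xw_Suc[OF n1] Xw_step[OF n1, of k] Xw_nonneg[OF n1] unfolding n_def th_def by blast+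
  define A where "A = Eseq (Suc k) (\<lambda>s. nsq P (run_z P u0 (Suc k) s))"
  define B where "B = Eseq k (\<lambda>s. nsq P (run_z P u0 k s))"
  have "Eseq (Suc k) (run_D P u0 (Suc k)) + n\<^sup>2 * th\<^sup>2 * A
    \<le> (1 - th) * Eseq k (run_D P u0 k) - th * Eseq k (primal_value k) + n\<^sup>2 * th\<^sup>2 * B"
  proof -
    have "Eseq k (\<lambda>s. Ecoord (\<lambda>i. run_D P u0 (Suc k) (s(k := i)))
      + n\<^sup>2 * th\<^sup>2 * Ecoord (\<lambda>i. nsq P (run_z P u0 (Suc k) (s(k := i)))))
      \<le> Eseq k (\<lambda>s. (1 - th) * run_D P u0 k s - th * primal_value k s + n\<^sup>2 * th\<^sup>2 * nsq P (run_z P u0 k s))"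
      using run_primal[OF seqs_good] unfolding n_def th_def primal_value_def by (intro avg_mono) blast
    then show ?thesis unfolding avg_add avg_diff avg_cmult A_def B_def Eseq_step .
  qed
  then have "Egap (Suc k) + n\<^sup>2 * th\<^sup>2 * A
    \<le> (1 - th) * Egap k - th * (Eseq k (primal_value k) + Dopt) + n\<^sup>2 * th\<^sup>2 * B"
    unfolding Egap_def by (simp add: algebra_simps)
  from mult_left_mono[OF this X(3)]
  have "Xw P (Suc k) * Egap (Suc k) + (n\<^sup>2 * th\<^sup>2 * Xw P (Suc k)) * A
    \<le> ((1 - th) * Xw P (Suc k)) * Egap k - (Xw P (Suc k) - (1 - th) * Xw P (Suc k)) * (Eseq k (primal_value k) + Dopt)
       + (n\<^sup>2 * th\<^sup>2 * Xw P (Suc k)) * B"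
    by (simp add: algebra_simps del: Xw.simps)
  then show ?thesis unfolding X(1) X(2)[symmetric] A_def B_def by simp
qed

text \<open>After telescoping from \<open>K0\<close>, the squared norms of \<open>z\<close> at both
  ends are recentred at \<open>w\<close>. This leaves distances to \<open>w\<close> and an inner
  product with \<open>w\<close>, bounded by \<open>2 * normL P w\<close> times two distances, each
  at most \<open>sqrt Tinit\<close> in mean.\<close>

lemma primal_sum:
  "Sx * ((\<Sum>k=K0..K. lam k * Eseq (Suc K) (primal_value k)) + Dopt)
   \<le> Tinit + 4 * normL P w * sqrt Tinit"
proof -
  define Z where "Z k = Eseq k (\<lambda>s. nsq P (run_z P u0 k s))" for k
  have "Xw P (Suc m) * Egap (Suc m) + (\<Sum>k=K0..m. (Xw P (Suc k) - Xw P k) * (Eseq k (primal_value k) + Dopt)) + Z (Suc m)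
     \<le> Xw P K0 * Egap K0 + Z K0" if "K0 \<le> m" for m
    using that
  proof (induction m rule: dec_induct)
    case base
    show ?case using primal_step[of K0] unfolding Z_def by simp
  next
    case (step m)
    then show ?case using primal_step[of "Suc m"] unfolding Z_def by (simp add: sum.cl_ivl_Suc del: Xw.simps)
  qed
  from this[OF K] Egap_nonneg[of "Suc K"]
  have 1: "(\<Sum>k=K0..K. (Xw P (Suc k) - Xw P k) * (Eseq k (primal_value k) + Dopt)) \<le> Xw P K0 * Egap K0 + (Z K0 - Z (Suc K))"
    by linarith
  have "(\<Sum>k=K0..K. (Xw P (Suc k) - Xw P k) * (Eseq k (primal_value k) + Dopt))
    = (\<Sum>k=K0..K. Sx * (lam k * (Eseq (Suc K) (primal_value k) + Dopt)))"
  proof (intro sum.cong refl)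
    fix k assume "k \<in> {K0..K}"
    then have "Eseq (Suc K) (primal_value k) = Eseq k (primal_value k)"
      by (intro Eseq_later primal_value_upd) auto
    then show "(Xw P (Suc k) - Xw P k) * (Eseq k (primal_value k) + Dopt) = Sx * (lam k * (Eseq (Suc K) (primal_value k) + Dopt))"
      unfolding lam(3) using Sx_pos by simp
  qed
  also have "\<dots> = Sx * ((\<Sum>k=K0..K. lam k * Eseq (Suc K) (primal_value k)) + (\<Sum>k=K0..K. lam k) * Dopt)"
    unfolding sum_distrib_left[symmetric] distrib_left sum.distrib sum_distrib_right[symmetric] ..
  finally have 2: "Sx * ((\<Sum>k=K0..K. lam k * Eseq (Suc K) (primal_value k)) + Dopt)
      \<le> Xw P K0 * Egap K0 + (Z K0 - Z (Suc K))" using 1 lam(2) by simp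
  let ?a = "\<lambda>k s. (\<lambda>j. w j - run_z P u0 k s j)"
  have "nsq P (run_z P u0 K0 s) - nsq P (run_z P u0 (Suc K) s)
    \<le> nsq P (?a K0 s) - nsq P (?a (Suc K) s) + (2 * normL P w) * (normL P (?a (Suc K) s) + normL P (?a K0 s))" for s
  proof -
    have 1: "nsq P (run_z P u0 K0 s) - nsq P (run_z P u0 (Suc K) s)
      = nsq P (?a K0 s) - nsq P (?a (Suc K) s) + 2 * (\<Sum>j<nhat P. Lc P j * (w j * (?a (Suc K) s j + (- 1) * ?a K0 s j)))"
      unfolding nsq_def sum_distrib_left sum_subtractf[symmetric] sum.distrib[symmetric]
      by (intro sum.cong refl) (simp add: power2_eq_square algebra_simps)
    have 2: "(\<Sum>j<nhat P. Lc P j * (w j * (?a (Suc K) s j + (- 1) * ?a K0 s j)))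
      \<le> normL P w * normL P (\<lambda>j. ?a (Suc K) s j + (- 1) * ?a K0 s j)" by (rule inner_normL)
    have 3: "normL P w * normL P (\<lambda>j. ?a (Suc K) s j + (- 1) * ?a K0 s j)
      \<le> normL P w * (normL P (?a (Suc K) s) + normL P (\<lambda>j. (- 1) * ?a K0 s j))"
      by (intro mult_left_mono normL_triangle normL_nonneg)
    have 4: "normL P (\<lambda>j. (- 1) * ?a K0 s j) = normL P (?a K0 s)" unfolding normL_scale by simp
    show ?thesis using 1 order_trans[OF 2 3] unfolding 4 by linarith
  qed
  then have "Eseq (Suc K) (\<lambda>s. nsq P (run_z P u0 K0 s) - nsq P (run_z P u0 (Suc K) s))
    \<le> Eseq (Suc K) (\<lambda>s. nsq P (?a K0 s) - nsq P (?a (Suc K) s) + (2 * normL P w) * (normL P (?a (Suc K) s) + normL P (?a K0 s)))"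
    by (intro avg_mono)
  then have "Eseq (Suc K) (\<lambda>s. nsq P (run_z P u0 K0 s)) - Z (Suc K)
    \<le> Edist K0 - Edist (Suc K) + (2 * normL P w) * (Eseq (Suc K) (\<lambda>s. normL P (?a (Suc K) s)) + Eseq (Suc K) (\<lambda>s. normL P (?a K0 s)))"
    unfolding avg_add avg_diff avg_cmult Z_def using Edist_later[of K0 "Suc K"] Edist_later[of "Suc K" "Suc K"] K by simp
  moreover define BB where "BB = (2 * normL P w) * (Eseq (Suc K) (\<lambda>s. normL P (?a (Suc K) s)) + Eseq (Suc K) (\<lambda>s. normL P (?a K0 s)))"
  ultimately have 3: "Eseq (Suc K) (\<lambda>s. nsq P (run_z P u0 K0 s)) - Z (Suc K) \<le> Edist K0 - Edist (Suc K) + BB" by simp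
  have "Eseq (Suc K) (\<lambda>s. nsq P (run_z P u0 K0 s)) = Z K0"
    unfolding Z_def using K by (intro Eseq_later) (auto simp: run_upd)
  moreover have "BB \<le> (2 * normL P w) * (sqrt Tinit + sqrt Tinit)"
    unfolding BB_def
  proof (intro mult_left_mono add_mono)
    show "Eseq (Suc K) (\<lambda>s. normL P (?a K0 s)) \<le> sqrt Tinit"
      using K by (intro Enorm_le) simp
    show "Eseq (Suc K) (\<lambda>s. normL P (?a (Suc K) s)) \<le> sqrt Tinit"
      by (intro Enorm_le) simp
  qed (use normL_nonneg in simp)
  moreover have "(2 * normL P w) * (sqrt Tinit + sqrt Tinit) = 4 * normL P w * sqrt Tinit" by simp
  moreover have "Xw P K0 * Egap K0 + Edist K0 \<le> Tinit"
  proof -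
    have "0 \<le> (\<Sum>j<K0. Estep j)" by (intro sum_nonneg Estep_nonneg)
    then show ?thesis using run_budget[of K0] by linarith
  qed
  ultimately show ?thesis using 2 3 Edist_nonneg[of "Suc K"] by linarith
qed

lemma xhat_bounds:
  defines "d \<equiv> 2 * (2 + sqrt 2) * sqrt Tinit / Sx"
  shows "Eseq (Suc K) (\<lambda>s. constr_dnorm P (ardca_xhat P u0 s K0 K)) \<le> d"
    and "Eseq (Suc K) (\<lambda>s. Fobj P (ardca_xhat P u0 s K0 K)) + Dopt
      \<le> MM P * sqrt (\<Sum>i<nn P. Lc P i) * d + (Tinit + 4 * normL P w * sqrt Tinit) / Sx"
proof -
  define n where "n = real (nhat P)"
  have n: "1 \<le> n" using n1 unfolding n_def by simp
  define q where "q = 2 / (n * Sx)"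
  have q: "0 \<le> q" using n Sx_pos unfolding q_def by simp
  define M where "M = MM P * sqrt (\<Sum>i<nn P. Lc P i)"
  have M: "0 \<le> M" unfolding M_def using MM_nonneg Lc_pos
    by (auto intro!: mult_nonneg_nonneg sum_nonneg simp: nhat_def less_imp_le)
  have "q * Eseq (Suc K) (\<lambda>s. normL P (drift K0 K s)) \<le> q * (n * (2 + sqrt 2) * sqrt Tinit)"
    using drift_bound[OF K] q unfolding n_def by (intro mult_left_mono) auto
  also have "\<dots> = d" unfolding q_def d_def using n by simp
  finally have qd: "Eseq (Suc K) (\<lambda>s. q * normL P (drift K0 K s)) \<le> d" unfolding avg_cmult .
  have "Eseq (Suc K) (\<lambda>s. constr_dnorm P (ardca_xhat P u0 s K0 K)) \<le> Eseq (Suc K) (\<lambda>s. q * normL P (drift K0 K s))"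
    using xhat_pointwise(1)[OF seqs_good] unfolding q_def n_def by (intro avg_mono) blast
  with qd show "Eseq (Suc K) (\<lambda>s. constr_dnorm P (ardca_xhat P u0 s K0 K)) \<le> d" by linarith
  have 1: "Eseq (Suc K) (\<lambda>s. Fobj P (ardca_xhat P u0 s K0 K))
    \<le> Eseq (Suc K) (\<lambda>s. (\<Sum>k=K0..K. lam k * primal_value k s) + M * (q * normL P (drift K0 K s)))"
    using xhat_pointwise(2)[OF seqs_good] unfolding q_def n_def M_def primal_value_def by (intro avg_mono) blast
  have "Eseq (Suc K) (\<lambda>s. \<Sum>k=K0..K. lam k * primal_value k s) = (\<Sum>k=K0..K. lam k * Eseq (Suc K) (primal_value k))"
    unfolding avg_sum avg_cmult ..
  with 1 have "Eseq (Suc K) (\<lambda>s. Fobj P (ardca_xhat P u0 s K0 K))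
    \<le> (\<Sum>k=K0..K. lam k * Eseq (Suc K) (primal_value k)) + M * Eseq (Suc K) (\<lambda>s. q * normL P (drift K0 K s))"
    unfolding avg_add avg_cmult[of _ M] by simp
  moreover have "M * Eseq (Suc K) (\<lambda>s. q * normL P (drift K0 K s)) \<le> M * d"
    using qd M by (intro mult_left_mono) auto
  moreover have "(\<Sum>k=K0..K. lam k * Eseq (Suc K) (primal_value k)) + Dopt \<le> (Tinit + 4 * normL P w * sqrt Tinit) / Sx"
    using primal_sum Sx_pos by (simp add: pos_le_divide_eq mult.commute)
  ultimately show "Eseq (Suc K) (\<lambda>s. Fobj P (ardca_xhat P u0 s K0 K)) + Dopt
      \<le> MM P * sqrt (\<Sum>i<nn P. Lc P i) * d + (Tinit + 4 * normL P w * sqrt Tinit) / Sx"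
    unfolding M_def by linarith
qed

end

end

subsection \<open>Restarts\<close>

text \<open>A realisation of the restarted method is a word of \<open>N + 1\<close> letters, each of
  them a run of \<open>K + 1\<close> draws, padded with the zero run.\<close>

lemma index_seqs_eq: "index_seqs nh N K = seqs (seqs {..<nh} 0 (Suc K)) (\<lambda>_. 0) (Suc N)"
  unfolding index_seqs_def seqs_def
  by (auto simp: fun_eq_iff less_Suc_eq_le not_le Suc_le_eq) (metis not_le)

lemma expect_avg: "expect nh N K X = avg (seqs (seqs {..<nh} 0 (Suc K)) (\<lambda>_. 0) (Suc N)) X"
  unfolding expect_def avg_def index_seqs_eq ..

lemma avg_le_exists:
  assumes "finite A" "A \<noteq> {}"
  obtains x where "x \<in> A" "X x \<le> avg A X"
proof (rule ccontr)
  assume "\<not> thesis"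
  then have "avg A X < X x" if "x \<in> A" for x using that \<open>\<And>x. x \<in> A \<Longrightarrow> X x \<le> avg A X \<Longrightarrow> thesis\<close> by force
  then have "(\<Sum>x\<in>A. avg A X) < (\<Sum>x\<in>A. X x)" using assms by (intro sum_strict_mono) auto
  then show False using assms unfolding avg_def by simp
qed

lemma restart_u_upd: "t \<le> j \<Longrightarrow> restart_u P u00 K (s(j := r)) t = restart_u P u00 K s t"
  by (induction t) auto

context dual_problem
begin

lemma feasible_if_constr_dnorm_0:
  assumes "constr_dnorm P x = 0"
  shows "feasible P x"
proof -
  let ?b = "\<lambda>j. (Bro P j \<bullet> x + bb P j)\<^sup>2 / Lc P (nn P + j)"
  let ?g = "\<lambda>j. (max 0 (gg P j x))\<^sup>2 / Lc P (nn P + pp P + j)"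
  have L: "0 < Lc P (nn P + j)" if "j < pp P" for j using Lc_pos that unfolding nhat_def by simp
  have L': "0 < Lc P (nn P + pp P + j)" if "j < mm P" for j using Lc_pos that unfolding nhat_def by simp
  have nn: "0 \<le> sum ?b {..<pp P}" "0 \<le> sum ?g {..<mm P}"
    using L L' by (auto intro!: sum_nonneg simp: less_imp_le)
  have "sum ?b {..<pp P} + sum ?g {..<mm P} = 0"
    using assms unfolding constr_dnorm_def by simp
  then have 0: "sum ?b {..<pp P} = 0" "sum ?g {..<mm P} = 0" using nn by linarith+
  have "?b j = 0" if "j < pp P" for j
    using 0(1) that L by (subst (asm) sum_nonneg_eq_0_iff) (auto simp: less_imp_le)
  then have "Bro P j \<bullet> x + bb P j = 0" if "j < pp P" for j using that L by fastforce
  moreover have "?g j = 0" if "j < mm P" for j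
    using 0(2) that L' by (subst (asm) sum_nonneg_eq_0_iff) (auto simp: less_imp_le)
  then have "gg P j x \<le> 0" if "j < mm P" for j using that L'
    by (metis divide_eq_0_iff less_irrefl max.cobounded2 power_eq_0_iff)
  ultimately show ?thesis unfolding feasible_def by blast
qed

lemma constr_dnorm_feasible: "feasible P x \<Longrightarrow> constr_dnorm P x = 0"
  unfolding constr_dnorm_def feasible_def by (simp add: max_absorb1)

text \<open>Running the method from the dual solution itself, where the potential vanishes, produces a
  feasible point of value at most \<open>- Dopt\<close>.\<close>

lemma strong_duality:
  assumes opt: "feasible P xopt" "\<forall>x. feasible P x \<longrightarrow> Fobj P xopt \<le> Fobj P x"
  shows "Fobj P xopt = - Dopt"
proof (rule antisym)
  interpret ardca_run P ust ust ust
    using ust indom_Dset Dstar_indom by unfold_locales auto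
  have T: "Tinit = 0" unfolding Tinit_def Dopt_def by (simp add: nsq_def)
  let ?x = "\<lambda>s. ardca_xhat P ust s 0 0"
  let ?A = "seqs {..<nhat P} 0 (Suc 0)"
  have b: "avg ?A (\<lambda>s. constr_dnorm P (?x s)) \<le> 0" "avg ?A (\<lambda>s. Fobj P (?x s)) + Dopt \<le> 0"
    using xhat_bounds[of 0 0] unfolding T by simp_all
  \<comment> \<open>A realisation with objective at most the mean. Residuals are nonnegative with
    mean at most 0, so its residual vanishes as well.\<close>
  obtain s where s: "s \<in> ?A" "Fobj P (?x s) \<le> avg ?A (\<lambda>s. Fobj P (?x s))"
    by (rule avg_le_exists[OF seqs_fin])
  have "(\<Sum>s\<in>?A. constr_dnorm P (?x s)) \<le> 0"
    using b(1) seqs_fin[of "Suc 0"] unfolding avg_def by (simp add: divide_le_0_iff card_gt_0_iff)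
  then have "(\<Sum>s\<in>?A. constr_dnorm P (?x s)) = 0"
    using sum_nonneg[of ?A "\<lambda>s. constr_dnorm P (?x s)"] constr_dnorm_nonneg by force
  then have "constr_dnorm P (?x s) = 0"
    using s(1) seqs_fin constr_dnorm_nonneg by (subst (asm) sum_nonneg_eq_0_iff) auto
  then have "Fobj P xopt \<le> Fobj P (?x s)" using opt(2) feasible_if_constr_dnorm_0 by blast
  with s(2) b(2) show "Fobj P xopt \<le> - Dopt" by linarith
  show "- Dopt \<le> Fobj P xopt" using Fobj_ge[OF ust, of xopt] constr_dnorm_feasible[OF opt(1)] by simp
qed

lemma contraction_factor_pos:
  fixes kappa :: real
  assumes kappa: "0 < kappa"
  shows "0 < (1 + (1 - theta P 0) * kappa) / (1 + kappa / 2 * (real K / (2 * real (nhat P)) + 1)\<^sup>2)"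
proof -
  have "0 \<le> (1 - theta P 0) * kappa" using theta_le_1[OF n1, of 0] kappa by simp
  moreover have "0 \<le> kappa / 2 * (real K / (2 * real (nhat P)) + 1)\<^sup>2" using kappa by simp
  ultimately show ?thesis by (intro divide_pos_pos) linarith+
qed

text \<open>The value of \<open>Tinit\<close> for a run started at \<open>u\<close> whose reference
  solution is the projection of \<open>u\<close>; with this choice the end of one run matches the
  start of the next.\<close>

definition "potential u = (1 - theta P 0) * (dval P u + Hr P u - Dopt) + nsq P (u - ProjD P u)"

context
  fixes u00 :: "nat \<Rightarrow> real" and K :: nat
  assumes u00: "u00 \<in> Dset P" and init: "nhat P = 1 \<or> indom P u00"
begin

abbreviation "runs \<equiv> seqs {..<nhat P} (0::nat) (Suc K)"
abbreviation "Eruns t X \<equiv> avg (seqs runs (\<lambda>_. 0) t) X"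

lemma runs_fin: "finite (seqs runs (\<lambda>_. 0) t)" "seqs runs (\<lambda>_. 0) t \<noteq> {}"
  using seqs_fin[of "Suc K"] by (auto intro!: finite_seqs seqs_nonempty)

lemma runs_good: "s \<in> seqs runs (\<lambda>_. 0) t \<Longrightarrow> \<forall>j. good (s j)"
proof
  fix j assume "s \<in> seqs runs (\<lambda>_. 0) t"
  then show "good (s j)"
    using seqs_good[of "s j" "Suc K"] n1 unfolding seqs_def[of runs] good_def by (cases "j < t") auto
qed

lemma restart_indom:
  assumes s: "\<forall>j. good (s j)"
  shows "restart_u P u00 K s t \<in> Dset P \<and> (nhat P = 1 \<or> indom P (restart_u P u00 K s t))"
proof (induction t)
  case 0
  show ?case using u00 init by simp
next
  case (Suc t)
  then interpret ardca_run P ust "restart_u P u00 K s t" ust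
    using ust by unfold_locales auto
  show ?case using run_u_indom(1)[OF s[rule_format, of t], of K] indom_Dset by simp
qed

lemma restart_run:
  assumes s: "\<forall>j. good (s j)"
  shows "ardca_run P ust (restart_u P u00 K s t) (ProjD P (restart_u P u00 K s t))"
  using restart_indom[OF s, of t] ProjD(1) by unfold_locales auto

lemma Tinit_potential:
  assumes "ardca_run P ust u (ProjD P u)"
  shows "ardca_run.Tinit P ust u (ProjD P u) = potential u"
  unfolding ardca_run.Tinit_def[OF assms] potential_def nsq_def by (simp add: power2_commute)

lemma potential_nonneg:
  assumes s: "\<forall>j. good (s j)"
  shows "0 \<le> potential (restart_u P u00 K s t)"
  using ardca_run.Tinit_nonneg[OF restart_run[OF s, of t]] unfolding Tinit_potential[OF restart_run[OF s, of t]] .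

context
  fixes kappa rho :: real
  assumes kappa: "0 < kappa"
    and qg: "\<And>u. indom P u \<Longrightarrow> kappa * nsq P (u - ProjD P u) \<le> dval P u + Hr P u - Dopt"
  defines "rho \<equiv> (1 + (1 - theta P 0) * kappa) / (1 + kappa / 2 * (real K / (2 * real (nhat P)) + 1)\<^sup>2)"
begin

lemma rho_pos: "0 < rho"
  unfolding rho_def by (rule contraction_factor_pos[OF kappa])

text \<open>The first \<open>t\<close> runs fix the start of run \<open>t\<close>, and the
  single-run contraction holds from every such start with the same factor, so it can be
  averaged.\<close>

lemma restart_contraction: "Eruns t (\<lambda>s. potential (restart_u P u00 K s t)) \<le> rho ^ t * potential u00"
proof (induction t)
  case 0
  show ?case using runs_fin[of 0] by (simp add: avg_const)
next
  case (Suc t)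
  have "avg runs (\<lambda>r. potential (restart_u P u00 K (s(t := r)) (Suc t))) \<le> rho * potential (restart_u P u00 K s t)"
    if s: "s \<in> seqs runs (\<lambda>_. 0) t" for s
  proof -
    note r = restart_run[OF runs_good[OF s], of t]
    show ?thesis
      using ardca_run.run_contraction[OF r kappa qg, of K]
      unfolding Tinit_potential[OF r] rho_def potential_def by (simp add: restart_u_upd)
  qed
  then have "Eruns (Suc t) (\<lambda>s. potential (restart_u P u00 K s (Suc t)))
     \<le> Eruns t (\<lambda>s. rho * potential (restart_u P u00 K s t))"
    unfolding avg_seqs_Suc[OF seqs_fin(1)] by (intro avg_mono) blast
  also have "\<dots> = rho * Eruns t (\<lambda>s. potential (restart_u P u00 K s t))" by (rule avg_cmult)
  also have "\<dots> \<le> rho * (rho ^ t * potential u00)" using Suc rho_pos by (intro mult_left_mono) auto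
  finally show ?case by simp
qed

lemma Eruns_potential:
  "Eruns (Suc N) (\<lambda>s. potential (restart_u P u00 K s N)) \<le> rho ^ N * potential u00"
proof -
  have "Eruns (Suc N) (\<lambda>s. potential (restart_u P u00 K s N)) = Eruns N (\<lambda>s. potential (restart_u P u00 K s N))"
    by (intro avg_seqs_Suc_indep seqs_fin) (simp add: restart_u_upd)
  then show ?thesis using restart_contraction[of N] by simp
qed

text \<open>Jensen's inequality for the square root, the source of the exponent
  \<open>N / 2\<close>.\<close>

lemma Eruns_sqrt_potential:
  "Eruns N (\<lambda>s. sqrt (potential (restart_u P u00 K s N))) \<le> sqrt (potential u00) * rho powr (real N / 2)"
proof -
  have "Eruns N (\<lambda>s. sqrt (potential (restart_u P u00 K s N))) \<le> sqrt (Eruns N (\<lambda>s. potential (restart_u P u00 K s N)))"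
    using potential_nonneg[OF runs_good] by (intro avg_sqrt runs_fin) blast
  also have "\<dots> \<le> sqrt (rho ^ N * potential u00)" by (intro real_sqrt_le_mono restart_contraction)
  also have "sqrt (rho ^ N) = rho powr (real N / 2)"
    using rho_pos by (simp add: powr_half_sqrt_powr powr_realpow)
  then have "sqrt (rho ^ N * potential u00) = sqrt (potential u00) * rho powr (real N / 2)"
    by (simp add: real_sqrt_mult)
  finally show ?thesis .
qed

text \<open>The upper bounds are those of the last run, conditionally on the earlier ones; the lower
  bound on the objective follows from weak duality and the residual bound.\<close>

lemma restart_primal_bounds:
  fixes CD ups :: real and K0 N :: nat
  assumes CD: "\<forall>w\<in>Dstar P. normL P w \<le> CD" and nK: "nhat P \<le> K" and ups: "1 < ups"
    and K0: "int K0 \<le> \<lfloor>real K / (ups * (1 + 1 / real (nhat P))) + 1\<rfloor>"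
  defines "T \<equiv> potential u00" and "a \<equiv> 1 - 1 / ups"
    and "F \<equiv> Eruns (Suc N) (\<lambda>s. Fobj P (restart_xhat P u00 K0 K s N)) + Dopt"
  shows "Eruns (Suc N) (\<lambda>s. constr_dnorm P (restart_xhat P u00 K0 K s N)) \<le> 6 * sqrt T / a * rho powr (real N / 2)"
    and "F \<le> (6 * CD * sqrt T + 6 * MM P * sqrt (\<Sum>i<nn P. Lc P i) * sqrt T) / a * rho powr (real N / 2)
           + 2 * T / a * rho ^ N"
    and "- (6 * CD * sqrt T / a * rho powr (real N / 2)) \<le> F"
proof -
  define Sx where "Sx = Xw P (Suc K) - Xw P K0"
  have K: "K0 \<le> K" and Sx: "5 / 4 * a \<le> Sx"
    using Xw_diff_ge[OF n1 ups nK K0] unfolding Sx_def a_def by blast+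
  have a: "0 < a" using ups unfolding a_def by simp
  have Sx0: "0 < Sx" using a Sx by linarith
  have CD0: "0 \<le> CD" using CD ust normL_nonneg[of ust] by force
  define M where "M = MM P * sqrt (\<Sum>i<nn P. Lc P i)"
  have M: "0 \<le> M" unfolding M_def using MM_nonneg Lc_pos
    by (auto intro!: mult_nonneg_nonneg sum_nonneg simp: nhat_def less_imp_le)
  \<comment> \<open>Replaces the normalised averaging weight by its lower bound, so each
    \<open>1 / Sx\<close> contributes a factor 4/5.\<close>
  have div: "x / Sx \<le> (4 / 5 * x) / a" if "0 \<le> x" for x
  proof -
    have "x / Sx \<le> x / (5 / 4 * a)" using that a Sx by (intro divide_left_mono) auto
    then show ?thesis by simp
  qed
  \<comment> \<open>Enough for \<open>8 / 5 * (2 + sqrt 2) \<le> 28 / 5\<close>, hence below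
    6.\<close>
  have s2: "sqrt 2 \<le> 3 / 2" by (rule real_le_lsqrt) (auto simp: power2_eq_square)
  have step: "avg runs (\<lambda>r. constr_dnorm P (restart_xhat P u00 K0 K (s(N := r)) N)) \<le> 6 / a * sqrt (potential (restart_u P u00 K s N))"
    "avg runs (\<lambda>r. Fobj P (restart_xhat P u00 K0 K (s(N := r)) N) + Dopt)
       \<le> (6 * CD + 6 * M) / a * sqrt (potential (restart_u P u00 K s N)) + 2 / a * potential (restart_u P u00 K s N)"
    if s: "s \<in> seqs runs (\<lambda>_. 0) N" for s
  proof -
    define u where "u = restart_u P u00 K s N"
    have r: "ardca_run P ust u (ProjD P u)" unfolding u_def by (rule restart_run[OF runs_good[OF s]])
    define p where "p = potential u"
    have p: "0 \<le> p" unfolding p_def u_def by (rule potential_nonneg[OF runs_good[OF s]])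
    have w: "normL P (ProjD P u) \<le> CD" using CD ProjD(1) by blast
    have x: "restart_xhat P u00 K0 K (s(N := r)) N = ardca_xhat P u r K0 K" for r
      unfolding restart_xhat_def u_def by (simp add: restart_u_upd)
    note b = ardca_run.xhat_bounds[OF r K, folded Sx_def, unfolded Tinit_potential[OF r], folded p_def]
    have "2 * (2 + sqrt 2) * sqrt p / Sx \<le> (4 / 5 * (2 * (2 + sqrt 2) * sqrt p)) / a"
      using p by (intro div) simp
    also have "\<dots> \<le> (6 * sqrt p) / a"
    proof (rule divide_right_mono)
      have "(8 / 5 * (2 + sqrt 2)) * sqrt p \<le> 6 * sqrt p" using s2 p by (intro mult_right_mono) auto
      moreover have "4 / 5 * (2 * (2 + sqrt 2) * sqrt p) = (8 / 5 * (2 + sqrt 2)) * sqrt p"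
        by (simp add: algebra_simps)
      ultimately show "4 / 5 * (2 * (2 + sqrt 2) * sqrt p) \<le> 6 * sqrt p" by (simp only:)
    qed (use a in simp)
    finally have d: "2 * (2 + sqrt 2) * sqrt p / Sx \<le> 6 / a * sqrt p" by simp
    show "avg runs (\<lambda>r. constr_dnorm P (restart_xhat P u00 K0 K (s(N := r)) N)) \<le> 6 / a * sqrt (potential (restart_u P u00 K s N))"
      using b(1) d unfolding x p_def u_def by linarith
    have "(p + 4 * normL P (ProjD P u) * sqrt p) / Sx \<le> (p + 4 * CD * sqrt p) / Sx"
      using w p Sx0 by (intro divide_right_mono add_left_mono mult_right_mono mult_left_mono) auto
    also have "\<dots> \<le> (4 / 5 * (p + 4 * CD * sqrt p)) / a" using p CD0 by (intro div) simp
    also have "\<dots> \<le> (6 * CD * sqrt p + 2 * p) / a"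
    proof (rule divide_right_mono)
      have "0 \<le> CD * sqrt p" using CD0 p by simp
      then show "4 / 5 * (p + 4 * CD * sqrt p) \<le> 6 * CD * sqrt p + 2 * p" using p by (simp add: mult.assoc)
    qed (use a in simp)
    also have "\<dots> = 6 * CD / a * sqrt p + 2 / a * p" by (simp add: add_divide_distrib)
    finally have e: "(p + 4 * normL P (ProjD P u) * sqrt p) / Sx \<le> 6 * CD / a * sqrt p + 2 / a * p" .
    have "M * (2 * (2 + sqrt 2) * sqrt p / Sx) \<le> M * (6 / a * sqrt p)" using d M by (rule mult_left_mono)
    then have "Eseq (Suc K) (\<lambda>s. Fobj P (ardca_xhat P u s K0 K)) + Dopt
       \<le> M * (6 / a * sqrt p) + (6 * CD / a * sqrt p + 2 / a * p)"
      using b(2) e unfolding M_def[symmetric] by linarith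
    also have "\<dots> = (6 * CD + 6 * M) / a * sqrt p + 2 / a * p" by (simp add: field_simps add_divide_distrib)
    finally show "avg runs (\<lambda>r. Fobj P (restart_xhat P u00 K0 K (s(N := r)) N) + Dopt)
       \<le> (6 * CD + 6 * M) / a * sqrt (potential (restart_u P u00 K s N)) + 2 / a * potential (restart_u P u00 K s N)"
      unfolding x avg_add avg_const[OF seqs_fin] p_def u_def .
  qed
  let ?R = "rho powr (real N / 2)"
  let ?p = "\<lambda>s. potential (restart_u P u00 K s N)"
  have sq: "Eruns N (\<lambda>s. sqrt (?p s)) \<le> sqrt T * ?R" using Eruns_sqrt_potential unfolding T_def .
  have "Eruns (Suc N) (\<lambda>s. constr_dnorm P (restart_xhat P u00 K0 K s N)) \<le> Eruns N (\<lambda>s. 6 / a * sqrt (?p s))"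
    unfolding avg_seqs_Suc[OF seqs_fin(1)] by (intro avg_mono step(1))
  also have "\<dots> = 6 / a * Eruns N (\<lambda>s. sqrt (?p s))" by (rule avg_cmult)
  also have "\<dots> \<le> 6 / a * (sqrt T * ?R)" using sq a by (intro mult_left_mono) auto
  also have "\<dots> = 6 * sqrt T / a * ?R" by simp
  finally show c: "Eruns (Suc N) (\<lambda>s. constr_dnorm P (restart_xhat P u00 K0 K s N)) \<le> 6 * sqrt T / a * ?R" .
  have F: "F = Eruns (Suc N) (\<lambda>s. Fobj P (restart_xhat P u00 K0 K s N) + Dopt)"
    unfolding F_def avg_add avg_const[OF runs_fin] ..
  have "F \<le> Eruns N (\<lambda>s. (6 * CD + 6 * M) / a * sqrt (?p s) + 2 / a * ?p s)"
    unfolding F avg_seqs_Suc[OF seqs_fin(1)] by (intro avg_mono step(2))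
  also have "\<dots> = (6 * CD + 6 * M) / a * Eruns N (\<lambda>s. sqrt (?p s)) + 2 / a * Eruns N ?p"
    unfolding avg_add avg_cmult ..
  also have "\<dots> \<le> (6 * CD + 6 * M) / a * (sqrt T * ?R) + 2 / a * (rho ^ N * T)"
    using sq restart_contraction[of N] a CD0 M unfolding T_def by (intro add_mono mult_left_mono) auto
  also have "\<dots> = (6 * CD * sqrt T + 6 * MM P * sqrt (\<Sum>i<nn P. Lc P i) * sqrt T) / a * ?R + 2 * T / a * rho ^ N"
    unfolding M_def by (simp add: algebra_simps)
  finally show "F \<le> (6 * CD * sqrt T + 6 * MM P * sqrt (\<Sum>i<nn P. Lc P i) * sqrt T) / a * ?R + 2 * T / a * rho ^ N" .
  have "Eruns (Suc N) (\<lambda>s. - CD * constr_dnorm P (restart_xhat P u00 K0 K s N)) \<le> F"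
    unfolding F
  proof (rule avg_mono)
    fix s
    let ?x = "restart_xhat P u00 K0 K s N"
    have "normL P ust * constr_dnorm P ?x \<le> CD * constr_dnorm P ?x"
      using CD ust constr_dnorm_nonneg by (intro mult_right_mono) auto
    then show "- CD * constr_dnorm P ?x \<le> Fobj P ?x + Dopt" using Fobj_ge[OF ust, of ?x] by simp
  qed
  then have "- (CD * Eruns (Suc N) (\<lambda>s. constr_dnorm P (restart_xhat P u00 K0 K s N))) \<le> F"
    unfolding avg_cmult by simp
  moreover have "CD * Eruns (Suc N) (\<lambda>s. constr_dnorm P (restart_xhat P u00 K0 K s N)) \<le> CD * (6 * sqrt T / a * ?R)"
    using c CD0 by (rule mult_left_mono)
  ultimately show "- (6 * CD * sqrt T / a * ?R) \<le> F" by (simp add: mult.assoc mult.left_commute)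
qed

end

end

end

theorem theorem2:
  fixes P :: "('a::euclidean_space) cprob"
    and xopt :: 'a and ust u00 :: "nat \<Rightarrow> real"
    and kappa :: real and K0 K N :: nat
  assumes n_pos: "nn P \<ge> 1"
    and mu_pos: "mu P > 0"
    and f_sc: "strongly_convex (mu P) (ff P)"
    and phi_cvx: "\<forall>i<nn P. convex_on UNIV (phi P i)"
    and phi_lip: "\<forall>i<nn P. (MM P)-lipschitz_on UNIV (phi P i)"
    and g_cvx: "\<forall>i<mm P. convex_on UNIV (gg P i)"
    and g_subgrad: "\<forall>i<mm P. \<forall>x s. (\<forall>y. gg P i y \<ge> gg P i x + s \<bullet> (y - x)) \<longrightarrow> norm s \<le> Lg P i"
    and slater: "\<exists>xb. (\<forall>i<mm P. gg P i xb < 0) \<and> (\<forall>j<pp P. Bro P j \<bullet> xb + bb P j = 0)"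
    and finite_opt: "bdd_below (Fobj P ` {x. feasible P x})"
    and xopt: "feasible P xopt" "\<forall>x. feasible P x \<longrightarrow> Fobj P xopt \<le> Fobj P x"
    and Lc_pos: "\<forall>i<nhat P. Lc P i > 0"
    and ust: "ust \<in> Dstar P"
    and kappa_pos: "kappa > 0"
    and qgrowth: "\<forall>u. ereal (kappa * (normL P (u - ProjD P u))\<^sup>2) \<le> Dfun P u - Dfun P ust"
    and u00: "u00 \<in> Dset P"
  defines "rho \<equiv> (1 + (1 - theta P 0) * kappa)
                 / (1 + kappa / 2 * (real K / (2 * real (nhat P)) + 1)\<^sup>2)"
    and "T00 \<equiv> ereal (1 - theta P 0) * (Dfun P u00 - Dfun P ust)
               + ereal ((normL P (u00 - ProjD P u00))\<^sup>2)"
  shows "ereal (1 - theta P 0)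
           * (expectE (nhat P) N K (\<lambda>s. Dfun P (restart_u P u00 K s N)) - Dfun P ust)
         + ereal (expect (nhat P) N K
             (\<lambda>s. (normL P (restart_u P u00 K s N - ProjD P (restart_u P u00 K s N)))\<^sup>2))
         \<le> ereal (rho ^ N) * T00
       \<and> (\<forall>CD ups. (\<forall>w\<in>Dstar P. normL P w \<le> CD) \<and> nhat P \<le> K \<and> ups > 1 \<and>
         int K0 \<le> \<lfloor>real K / (ups * (1 + 1 / real (nhat P))) + 1\<rfloor> \<and>
         T00 \<noteq> \<infinity> \<longrightarrow>
         (let T = real_of_ereal T00;
              C1 = (6 * CD * sqrt T + 6 * MM P * sqrt (\<Sum>i<nn P. Lc P i) * sqrt T) / (1 - 1 / ups)
                   + 2 * sqrt (real (mm P)) * CD * sqrt T / sqrt (1 - 1 / ups);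
              C2 = 2 * T / (1 - 1 / ups);
              C3 = 6 * sqrt T / (1 - 1 / ups)
          in \<bar>expect (nhat P) N K (\<lambda>s. Fobj P (restart_xhat P u00 K0 K s N)) - Fobj P xopt\<bar>
               \<le> C1 * rho powr (real N / 2) + C2 * rho ^ N
           \<and> expect (nhat P) N K (\<lambda>s. constr_dnorm P (restart_xhat P u00 K0 K s N))
               \<le> C3 * rho powr (real N / 2)))"
proof -
  interpret dual_problem P ust
    using n_pos mu_pos f_sc phi_cvx phi_lip g_cvx g_subgrad Lc_pos ust by unfold_locales
  define c where "c = 1 - theta P 0"
  have c0: "0 \<le> c" using theta_le_1[OF n1, of 0] unfolding c_def by simp
  have qg: "kappa * nsq P (u - ProjD P u) \<le> dval P u + Hr P u - Dopt" if "indom P u" for u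
    using qgrowth[rule_format, of u] unfolding normL_nsq(2) Dopt Dfun_real[OF that] by simp
  have rho: "0 < rho" unfolding rho_def by (rule contraction_factor_pos[OF kappa_pos])
  show ?thesis
  \<comment> \<open>If neither alternative holds, the initial gap is infinite and has positive
    weight, so \<open>T00\<close> is infinite: the first claim is trivial because
    \<open>rho ^ N\<close> is positive, and the second excludes this case by its premise.\<close>
  proof (cases "nhat P = 1 \<or> indom P u00")
    case False
    then have "Dfun P u00 = \<infinity>" using Dfun_infinite by blast
    moreover have "0 < c"
      using False n1 unfolding c_def by (simp add: divide_less_eq)
    ultimately have "T00 = \<infinity>" unfolding T00_def Dopt c_def[symmetric] by simp
    then show ?thesis using rho by simp
  next
    case init: True
    have c1: "c = 0" if "nhat P = 1" using that unfolding c_def by simp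
    have T00: "T00 = ereal (potential u00)"
    proof (cases "indom P u00")
      case True
      then show ?thesis unfolding T00_def potential_def Dopt Dfun_real[OF True] normL_nsq(2) by simp
    next
      \<comment> \<open>Zero times infinity is zero in the extended reals, so with a single
        coordinate \<open>T00\<close> is just the squared distance, whatever the dual value at
        \<open>u00\<close>.\<close>
      case False
      then have "c = 0" using init c1 by blast
      then show ?thesis unfolding T00_def potential_def normL_nsq(2) c_def[symmetric]
        by (simp flip: zero_ereal_def)
    qed
    note r = u00 init kappa_pos qg
    let ?U = "\<lambda>s. restart_u P u00 K s N"
    let ?R = "seqs (seqs {..<nhat P} 0 (Suc K)) (\<lambda>_. 0) (Suc N)"
    have pot: "avg ?R (\<lambda>s. potential (?U s)) \<le> rho ^ N * potential u00"
      using Eruns_potential[OF r] unfolding rho_def .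
    define W where "W = avg ?R (\<lambda>s. nsq P (?U s - ProjD P (?U s)))"
    have part1: "ereal (1 - theta P 0) * (expectE (nhat P) N K (\<lambda>s. Dfun P (?U s)) - Dfun P ust)
         + ereal (expect (nhat P) N K (\<lambda>s. (normL P (?U s - ProjD P (?U s)))\<^sup>2))
         \<le> ereal (rho ^ N) * T00"
    proof (cases "nhat P = 1")
      case True
      have "W \<le> rho ^ N * potential u00"
        using pot c1[OF True] unfolding potential_def W_def c_def by simp
      then show ?thesis unfolding T00 normL_nsq(2) expect_avg W_def[symmetric] c_def[symmetric] c1[OF True]
        by (simp flip: zero_ereal_def)
    next
      case False
      have dom: "indom P (?U s)" if "s \<in> ?R" for s
        using restart_indom[OF u00 init, of s K N] runs_good[OF u00 init that] False by blast
      have "(\<Sum>s\<in>?R. Dfun P (?U s)) = (\<Sum>s\<in>?R. ereal (dval P (?U s) + Hr P (?U s)))"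
        using Dfun_real[OF dom] by (intro sum.cong) auto
      moreover have "card ?R \<noteq> 0" using runs_fin[OF u00 init, of K "Suc N"] by simp
      ultimately have "expectE (nhat P) N K (\<lambda>s. Dfun P (?U s)) = ereal (avg ?R (\<lambda>s. dval P (?U s) + Hr P (?U s)))"
        unfolding expectE_def index_seqs_eq avg_def by simp
      moreover have "c * (avg ?R (\<lambda>s. dval P (?U s) + Hr P (?U s)) - Dopt) + W \<le> rho ^ N * potential u00"
        using pot unfolding potential_def W_def c_def avg_add avg_diff avg_cmult
          avg_const[OF runs_fin[OF u00 init]] .
      ultimately show ?thesis unfolding T00 Dopt normL_nsq(2) expect_avg W_def[symmetric] c_def by simp
    qed
    show ?thesis
    proof (intro conjI part1 allI impI, elim conjE)
      fix CD ups
      assume h: "\<forall>w\<in>Dstar P. normL P w \<le> CD" "nhat P \<le> K" "1 < ups"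
        "int K0 \<le> \<lfloor>real K / (ups * (1 + 1 / real (nhat P))) + 1\<rfloor>"
      define T Rh where "T = potential u00" and "Rh = rho powr (real N / 2)"
      note b = restart_primal_bounds[OF r h, of N, folded rho_def expect_avg T_def, folded Rh_def]
      have "0 \<le> CD" using h(1) ust normL_nonneg[of ust] by force
      moreover have T: "0 \<le> T" using potential_nonneg[OF u00 init, of "\<lambda>_ _. 0" K 0] n1 unfolding T_def good_def by simp
      ultimately have x: "0 \<le> 2 * sqrt (real (mm P)) * CD * sqrt T / sqrt (1 - 1 / ups) * Rh"
        using h(3) unfolding Rh_def by simp
      have y: "0 \<le> 6 * MM P * sqrt (\<Sum>i<nn P. Lc P i) * sqrt T / (1 - 1 / ups) * Rh"
        using h(3) T MM_nonneg Lc_pos unfolding Rh_def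
        by (intro mult_nonneg_nonneg divide_nonneg_nonneg real_sqrt_ge_zero sum_nonneg)
          (auto simp: nhat_def less_imp_le)
      have z: "0 \<le> 2 * T / (1 - 1 / ups) * rho ^ N" using h(3) T rho by simp
      have "\<bar>expect (nhat P) N K (\<lambda>s. Fobj P (restart_xhat P u00 K0 K s N)) - Fobj P xopt\<bar>
        \<le> ((6 * CD * sqrt T + 6 * MM P * sqrt (\<Sum>i<nn P. Lc P i) * sqrt T) / (1 - 1 / ups)
             + 2 * sqrt (real (mm P)) * CD * sqrt T / sqrt (1 - 1 / ups)) * Rh + 2 * T / (1 - 1 / ups) * rho ^ N"
        using b(2,3) x y z unfolding strong_duality[OF xopt] distrib_right add_divide_distrib abs_le_iff
        by (intro conjI) linarith+
      then show "let T = real_of_ereal T00;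
              C1 = (6 * CD * sqrt T + 6 * MM P * sqrt (\<Sum>i<nn P. Lc P i) * sqrt T) / (1 - 1 / ups)
                   + 2 * sqrt (real (mm P)) * CD * sqrt T / sqrt (1 - 1 / ups);
              C2 = 2 * T / (1 - 1 / ups);
              C3 = 6 * sqrt T / (1 - 1 / ups)
          in \<bar>expect (nhat P) N K (\<lambda>s. Fobj P (restart_xhat P u00 K0 K s N)) - Fobj P xopt\<bar>
               \<le> C1 * rho powr (real N / 2) + C2 * rho ^ N
           \<and> expect (nhat P) N K (\<lambda>s. constr_dnorm P (restart_xhat P u00 K0 K s N))
               \<le> C3 * rho powr (real N / 2)"
        using b(1) unfolding Let_def T00 real_of_ereal.simps T_def[symmetric] Rh_def[symmetric] by blast
    qed
  qed
qed

end
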